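(* Consider the primal problem of minimizing $$\frac12\iint_Q|y-y_d|^2\,dx\,dt+\frac{\gamma}{2}\iint_{\mathcal{O}}|u|^2\,dx\,dt$$ over $u\in\mathcal{C}$, where $y$ solves $$\frac{\partial y}{\partial t}-\nu\Delta y+a_0y=u\chi_{\mathcal{O}}\ \text{ in }\Omega\times(0,T),\qquad y=0\ \text{ on }\Gamma\times(0,T),\qquad y(0)=0,$$ and the dual problem of minimizing $$J(q)=\langle p,\operatorname{Pr}_{\mathcal{C}}(\tfrac{p}{\gamma})\rangle_{L^2(\mathcal{O})}-\frac{\gamma}{2}\|\operatorname{Pr}_{\mathcal{C}}(\tfrac{p}{\gamma})\|^2_{L^2(\mathcal{O})}-\langle q,y_d\rangle_{L^2(Q)}+\frac12\|q\|^2_{L^2(Q)}$$ over $q\in L^2(Q)$, where $p$ solves $$\frac{\partial p}{\partial t}+\nu\Delta p-a_0p=-q\ \text{ in }\Omega\times(0,T),\qquad p=0\ \text{ on }\Gamma\times(0,T),\qquad p(T)=0.$$ Let $\bar u$ be the solution of the primal problem with corresponding state $\bar y$, and let $\bar q$ be the solution of the dual problem with corresponding state $\bar p$. Then $$\bar u=\operatorname{Pr}_{\mathcal{C}}\Big(\frac{\bar p}{\gamma}\Big)\ \text{ in } L^2(\mathcal{O}),\qquad \bar y=y_d-\bar q\ \text{ in } L^2(Q).$$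
   Context: $\Omega\subset\mathbb{R}^n$ is a domain with piecewise continuous boundary $\Gamma=\partial\Omega$, $0<T<\infty$, $Q=\Omega\times(0,T)$, $O\subset\Omega$ is open and $\mathcal{O}=O\times(0,T)$ with characteristic function $\chi_{\mathcal{O}}$. $\nu>0$ and $\gamma>0$ are constants, $a_0\in L^\infty(Q)$ with $a_0\ge 0$, $y_d\in L^2(Q)$, and $a\le 0\le b$ are real constants. The set $\mathcal{C}=\{u\in L^2(\mathcal{O}) : a\le u(x,t)\le b \text{ a.e. in } \mathcal{O}\}$, and $\operatorname{Pr}_{\mathcal{C}}(v)(x,t)=\min\{b,\max\{a,v(x,t)\}\}$ is the projection onto $\mathcal{C}$. Terms on $\mathcal{O}$ involving $p$ use the restriction of $p$ to $\mathcal{O}$. Both problems have unique solutions. Solutions of the parabolic equations are understood in the usual weak sense with homogeneous Dirichlet boundary condition. *)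

theory Defs
  imports "HOL-Analysis.Analysis"
begin

section \<open>Domains with piecewise continuous boundary\<close>

text \<open>
  Near each of its points, the boundary consists of finitely many continuous hypersurface patches.
  A patch is a compact set homeomorphic to a subset of a coordinate hyperplane; this covers
  boundaries that are locally finite unions of graphs of continuous functions. Boundedness of the
  domain is not required.
\<close>

definition piecewise_continuous_boundary :: "(real^'n) set \<Rightarrow> bool" where
  "piecewise_continuous_boundary \<Omega> \<longleftrightarrow>
     (\<forall>x\<in>frontier \<Omega>. \<exists>U \<S>. open U \<and> x \<in> U \<and> finite \<S> \<and>
        frontier \<Omega> \<inter> U \<subseteq> \<Union>\<S> \<and> \<Union>\<S> \<subseteq> frontier \<Omega> \<and>
        (\<forall>S\<in>\<S>. compact S \<and> (\<exists>k D. D \<subseteq> {z::real^'n. z $ k = 0} \<and> S homeomorphic D)))"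

definition is_domain :: "'a::topological_space set \<Rightarrow> bool" where
  "is_domain \<Omega> \<longleftrightarrow> open \<Omega> \<and> connected \<Omega> \<and> \<Omega> \<noteq> {}"


section \<open>Lebesgue spaces\<close>

text \<open>
  Elements are represented by total functions, of which only the values on the given set matter;
  equality of elements is equality almost everywhere on that set.
\<close>

definition L2 :: "'a::euclidean_space set \<Rightarrow> ('a \<Rightarrow> 'b::euclidean_space) set" where
  "L2 S = {f. f \<in> borel_measurable (lebesgue_on S) \<and>
              integrable (lebesgue_on S) (\<lambda>z. (norm (f z))\<^sup>2)}"

definition Linf :: "'a::euclidean_space set \<Rightarrow> ('a \<Rightarrow> real) set" where
  "Linf S = {f. f \<in> borel_measurable (lebesgue_on S) \<and>
                (\<exists>M. AE z in lebesgue_on S. \<bar>f z\<bar> \<le> M)}"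

definition L2_inner :: "'a::euclidean_space set \<Rightarrow> ('a \<Rightarrow> 'b::euclidean_space) \<Rightarrow> ('a \<Rightarrow> 'b) \<Rightarrow> real" where
  "L2_inner S f g = (LINT z|lebesgue_on S. f z \<bullet> g z)"

definition L2_norm :: "'a::euclidean_space set \<Rightarrow> ('a \<Rightarrow> 'b::euclidean_space) \<Rightarrow> real" where
  "L2_norm S f = sqrt (LINT z|lebesgue_on S. (norm (f z))\<^sup>2)"

definition L2_eq :: "'a::euclidean_space set \<Rightarrow> ('a \<Rightarrow> 'b::euclidean_space) \<Rightarrow> ('a \<Rightarrow> 'b) \<Rightarrow> bool" where
  "L2_eq S f g \<longleftrightarrow> f \<in> L2 S \<and> g \<in> L2 S \<and> (AE z in lebesgue_on S. f z = g z)"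


section \<open>Test functions and the energy space\<close>

text \<open>
  On space-time \<open>real^'n \<times> real\<close> the gradient splits as \<open>grad \<phi> z = (\<nabla>\<^sub>x \<phi> z, \<partial>\<^sub>t \<phi> z)\<close>.
\<close>

definition grad :: "('a::real_inner \<Rightarrow> real) \<Rightarrow> 'a \<Rightarrow> 'a" where
  "grad \<phi> z = (THE D. GDERIV \<phi> z :> D)"

definition space_grad :: "((real^'n) \<times> real \<Rightarrow> real) \<Rightarrow> (real^'n) \<times> real \<Rightarrow> real^'n" where
  "space_grad \<phi> z = fst (grad \<phi> z)"

definition time_deriv :: "((real^'n) \<times> real \<Rightarrow> real) \<Rightarrow> (real^'n) \<times> real \<Rightarrow> real" where
  "time_deriv \<phi> z = snd (grad \<phi> z)"

definition C1_compact :: "'a::real_inner set \<Rightarrow> ('a \<Rightarrow> real) set" where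
  "C1_compact U = {\<phi>. (\<forall>z. \<exists>D. GDERIV \<phi> z :> D) \<and> continuous_on UNIV (grad \<phi>) \<and>
                       (\<exists>K. compact K \<and> K \<subseteq> U \<and> (\<forall>z. z \<notin> K \<longrightarrow> \<phi> z = 0))}"

abbreviation cylinder :: "'a set \<Rightarrow> real \<Rightarrow> ('a \<times> real) set" where
  "cylinder S T \<equiv> S \<times> {0<..<T}"

text \<open>
  \<open>energy_space \<Omega> T y g\<close> says that \<open>y\<close> belongs to \<open>L\<^sup>2(0,T;H\<^sup>1\<^sub>0(\<Omega>))\<close>, with weak spatial gradient \<open>g\<close>.
  The space is defined as the closure, in the norm \<open>(\<parallel>y\<parallel>\<^sup>2 + \<parallel>\<nabla>\<^sub>x y\<parallel>\<^sup>2)\<^sup>1\<^sup>/\<^sup>2\<close> of \<open>L\<^sup>2(0,T;H\<^sup>1(\<Omega>))\<close>, of the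
  regular functions that vanish near the lateral boundary (Ladyzhenskaya, Solonnikov and Uraltseva);
  this is where the homogeneous Dirichlet condition enters. The functions in \<open>C1_compact (\<Omega> \<times> UNIV)\<close>
  need not vanish at \<open>t = 0\<close> or \<open>t = T\<close>.
\<close>

definition energy_space ::
  "(real^'n) set \<Rightarrow> real \<Rightarrow> ((real^'n) \<times> real \<Rightarrow> real) \<Rightarrow> ((real^'n) \<times> real \<Rightarrow> real^'n) \<Rightarrow> bool" where
  "energy_space \<Omega> T y g \<longleftrightarrow>
     y \<in> L2 (cylinder \<Omega> T) \<and> g \<in> L2 (cylinder \<Omega> T) \<and>
     (\<exists>\<phi>::nat \<Rightarrow> (real^'n) \<times> real \<Rightarrow> real.
        (\<forall>k. \<phi> k \<in> C1_compact (\<Omega> \<times> UNIV)) \<and>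
        (\<lambda>k. L2_norm (cylinder \<Omega> T) (\<lambda>z. \<phi> k z - y z)) \<longlonglongrightarrow> 0 \<and>
        (\<lambda>k. L2_norm (cylinder \<Omega> T) (\<lambda>z. space_grad (\<phi> k) z - g z)) \<longlonglongrightarrow> 0)"


section \<open>Weak solutions\<close>

text \<open>
  \<open>\<partial>\<^sub>t y - \<nu> \<Delta> y + a\<^sub>0 y = f\<close> in \<open>\<Omega> \<times> (0,T)\<close>, \<open>y = 0\<close> on the lateral boundary, \<open>y(0) = 0\<close>.
  The test functions vanish near \<open>t = T\<close> but are arbitrary at \<open>t = 0\<close>; integration by parts in time
  leaves the term \<open>\<integral> y(x,0) \<phi>(x,0) dx\<close>, and its absence encodes the initial condition.
\<close>

definition weak_forward ::
  "(real^'n) set \<Rightarrow> real \<Rightarrow> real \<Rightarrow> ((real^'n) \<times> real \<Rightarrow> real) \<Rightarrow>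
   ((real^'n) \<times> real \<Rightarrow> real) \<Rightarrow> ((real^'n) \<times> real \<Rightarrow> real) \<Rightarrow> bool" where
  "weak_forward \<Omega> T \<nu> a0 f y \<longleftrightarrow>
     (\<exists>g. energy_space \<Omega> T y g \<and>
       (\<forall>\<phi>\<in>C1_compact (\<Omega> \<times> {..<T}).
          (LINT z|lebesgue_on (cylinder \<Omega> T).
             - (y z * time_deriv \<phi> z) + \<nu> * (g z \<bullet> space_grad \<phi> z) + a0 z * y z * \<phi> z)
          = (LINT z|lebesgue_on (cylinder \<Omega> T). f z * \<phi> z)))"

text \<open>
  \<open>\<partial>\<^sub>t p + \<nu> \<Delta> p - a\<^sub>0 p = f\<close> in \<open>\<Omega> \<times> (0,T)\<close>, \<open>p = 0\<close> on the lateral boundary, \<open>p(T) = 0\<close>; here the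
  test functions vanish near \<open>t = 0\<close> and are arbitrary at \<open>t = T\<close>.
\<close>

definition weak_backward ::
  "(real^'n) set \<Rightarrow> real \<Rightarrow> real \<Rightarrow> ((real^'n) \<times> real \<Rightarrow> real) \<Rightarrow>
   ((real^'n) \<times> real \<Rightarrow> real) \<Rightarrow> ((real^'n) \<times> real \<Rightarrow> real) \<Rightarrow> bool" where
  "weak_backward \<Omega> T \<nu> a0 f p \<longleftrightarrow>
     (\<exists>g. energy_space \<Omega> T p g \<and>
       (\<forall>\<phi>\<in>C1_compact (\<Omega> \<times> {0<..}).
          (LINT z|lebesgue_on (cylinder \<Omega> T).
             - (p z * time_deriv \<phi> z) - \<nu> * (g z \<bullet> space_grad \<phi> z) - a0 z * p z * \<phi> z)
          = (LINT z|lebesgue_on (cylinder \<Omega> T). f z * \<phi> z)))"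


section \<open>The primal and the dual problem\<close>

definition control_set :: "'a::euclidean_space set \<Rightarrow> real \<Rightarrow> real \<Rightarrow> ('a \<Rightarrow> real) set" where
  "control_set S a b = {u \<in> L2 S. AE z in lebesgue_on S. a \<le> u z \<and> u z \<le> b}"

definition Pr_box :: "real \<Rightarrow> real \<Rightarrow> ('a \<Rightarrow> real) \<Rightarrow> 'a \<Rightarrow> real" where
  "Pr_box a b v z = min b (max a (v z))"

text \<open>Here \<open>W\<close> is the control region, an open subset of \<open>\<Omega>\<close>.\<close>

definition primal_feasible where
  "primal_feasible \<Omega> W T \<nu> a0 a b u y \<longleftrightarrow>
     u \<in> control_set (cylinder W T) a b \<and>
     weak_forward \<Omega> T \<nu> a0 (\<lambda>z. u z * indicator (cylinder W T) z) y"

definition primal_cost ::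
  "(real^'n) set \<Rightarrow> (real^'n) set \<Rightarrow> real \<Rightarrow> real \<Rightarrow> ((real^'n) \<times> real \<Rightarrow> real) \<Rightarrow>
   ((real^'n) \<times> real \<Rightarrow> real) \<Rightarrow> ((real^'n) \<times> real \<Rightarrow> real) \<Rightarrow> real" where
  "primal_cost \<Omega> W T \<gamma> yd u y =
     1 / 2 * (LINT z|lebesgue_on (cylinder \<Omega> T). \<bar>y z - yd z\<bar>\<^sup>2) +
     \<gamma> / 2 * (LINT z|lebesgue_on (cylinder W T). \<bar>u z\<bar>\<^sup>2)"

definition primal_solution where
  "primal_solution \<Omega> W T \<nu> \<gamma> a0 yd a b u y \<longleftrightarrow>
     primal_feasible \<Omega> W T \<nu> a0 a b u y \<and>
     (\<forall>v w. primal_feasible \<Omega> W T \<nu> a0 a b v w \<longrightarrow>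
        primal_cost \<Omega> W T \<gamma> yd u y \<le> primal_cost \<Omega> W T \<gamma> yd v w)"

definition dual_feasible where
  "dual_feasible \<Omega> T \<nu> a0 q p \<longleftrightarrow>
     q \<in> L2 (cylinder \<Omega> T) \<and> weak_backward \<Omega> T \<nu> a0 (\<lambda>z. - q z) p"

definition dual_cost ::
  "(real^'n) set \<Rightarrow> (real^'n) set \<Rightarrow> real \<Rightarrow> real \<Rightarrow> ((real^'n) \<times> real \<Rightarrow> real) \<Rightarrow> real \<Rightarrow> real \<Rightarrow>
   ((real^'n) \<times> real \<Rightarrow> real) \<Rightarrow> ((real^'n) \<times> real \<Rightarrow> real) \<Rightarrow> real" where
  "dual_cost \<Omega> W T \<gamma> yd a b q p =
     L2_inner (cylinder W T) p (Pr_box a b (\<lambda>z. p z / \<gamma>))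
     - \<gamma> / 2 * (L2_norm (cylinder W T) (Pr_box a b (\<lambda>z. p z / \<gamma>)))\<^sup>2
     - L2_inner (cylinder \<Omega> T) q yd
     + 1 / 2 * (L2_norm (cylinder \<Omega> T) q)\<^sup>2"

definition dual_solution where
  "dual_solution \<Omega> W T \<nu> \<gamma> a0 yd a b q p \<longleftrightarrow>
     dual_feasible \<Omega> T \<nu> a0 q p \<and>
     (\<forall>r s. dual_feasible \<Omega> T \<nu> a0 r s \<longrightarrow>
        dual_cost \<Omega> W T \<gamma> yd a b q p \<le> dual_cost \<Omega> W T \<gamma> yd a b r s)"

end

theory Submission
  imports Defs
begin

text \<open>
  Testing the state equation with the adjoint state and conversely gives
  \<open>\<langle>v, s\<rangle> = \<langle>w, r\<rangle>\<close> for a control \<open>v\<close> with state \<open>w\<close> and an \<open>r\<close> with adjoint state \<open>s\<close>. Hence, with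
  \<open>\<pi> = Pr (s / \<gamma>)\<close>, the sum of the primal and the dual cost is
  \<open>\<parallel>w - (yd - r)\<parallel>\<^sup>2 / 2\<close> plus a gap that dominates \<open>\<gamma> \<parallel>v - \<pi>\<parallel>\<^sup>2 / 2\<close>. The adjoint state of \<open>yd - y\<close> makes
  this sum vanish at the primal optimum, so it also vanishes at the pair of optima.

  The identity is proved for weak solutions by mollifying, in time only, the smooth functions that
  approximate them: a one-sided kernel \<open>\<eta>\<close> and its reflection turn the approximations of one
  solution into admissible test functions for the other, and the time derivative and gradient terms
  cancel because convolution with the reflected kernel is the transpose. Existence is Lions'
  projection theorem.
\<close>

section \<open>The Hilbert space \<open>L2\<close>\<close>

text \<open>A weak solution is only an \<open>L2\<close> limit of smooth functions, with a time
  derivative in the sense of distributions. It cannot be inserted into the other equation, whose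
  test functions must moreover vanish near one end of the time interval. Convolution in time alone
  leaves the spatial support inside \<open>\<Omega>\<close>, so the Dirichlet condition survives,
  and it moves the time derivative to the kernel, so that only \<open>L2\<close> convergence of the
  approximants and of their spatial gradients is used. The kernel is supported in
  \<open>[d, 4d]\<close> rather than around 0: the average at time t then looks only at times from t
  + d on and vanishes for t > T - d, while the reflected one looks back and vanishes for t < d.
  Existence is called upon twice: for the adjoint state of the optimal residual, and for the state
  of its projected control, the direction in which the optimal control is varied. Elements of
  \<open>L2\<close> are functions rather than classes, hence completeness and Riesz representation
  are proved in a form that never passes to a quotient.\<close>

lemma L2D:
  assumes "f \<in> L2 S"
  shows "f \<in> borel_measurable (lebesgue_on S)" "integrable (lebesgue_on S) (\<lambda>z. (norm (f z))\<^sup>2)"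
  using assms by (auto simp: L2_def)

lemma L2_dominated:
  fixes f :: "'a::euclidean_space \<Rightarrow> 'b::euclidean_space"
  assumes "f \<in> borel_measurable (lebesgue_on S)" "integrable (lebesgue_on S) h"
    and "\<And>z. z \<in> S \<Longrightarrow> (norm (f z))\<^sup>2 \<le> h z"
  shows "f \<in> L2 S"
proof -
  have "integrable (lebesgue_on S) (\<lambda>z. (norm (f z))\<^sup>2)"
    by (rule Bochner_Integration.integrable_bound[OF assms(2)])
       (use assms in \<open>auto intro!: AE_I2 simp: space_restrict_space abs_if\<close>, force)
  then show ?thesis using assms(1) by (simp add: L2_def)
qed

lemma L2_scale:
  fixes f :: "'a::euclidean_space \<Rightarrow> 'b::euclidean_space"
  assumes "f \<in> L2 S" shows "(\<lambda>z. c *\<^sub>R f z) \<in> L2 S"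
  using assms by (auto simp: L2_def power_mult_distrib)

lemma L2_add:
  fixes f g :: "'a::euclidean_space \<Rightarrow> 'b::euclidean_space"
  assumes "f \<in> L2 S" "g \<in> L2 S" shows "(\<lambda>z. f z + g z) \<in> L2 S"
proof (rule L2_dominated)
  show "(\<lambda>z. f z + g z) \<in> borel_measurable (lebesgue_on S)"
    using L2D[OF assms(1)] L2D[OF assms(2)] by measurable
  show "integrable (lebesgue_on S) (\<lambda>z. 2 * (norm (f z))\<^sup>2 + 2 * (norm (g z))\<^sup>2)"
    using L2D[OF assms(1)] L2D[OF assms(2)] by simp
  fix z
  have "(norm (f z + g z))\<^sup>2 \<le> (norm (f z) + norm (g z))\<^sup>2"
    by (intro power_mono norm_triangle_ineq) simp
  also have "\<dots> \<le> 2 * (norm (f z))\<^sup>2 + 2 * (norm (g z))\<^sup>2"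
    using sum_squares_bound[of "norm (f z)" "norm (g z)"] by (simp add: power2_sum)
  finally show "(norm (f z + g z))\<^sup>2 \<le> 2 * (norm (f z))\<^sup>2 + 2 * (norm (g z))\<^sup>2" .
qed

lemma L2_diff:
  fixes f g :: "'a::euclidean_space \<Rightarrow> 'b::euclidean_space"
  assumes "f \<in> L2 S" "g \<in> L2 S" shows "(\<lambda>z. f z - g z) \<in> L2 S"
  using L2_add[OF assms(1) L2_scale[OF assms(2), of "-1"]] by simp

lemma L2_mult:
  fixes f :: "'a::euclidean_space \<Rightarrow> real"
  assumes "f \<in> L2 S" shows "(\<lambda>z. c * f z) \<in> L2 S"
  using L2_scale[OF assms, of c] by simp

lemma L2_inner_integrable:
  fixes f g :: "'a::euclidean_space \<Rightarrow> 'b::euclidean_space"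
  assumes "f \<in> L2 S" "g \<in> L2 S"
  shows "integrable (lebesgue_on S) (\<lambda>z. f z \<bullet> g z)"
proof (rule Bochner_Integration.integrable_bound)
  show "integrable (lebesgue_on S) (\<lambda>z. (norm (f z))\<^sup>2 + (norm (g z))\<^sup>2)"
    using L2D[OF assms(1)] L2D[OF assms(2)] by simp
  show "(\<lambda>z. f z \<bullet> g z) \<in> borel_measurable (lebesgue_on S)"
    using L2D[OF assms(1)] L2D[OF assms(2)] by measurable
  have "norm (f z \<bullet> g z) \<le> norm ((norm (f z))\<^sup>2 + (norm (g z))\<^sup>2)" for z
  proof -
    have "norm (f z \<bullet> g z) \<le> norm (f z) * norm (g z)" by (simp add: Cauchy_Schwarz_ineq2)
    also have "\<dots> \<le> (norm (f z))\<^sup>2 + (norm (g z))\<^sup>2"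
      using sum_squares_bound[of "norm (f z)" "norm (g z)"] mult_nonneg_nonneg[OF norm_ge_zero norm_ge_zero, of "f z" "g z"] by linarith
    finally show ?thesis by simp
  qed
  then show "AE z in lebesgue_on S. norm (f z \<bullet> g z) \<le> norm ((norm (f z))\<^sup>2 + (norm (g z))\<^sup>2)"
    by auto
qed

lemma L2_inner_commute: "L2_inner S f g = L2_inner S g f"
  by (simp add: L2_inner_def inner_commute)

lemma L2_inner_add_left:
  assumes "f \<in> L2 S" "g \<in> L2 S" "h \<in> L2 S"
  shows "L2_inner S (\<lambda>z. f z + g z) h = L2_inner S f h + L2_inner S g h"
  unfolding L2_inner_def
  using L2_inner_integrable[OF assms(1,3)] L2_inner_integrable[OF assms(2,3)]
  by (simp add: inner_add_left)

lemma L2_inner_diff_left: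
  assumes "f \<in> L2 S" "g \<in> L2 S" "h \<in> L2 S"
  shows "L2_inner S (\<lambda>z. f z - g z) h = L2_inner S f h - L2_inner S g h"
  unfolding L2_inner_def
  using L2_inner_integrable[OF assms(1,3)] L2_inner_integrable[OF assms(2,3)]
  by (simp add: inner_diff_left)

lemma L2_inner_scale_left: "L2_inner S (\<lambda>z. c *\<^sub>R f z) h = c * L2_inner S f h"
  unfolding L2_inner_def by simp

lemma L2_inner_mult_left:
  fixes f :: "'a::euclidean_space \<Rightarrow> real"
  shows "L2_inner S (\<lambda>z. c * f z) h = c * L2_inner S f h"
  using L2_inner_scale_left[of S c f h] by simp

lemma L2_inner_add_right:
  assumes "f \<in> L2 S" "g \<in> L2 S" "h \<in> L2 S"
  shows "L2_inner S h (\<lambda>z. f z + g z) = L2_inner S h f + L2_inner S h g"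
  using L2_inner_add_left[OF assms] by (simp add: L2_inner_commute)

lemma L2_inner_diff_right:
  assumes "f \<in> L2 S" "g \<in> L2 S" "h \<in> L2 S"
  shows "L2_inner S h (\<lambda>z. f z - g z) = L2_inner S h f - L2_inner S h g"
  using L2_inner_diff_left[OF assms] by (simp add: L2_inner_commute)

lemma L2_inner_scale_right: "L2_inner S h (\<lambda>z. c *\<^sub>R f z) = c * L2_inner S h f"
  unfolding L2_inner_def by simp

lemma L2_norm_nonneg [simp]: "0 \<le> L2_norm S f"
  by (simp add: L2_norm_def)

lemma L2_norm_zero [simp]: "L2_norm S (\<lambda>z. 0) = 0"
  by (simp add: L2_norm_def)

lemma L2_norm_sq: "(L2_norm S f)\<^sup>2 = L2_inner S f f"
  by (simp add: L2_norm_def L2_inner_def power2_norm_eq_inner)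

lemma L2_norm_scale: "L2_norm S (\<lambda>z. c *\<^sub>R f z) = \<bar>c\<bar> * L2_norm S f"
  by (simp add: L2_norm_def power_mult_distrib real_sqrt_mult)

lemma L2_norm_minus_commute: "L2_norm S (\<lambda>z. f z - g z) = L2_norm S (\<lambda>z. g z - f z)"
  by (simp add: L2_norm_def norm_minus_commute)

text \<open>The values 1 and -1 of \<open>c\<close> give polarization and the parallelogram law; a
  free \<open>c\<close> gives the discriminant argument for Cauchy-Schwarz and the expansion of the
  cost along a segment.\<close>

lemma L2_norm_sq_add:
  assumes "f \<in> L2 S" "g \<in> L2 S"
  shows "(L2_norm S (\<lambda>z. f z + c *\<^sub>R g z))\<^sup>2
       = (L2_norm S f)\<^sup>2 + 2 * c * L2_inner S f g + c\<^sup>2 * (L2_norm S g)\<^sup>2"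
  unfolding L2_norm_sq using assms L2_scale[OF assms(2), of c]
  by (simp add: L2_inner_add_left L2_inner_add_right L2_add L2_inner_scale_left
      L2_inner_scale_right L2_inner_commute[of S g f] power2_eq_square algebra_simps)

text \<open>A quadratic in \<open>c\<close> that is nonnegative everywhere has nonpositive
  discriminant; a vanishing leading coefficient is treated apart.\<close>

lemma L2_Cauchy_Schwarz:
  assumes "f \<in> L2 S" "g \<in> L2 S"
  shows "\<bar>L2_inner S f g\<bar> \<le> L2_norm S f * L2_norm S g"
proof -
  define A B C where "A = (L2_norm S f)\<^sup>2" and "B = L2_inner S f g" and "C = (L2_norm S g)\<^sup>2"
  have q: "0 \<le> A + 2 * c * B + c\<^sup>2 * C" for c
    using L2_norm_sq_add[OF assms, of c] unfolding A_def B_def C_def by (metis zero_le_power2)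
  have "B\<^sup>2 \<le> A * C"
  proof (cases "C = 0")
    case True
    have "B = 0"
    proof (rule ccontr)
      assume "B \<noteq> 0"
      \<comment> \<open>The quadratic is now affine, and this \<open>c\<close> gives it the value
        -1.\<close>
      then show False using q[of "- (A + 1) / (2 * B)"] True by (simp add: field_simps)
    qed
    then show ?thesis using True by simp
  next
    case False
    then have "C > 0" unfolding C_def by simp
    then show ?thesis using q[of "- B / C"] by (simp add: field_simps power2_eq_square)
  qed
  then have "B\<^sup>2 \<le> (L2_norm S f * L2_norm S g)\<^sup>2" by (simp add: A_def C_def power_mult_distrib)
  then show ?thesis unfolding B_def by (metis abs_le_square_iff abs_of_nonneg L2_norm_nonneg mult_nonneg_nonneg)
qed

lemma L2_norm_triangle:
  assumes "f \<in> L2 S" "g \<in> L2 S"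
  shows "L2_norm S (\<lambda>z. f z + g z) \<le> L2_norm S f + L2_norm S g"
proof (rule power2_le_imp_le)
  show "(L2_norm S (\<lambda>z. f z + g z))\<^sup>2 \<le> (L2_norm S f + L2_norm S g)\<^sup>2"
    using L2_norm_sq_add[OF assms, of 1] L2_Cauchy_Schwarz[OF assms] by (simp add: power2_sum)
qed (simp add: add_nonneg_nonneg)

lemma L2_norm_triangle_diff:
  assumes "f \<in> L2 S" "g \<in> L2 S" "h \<in> L2 S"
  shows "L2_norm S (\<lambda>z. f z - h z) \<le> L2_norm S (\<lambda>z. f z - g z) + L2_norm S (\<lambda>z. g z - h z)"
  using L2_norm_triangle[OF L2_diff[OF assms(1,2)] L2_diff[OF assms(2,3)]] by simp

lemma L2_norm_mono:
  assumes "f \<in> L2 S" "g \<in> L2 S" "\<And>z. z \<in> S \<Longrightarrow> norm (f z) \<le> norm (g z)"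
  shows "L2_norm S f \<le> L2_norm S g"
  unfolding L2_norm_def
proof (intro real_sqrt_le_mono integral_mono)
  show "integrable (lebesgue_on S) (\<lambda>z. (norm (f z))\<^sup>2)" "integrable (lebesgue_on S) (\<lambda>z. (norm (g z))\<^sup>2)"
    using L2D(2)[OF assms(1)] L2D(2)[OF assms(2)] by auto
  show "\<And>x. x \<in> space (lebesgue_on S) \<Longrightarrow> (norm (f x))\<^sup>2 \<le> (norm (g x))\<^sup>2"
    using assms(3) by (auto simp: space_restrict_space intro!: power_mono)
qed

lemma L2_norm_eq_0_AE:
  assumes "f \<in> L2 S" "L2_norm S f = 0"
  shows "AE z in lebesgue_on S. f z = 0"
  using integral_nonneg_eq_0_iff_AE[OF L2D(2)[OF assms(1)]] assms(2)
  by (auto simp: L2_norm_def)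

lemma L2_inner_tendsto:
  assumes "\<And>k. F k \<in> L2 S" "f \<in> L2 S" "g \<in> L2 S"
    and "(\<lambda>k. L2_norm S (\<lambda>z. F k z - f z)) \<longlonglongrightarrow> 0"
  shows "(\<lambda>k. L2_inner S (F k) g) \<longlonglongrightarrow> L2_inner S f g"
proof -
  have "(\<lambda>k. L2_inner S (F k) g - L2_inner S f g) \<longlonglongrightarrow> 0"
  proof (rule Lim_null_comparison)
    show "(\<lambda>k. L2_norm S (\<lambda>z. F k z - f z) * L2_norm S g) \<longlonglongrightarrow> 0"
      using tendsto_mult_right[OF assms(4), of "L2_norm S g"] by simp
    show "\<forall>\<^sub>F k in sequentially. norm (L2_inner S (F k) g - L2_inner S f g)
          \<le> L2_norm S (\<lambda>z. F k z - f z) * L2_norm S g"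
      using L2_Cauchy_Schwarz[OF L2_diff[OF assms(1,2)] assms(3)] assms
      by (intro always_eventually) (simp add: L2_inner_diff_left)
  qed
  then show ?thesis by (simp add: LIM_zero_iff)
qed

lemma L2_norm_tendsto:
  assumes "\<And>k. F k \<in> L2 S" "f \<in> L2 S"
    and "(\<lambda>k. L2_norm S (\<lambda>z. F k z - f z)) \<longlonglongrightarrow> 0"
  shows "(\<lambda>k. L2_norm S (F k)) \<longlonglongrightarrow> L2_norm S f"
proof -
  have "(\<lambda>k. L2_norm S (F k) - L2_norm S f) \<longlonglongrightarrow> 0"
  proof (rule Lim_null_comparison[OF always_eventually assms(3)], rule allI)
    fix k
    have "L2_norm S (F k) \<le> L2_norm S (\<lambda>z. F k z - f z) + L2_norm S f"
      using L2_norm_triangle[OF L2_diff[OF assms(1)[of k] assms(2)] assms(2)] by simp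
    moreover have "L2_norm S f \<le> L2_norm S (\<lambda>z. f z - F k z) + L2_norm S (F k)"
      using L2_norm_triangle[OF L2_diff[OF assms(2) assms(1)[of k]] assms(1)[of k]] by simp
    ultimately show "norm (L2_norm S (F k) - L2_norm S f) \<le> L2_norm S (\<lambda>z. F k z - f z)"
      using L2_norm_minus_commute[of S f "F k"] by simp
  qed
  then show ?thesis by (simp add: LIM_zero_iff)
qed

section \<open>Completeness of \<open>L2\<close> and Riesz representation\<close>

lemma L2_norm_nn_integral:
  assumes "f \<in> L2 S"
  shows "(\<integral>\<^sup>+z. ennreal ((norm (f z))\<^sup>2) \<partial>lebesgue_on S) = ennreal ((L2_norm S f)\<^sup>2)"
  using nn_integral_eq_integral[OF L2D(2)[OF assms]] by (simp add: L2_norm_def integral_nonneg_AE)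

text \<open>Summability of the squared increments does not make the increments summable. The weight
  \<open>(3/2)^k\<close> repairs this: the weighted squares still have integrals of at most
  \<open>(3/8)^k\<close>, and pointwise the arithmetic-geometric mean inequality bounds each
  increment by its weighted square plus \<open>(2/3)^k\<close>.\<close>

lemma L2_subseq_AE_convergent:
  fixes F :: "nat \<Rightarrow> 'a::euclidean_space \<Rightarrow> 'b::euclidean_space"
  assumes F: "\<And>k. F k \<in> L2 S" and fast: "\<And>k. L2_norm S (\<lambda>z. F (Suc k) z - F k z) \<le> (1/2)^k"
  shows "AE z in lebesgue_on S. convergent (\<lambda>k. F k z)"
proof -
  define d where "d k z = norm (F (Suc k) z - F k z)" for k z
  have dL2: "(\<lambda>z. F (Suc k) z - F k z) \<in> L2 S" for k by (intro L2_diff F)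
  have dm[measurable]: "d k \<in> borel_measurable (lebesgue_on S)" for k
    unfolding d_def using L2D(1)[OF dL2[of k]] by measurable
  have "(\<integral>\<^sup>+z. (\<Sum>k. ennreal ((3/2)^k * (d k z)\<^sup>2)) \<partial>lebesgue_on S)
      = (\<Sum>k. \<integral>\<^sup>+z. ennreal ((3/2)^k * (d k z)\<^sup>2) \<partial>lebesgue_on S)"
    by (intro nn_integral_suminf) measurable
  also have "\<dots> = (\<Sum>k. ennreal ((3/2)^k * (L2_norm S (\<lambda>z. F (Suc k) z - F k z))\<^sup>2))"
    by (intro suminf_cong)
      (simp add: ennreal_mult nn_integral_cmult L2_norm_nn_integral[OF dL2, folded d_def])
  also have "\<dots> \<le> (\<Sum>k. ennreal ((3/8)^k))"
  proof (intro suminf_le summableI ennreal_leI)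
    fix k
    have "(3/2)^k * (L2_norm S (\<lambda>z. F (Suc k) z - F k z))\<^sup>2 \<le> (3/2)^k * ((1/2)^k)\<^sup>2"
      by (intro mult_left_mono power_mono fast) auto
    also have "\<dots> = (3/8)^k" by (simp add: power2_eq_square flip: power_mult_distrib)
    finally show "(3/2)^k * (L2_norm S (\<lambda>z. F (Suc k) z - F k z))\<^sup>2 \<le> (3/8)^k" .
  qed
  also have "\<dots> < \<infinity>"
    by (subst suminf_ennreal2) (auto intro: summable_geometric)
  finally have "AE z in lebesgue_on S. (\<Sum>k. ennreal ((3/2)^k * (d k z)\<^sup>2)) \<noteq> \<infinity>"
    by (intro nn_integral_PInf_AE) auto
  then show ?thesis
  proof eventually_elim
    fix z assume "(\<Sum>k. ennreal ((3/2)^k * (d k z)\<^sup>2)) \<noteq> \<infinity>"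
    then have s: "summable (\<lambda>k. (3/2)^k * (d k z)\<^sup>2)"
      by (intro summable_suminf_not_top) auto
    have "summable (\<lambda>k. (3/2)^k * (d k z)\<^sup>2 + (2/3)^k)"
      using s by (intro summable_add summable_geometric) auto
    then have "summable (\<lambda>k. d k z)"
    proof (rule summable_comparison_test'[where N = 0])
      fix k
      have "2 * (d k z) \<le> (3/2)^k * (d k z)\<^sup>2 + (2/3)^k"
      proof -
        define c :: real where "c = (3/2)^k"
        have c: "c > 0" "(2/3)^k = 1 / c" by (auto simp: c_def power_divide)
        \<comment> \<open>Expanded, this is \<open>c * d^2 - 2 * d + 1 / c\<close>, the
          arithmetic-geometric mean inequality for \<open>c * d^2\<close> and
          \<open>1 / c\<close>.\<close>
        have "0 \<le> (c * d k z - 1)\<^sup>2 / c" using c by simp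
        then show ?thesis using c unfolding c_def[symmetric] by (simp add: field_simps power2_eq_square)
      qed
      moreover have "0 \<le> d k z" by (simp add: d_def)
      ultimately show "norm (d k z) \<le> (3/2)^k * (d k z)\<^sup>2 + (2/3)^k" by simp
    qed
    then have "summable (\<lambda>k. F (Suc k) z - F k z)"
      unfolding d_def by (rule summable_norm_cancel)
    then have "convergent (\<lambda>n. \<Sum>k<n. F (Suc k) z - F k z)"
      by (simp add: summable_iff_convergent)
    then have "convergent (\<lambda>n. F n z - F 0 z)"
      by (simp only: sum_lessThan_telescope[of "\<lambda>k. F k z"])
    from convergent_add[OF this convergent_const[of "F 0 z"]]
    show "convergent (\<lambda>k. F k z)" by simp
  qed
qed

text \<open>Fatou's lemma for the squared norms. The limit is only assumed measurable and the bound
  only eventual, because the lemma is applied to tails \<open>F m - F (r j)\<close> with j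
  growing.\<close>

lemma L2_Fatou:
  fixes F :: "nat \<Rightarrow> 'a::euclidean_space \<Rightarrow> 'b::euclidean_space"
  assumes F: "\<And>k. F k \<in> L2 S" and f: "f \<in> borel_measurable (lebesgue_on S)"
    and lim: "AE z in lebesgue_on S. (\<lambda>k. F k z) \<longlonglongrightarrow> f z"
    and bound: "\<forall>\<^sub>F k in sequentially. L2_norm S (F k) \<le> C"
  shows "f \<in> L2 S" "L2_norm S f \<le> C"
proof -
  obtain k where "L2_norm S (F k) \<le> C" using eventually_happens'[OF sequentially_bot bound] by blast
  then have C: "0 \<le> C" using L2_norm_nonneg[of S "F k"] by linarith
  note [measurable] = L2D(1)[OF F] f
  have "(\<integral>\<^sup>+z. ennreal ((norm (f z))\<^sup>2) \<partial>lebesgue_on S)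
      = (\<integral>\<^sup>+z. liminf (\<lambda>k. ennreal ((norm (F k z))\<^sup>2)) \<partial>lebesgue_on S)"
    using lim
  proof (intro nn_integral_cong_AE, eventually_elim)
    fix z assume "(\<lambda>k. F k z) \<longlonglongrightarrow> f z"
    then have "(\<lambda>k. ennreal ((norm (F k z))\<^sup>2)) \<longlonglongrightarrow> ennreal ((norm (f z))\<^sup>2)"
      by (intro tendsto_ennrealI tendsto_power tendsto_norm)
    then show "ennreal ((norm (f z))\<^sup>2) = liminf (\<lambda>k. ennreal ((norm (F k z))\<^sup>2))"
      by (intro lim_imp_Liminf[symmetric]) simp_all
  qed
  also have "\<dots> \<le> liminf (\<lambda>k. \<integral>\<^sup>+z. ennreal ((norm (F k z))\<^sup>2) \<partial>lebesgue_on S)"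
    by (rule nn_integral_liminf) measurable
  also have "\<dots> = liminf (\<lambda>k. ennreal ((L2_norm S (F k))\<^sup>2))"
    by (simp add: L2_norm_nn_integral[OF F])
  also have "\<dots> \<le> liminf (\<lambda>k::nat. ennreal (C\<^sup>2))"
    by (intro Liminf_mono eventually_mono[OF bound] ennreal_leI power_mono L2_norm_nonneg)
  finally have le: "(\<integral>\<^sup>+z. ennreal ((norm (f z))\<^sup>2) \<partial>lebesgue_on S) \<le> ennreal (C\<^sup>2)"
    by (simp add: Liminf_const)
  then have "(\<integral>\<^sup>+z. ennreal ((norm (f z))\<^sup>2) \<partial>lebesgue_on S) < \<infinity>"
    by (rule order_le_less_trans) simp
  then have "integrable (lebesgue_on S) (\<lambda>z. (norm (f z))\<^sup>2)"
    by (intro integrableI_bounded) simp_all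
  then show fL2: "f \<in> L2 S" using f by (simp add: L2_def)
  have "(L2_norm S f)\<^sup>2 \<le> C\<^sup>2" using le unfolding L2_norm_nn_integral[OF fL2] by simp
  then show "L2_norm S f \<le> C" by (rule power2_le_imp_le[OF _ C])
qed

text \<open>Riesz-Fischer: a fast subsequence converges almost everywhere, and Fatou carries the
  Cauchy bound over to its limit, for the whole sequence at once.\<close>

lemma L2_complete:
  fixes F :: "nat \<Rightarrow> 'a::euclidean_space \<Rightarrow> 'b::euclidean_space"
  assumes F: "\<And>k. F k \<in> L2 S"
    and Cauchy: "\<And>e. 0 < e \<Longrightarrow> \<exists>N. \<forall>m\<ge>N. \<forall>n\<ge>N. L2_norm S (\<lambda>z. F m z - F n z) \<le> e"
  obtains f where "f \<in> L2 S" "(\<lambda>k. L2_norm S (\<lambda>z. F k z - f z)) \<longlonglongrightarrow> 0"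
proof -
  have "\<exists>N. \<forall>m\<ge>N. \<forall>n\<ge>N. L2_norm S (\<lambda>z. F m z - F n z) \<le> (1/2)^k" for k
    by (rule Cauchy) simp
  then obtain N where N: "\<And>k m n. m \<ge> N k \<Longrightarrow> n \<ge> N k \<Longrightarrow> L2_norm S (\<lambda>z. F m z - F n z) \<le> (1/2)^k"
    by metis
  \<comment> \<open>Summing all earlier thresholds makes \<open>r\<close> monotone and at least
    \<open>N k\<close>; the summand \<open>k\<close> forces \<open>r k\<close> to infinity.\<close>
  define r where "r k = (\<Sum>i\<le>k. N i) + k" for k
  have rN: "N k \<le> r k" for k unfolding r_def by (meson atMost_iff finite_atMost le_refl member_le_sum trans_le_add1 zero_le)
  have rk: "k \<le> r k" for k by (simp add: r_def)
  have rS: "r k \<le> r (Suc k)" for k by (simp add: r_def)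
  define f where "f z = lim (\<lambda>k. F (r k) z)" for z
  have conv: "AE z in lebesgue_on S. convergent (\<lambda>k. F (r k) z)"
    by (intro L2_subseq_AE_convergent F N rN order_trans[OF rN rS])
  note [measurable] = L2D(1)[OF F]
  have f[measurable]: "f \<in> borel_measurable (lebesgue_on S)"
    unfolding f_def by measurable
  have lim: "AE z in lebesgue_on S. (\<lambda>k. F (r k) z) \<longlonglongrightarrow> f z"
    using conv by (auto simp: f_def convergent_LIMSEQ_iff)
  have tail: "(\<lambda>z. F m z - f z) \<in> L2 S \<and> L2_norm S (\<lambda>z. F m z - f z) \<le> (1/2)^k" if "m \<ge> N k" for m k
  proof -
    \<comment> \<open>Only \<open>j\<close> runs here while \<open>m\<close> stays fixed, so the
      Cauchy bound is constant along the sequence, as Fatou wants it.\<close>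
    have "AE z in lebesgue_on S. (\<lambda>j. F m z - F (r j) z) \<longlonglongrightarrow> F m z - f z"
      using lim by eventually_elim (intro tendsto_intros)
    moreover have "\<forall>\<^sub>F j in sequentially. L2_norm S (\<lambda>z. F m z - F (r j) z) \<le> (1/2)^k"
      using eventually_ge_at_top[of "N k"]
      by eventually_elim (intro N that order_trans[OF _ rk])
    ultimately show ?thesis
      using L2_Fatou[of "\<lambda>j z. F m z - F (r j) z" S "\<lambda>z. F m z - f z" "(1/2)^k"] F
      by (auto intro: L2_diff)
  qed
  have "f \<in> L2 S"
    using L2_diff[OF F[of "N 0"] conjunct1[OF tail[of 0 "N 0"]]] by simp
  moreover have "(\<lambda>k. L2_norm S (\<lambda>z. F k z - f z)) \<longlonglongrightarrow> 0"
  proof (rule LIMSEQ_I)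
    fix e :: real assume "0 < e"
    then obtain k where k: "(1/2)^k < e" using real_arch_pow_inv[of e "1/2"] by auto
    show "\<exists>no. \<forall>n\<ge>no. norm (L2_norm S (\<lambda>z. F n z - f z) - 0) < e"
      using tail[of k] k by (intro exI[of _ "N k"]) force
  qed
  ultimately show ?thesis by (rule that)
qed

text \<open>The representing element is the limit of a minimising sequence of \<open>\<parallel>v\<parallel>\<^sup>2 / 2 - c\<close> over
  \<open>(v, c) \<in> G\<close>. The functional is given by its graph because it is only well defined up to null functions.\<close>

lemma L2_Riesz_graph:
  fixes G :: "(('a::euclidean_space \<Rightarrow> 'b::euclidean_space) \<times> real) set"
  assumes L2: "\<And>v c. (v, c) \<in> G \<Longrightarrow> v \<in> L2 S"
    and bound: "\<And>v c. (v, c) \<in> G \<Longrightarrow> \<bar>c\<bar> \<le> C * L2_norm S v"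
    and zero: "(\<lambda>z. 0, 0) \<in> G"
    and lin: "\<And>v c v' c' t. (v, c) \<in> G \<Longrightarrow> (v', c') \<in> G \<Longrightarrow> (\<lambda>z. v z + t *\<^sub>R v' z, c + t * c') \<in> G"
  obtains h V where "h \<in> L2 S" "\<And>k. V k \<in> fst ` G" "(\<lambda>k. L2_norm S (\<lambda>z. V k z - h z)) \<longlonglongrightarrow> 0"
    "\<And>v c. (v, c) \<in> G \<Longrightarrow> L2_inner S h v = c"
proof -
  define I :: "('a \<Rightarrow> 'b) \<times> real \<Rightarrow> real" where "I = (\<lambda>(v, c). (L2_norm S v)\<^sup>2 / 2 - c)"
  define m where "m = Inf (I ` G)"
  have Ilow: "- (C\<^sup>2) / 2 \<le> I p" if "p \<in> G" for p
  proof -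
    obtain v c where p: "p = (v, c)" by force
    \<comment> \<open>Completing the square: with \<open>N\<close> the norm of \<open>v\<close>, the
      value \<open>N^2 / 2 - C * N\<close> is at least \<open>- C^2 / 2\<close>.\<close>
    have "0 \<le> (L2_norm S v - C)\<^sup>2" by simp
    then show ?thesis using bound that by (fastforce simp: p I_def power2_eq_square algebra_simps)
  qed
  have bdd: "bdd_below (I ` G)" using Ilow by (intro bdd_belowI2) auto
  have mle: "m \<le> I p" if "p \<in> G" for p
    unfolding m_def using bdd that by (intro cInf_lower) auto
  have "\<exists>p\<in>G. I p < m + inverse (real (Suc k))" for k
  proof -
    have "\<exists>x\<in>I ` G. x < m + inverse (real (Suc k))"
      unfolding m_def using zero bdd by (subst cInf_less_iff[symmetric]) (auto simp: m_def)
    then show ?thesis by blast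
  qed
  then obtain P where P: "\<And>k. P k \<in> G" "\<And>k. I (P k) < m + inverse (real (Suc k))" by metis
  define V c where "V k = fst (P k)" and "c k = snd (P k)" for k
  have Vc: "(V k, c k) \<in> G" for k using P(1) by (simp add: V_def c_def)
  have VL2: "V k \<in> L2 S" for k using L2[OF Vc] .
  have IV: "(L2_norm S (V k))\<^sup>2 / 2 - c k < m + inverse (real (Suc k))" for k
    using P(2)[of k] by (simp add: I_def V_def c_def case_prod_unfold)
  \<comment> \<open>The midpoint of \<open>V i\<close> and \<open>V j\<close> belongs to the graph
    with value \<open>(c i + c j) / 2\<close>, so \<open>m\<close> bounds the functional there from
    below; the parallelogram law turns this into closeness of two almost minimisers.\<close>
  have par: "(L2_norm S (\<lambda>z. V i z - V j z))\<^sup>2 \<le> 4 * (inverse (real (Suc i)) + inverse (real (Suc j)))" for i j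
  proof -
    have "(\<lambda>z. (\<lambda>z. 0) z + (1/2) *\<^sub>R (\<lambda>z. V i z + 1 *\<^sub>R V j z) z, 0 + 1/2 * (c i + 1 * c j)) \<in> G"
      by (intro lin zero Vc)
    then have "m \<le> (L2_norm S (\<lambda>z. (1/2) *\<^sub>R (V i z + V j z)))\<^sup>2 / 2 - (c i + c j) / 2"
      using mle by (force simp: I_def)
    then have "m \<le> (L2_norm S (\<lambda>z. V i z + V j z))\<^sup>2 / 8 - (c i + c j) / 2"
      by (simp only: L2_norm_scale) (simp add: power_mult_distrib power2_eq_square)
    moreover have "(L2_norm S (\<lambda>z. V i z + V j z))\<^sup>2 + (L2_norm S (\<lambda>z. V i z - V j z))\<^sup>2
        = 2 * (L2_norm S (V i))\<^sup>2 + 2 * (L2_norm S (V j))\<^sup>2"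
      using L2_norm_sq_add[OF VL2 VL2, of i 1 j] L2_norm_sq_add[OF VL2 VL2, of i "-1" j] by simp
    ultimately show ?thesis using IV[of i] IV[of j] by argo
  qed
  have Cauchy: "\<exists>N. \<forall>i\<ge>N. \<forall>j\<ge>N. L2_norm S (\<lambda>z. V i z - V j z) \<le> e" if e: "0 < e" for e
  proof -
    obtain N where N: "inverse (real (Suc N)) < e\<^sup>2 / 8" using reals_Archimedean[of "e\<^sup>2 / 8"] e by auto
    have "L2_norm S (\<lambda>z. V i z - V j z) \<le> e" if "i \<ge> N" "j \<ge> N" for i j
    proof (rule power2_le_imp_le)
      have "inverse (real (Suc i)) \<le> inverse (real (Suc N))" "inverse (real (Suc j)) \<le> inverse (real (Suc N))"
        using that by (auto intro!: le_imp_inverse_le)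
      then show "(L2_norm S (\<lambda>z. V i z - V j z))\<^sup>2 \<le> e\<^sup>2" using par[of i j] N by argo
    qed (use e in simp)
    then show ?thesis by blast
  qed
  obtain h where h: "h \<in> L2 S" "(\<lambda>k. L2_norm S (\<lambda>z. V k z - h z)) \<longlonglongrightarrow> 0"
    using L2_complete[of V S, OF VL2 Cauchy] .
  have "L2_inner S h v = e" if ve: "(v, e) \<in> G" for v e
  proof -
    have vL2: "v \<in> L2 S" using L2[OF ve] .
    define B where "B = L2_inner S h v - e"
    \<comment> \<open>Minimality tested at \<open>V k + t v\<close>: the coefficient of
      \<open>t\<close> tends to \<open>B\<close>, and the defect
      \<open>inverse (real (Suc k))\<close> of \<open>V k\<close> disappears in the limit.\<close>
    have ineq: "0 \<le> 2 * t * B + t\<^sup>2 * (L2_norm S v)\<^sup>2" for t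
    proof -
      have "0 \<le> inverse (real (Suc k)) + t * (L2_inner S (V k) v - e) + t\<^sup>2 * (L2_norm S v)\<^sup>2 / 2" for k
      proof -
        have "m \<le> I (\<lambda>z. V k z + t *\<^sub>R v z, c k + t * e)" by (intro mle lin Vc ve)
        then show ?thesis
          using IV[of k] L2_norm_sq_add[OF VL2 vL2, of k t] by (simp add: I_def algebra_simps)
      qed
      moreover have "(\<lambda>k. inverse (real (Suc k)) + t * (L2_inner S (V k) v - e) + t\<^sup>2 * (L2_norm S v)\<^sup>2 / 2)
          \<longlonglongrightarrow> 0 + t * (L2_inner S h v - e) + t\<^sup>2 * (L2_norm S v)\<^sup>2 / 2"
        by (intro tendsto_intros LIMSEQ_inverse_real_of_nat L2_inner_tendsto VL2 h vL2)
      ultimately have "0 \<le> 0 + t * (L2_inner S h v - e) + t\<^sup>2 * (L2_norm S v)\<^sup>2 / 2"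
        by (intro LIMSEQ_le_const) auto
      then show ?thesis by (simp add: B_def)
    qed
    \<comment> \<open>The added 1 keeps the divisor positive when \<open>v\<close> has norm zero;
      the choice \<open>t = - B / n\<close> then produces \<open>- B^2 / n\<close>.\<close>
    define n where "n = (L2_norm S v)\<^sup>2 + 1"
    have n: "n > 0" "(L2_norm S v)\<^sup>2 \<le> n" by (simp_all add: n_def add_nonneg_pos)
    have "0 \<le> 2 * (- B / n) * B + (- B / n)\<^sup>2 * n"
      using ineq[of "- B / n"] mult_left_mono[OF n(2), of "(- B / n)\<^sup>2"] by simp
    also have "\<dots> = - (B\<^sup>2) / n" using n by (simp add: field_simps power2_eq_square)
    finally have "B\<^sup>2 \<le> 0" using n by (simp add: field_simps)
    then show ?thesis by (simp add: B_def)
  qed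
  moreover have "V k \<in> fst ` G" for k using P(1) by (simp add: V_def)
  ultimately show ?thesis using that h by blast
qed

section \<open>Test functions and Fubini on the cylinder\<close>

text \<open>A general codomain lets one set of integrability and Fubini lemmas serve test functions,
  their gradients and the convolutions of both.\<close>

definition Cc :: "'a::topological_space set \<Rightarrow> ('a \<Rightarrow> 'b::{topological_space,zero}) set" where
  "Cc U = {f. continuous_on UNIV f \<and> (\<exists>K. compact K \<and> K \<subseteq> U \<and> (\<forall>z. z \<notin> K \<longrightarrow> f z = 0))}"

lemma Cc_continuous: "f \<in> Cc U \<Longrightarrow> continuous_on UNIV f"
  by (simp add: Cc_def)

lemma Cc_vanishing:
  assumes "f \<in> Cc U" "continuous_on UNIV g" "\<And>z. f z = 0 \<Longrightarrow> g z = 0"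
  shows "g \<in> Cc U"
  using assms unfolding Cc_def by blast

lemma Cc_add:
  fixes f g :: "'a::t2_space \<Rightarrow> 'b::real_normed_vector"
  assumes "f \<in> Cc U" "g \<in> Cc U" shows "(\<lambda>z. f z + g z) \<in> Cc U"
proof -
  obtain K K' where "compact K" "K \<subseteq> U" "\<forall>z. z \<notin> K \<longrightarrow> f z = 0" "compact K'" "K' \<subseteq> U" "\<forall>z. z \<notin> K' \<longrightarrow> g z = 0"
    using assms by (auto simp: Cc_def)
  then have "compact (K \<union> K') \<and> K \<union> K' \<subseteq> U \<and> (\<forall>z. z \<notin> K \<union> K' \<longrightarrow> f z + g z = 0)"
    by (auto intro: compact_Un)
  then show ?thesis using assms by (auto simp: Cc_def intro!: continuous_intros)
qed

lemma Cc_scaleR: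
  fixes f :: "'a::topological_space \<Rightarrow> 'b::real_normed_vector" and w :: "'a \<Rightarrow> real"
  assumes "f \<in> Cc U" "continuous_on UNIV w" shows "(\<lambda>z. w z *\<^sub>R f z) \<in> Cc U"
  by (rule Cc_vanishing[OF assms(1)]) (auto intro!: continuous_intros assms Cc_continuous[OF assms(1)])

lemma Cc_inner:
  fixes f g :: "'a::topological_space \<Rightarrow> 'b::real_inner"
  assumes "f \<in> Cc U" "continuous_on UNIV g" shows "(\<lambda>z. f z \<bullet> g z) \<in> Cc U"
  by (rule Cc_vanishing[OF assms(1)]) (auto intro!: continuous_intros assms Cc_continuous[OF assms(1)])

lemma Cc_norm_sq:
  fixes f :: "'a::topological_space \<Rightarrow> 'b::real_normed_vector"
  assumes "f \<in> Cc U" shows "(\<lambda>z. (norm (f z))\<^sup>2) \<in> Cc U"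
  by (rule Cc_vanishing[OF assms(1)]) (auto intro!: continuous_intros assms Cc_continuous[OF assms(1)])

lemma Cc_integrable_lborel:
  fixes f :: "'a::euclidean_space \<Rightarrow> 'b::euclidean_space"
  assumes "f \<in> Cc U" shows "integrable lborel f"
proof -
  obtain K where K: "compact K" "\<And>z. z \<notin> K \<Longrightarrow> f z = 0" and c: "continuous_on UNIV f"
    using assms by (auto simp: Cc_def)
  have "integrable lborel (\<lambda>x. indicator K x *\<^sub>R f x)"
    using K(1) continuous_on_subset[OF c] by (intro borel_integrable_compact) auto
  moreover have "(\<lambda>x. indicator K x *\<^sub>R f x) = f" using K(2) by (auto simp: indicator_def)
  ultimately show ?thesis by simp
qed

lemma Cc_integrable:
  fixes f :: "'a::euclidean_space \<Rightarrow> 'b::euclidean_space"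
  assumes "f \<in> Cc U" "S \<in> sets lebesgue" shows "integrable (lebesgue_on S) f"
proof -
  have "integrable lebesgue f"
    using Cc_integrable_lborel[OF assms(1)] by (simp add: integrable_completion)
  then show ?thesis
    using assms(2) by (subst integrable_restrict_space) (auto intro!: integrable_mult_indicator)
qed

lemma Cc_L2:
  fixes f :: "'a::euclidean_space \<Rightarrow> 'b::euclidean_space"
  assumes "f \<in> Cc U" "S \<in> sets lebesgue" shows "f \<in> L2 S"
  using Cc_integrable[OF Cc_norm_sq[OF assms(1)] assms(2)] Cc_integrable[OF assms]
  by (auto simp: L2_def dest: borel_measurable_integrable)

section \<open>Gradients of compactly supported functions\<close>

lemma grad_eq:
  assumes "GDERIV \<phi> z :> D" shows "grad \<phi> z = D"
  unfolding grad_def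
proof (rule the_equality[where P = "\<lambda>D. GDERIV \<phi> z :> D", OF assms])
  fix D' assume "GDERIV \<phi> z :> D'"
  then have "(\<lambda>h. h \<bullet> D') = (\<lambda>h. h \<bullet> D)"
    using assms has_derivative_unique unfolding gderiv_def by blast
  then show "D' = D" by (metis vector_eq_rdot inner_commute)
qed

lemma C1_compact_GDERIV:
  assumes "\<phi> \<in> C1_compact U" shows "GDERIV \<phi> z :> grad \<phi> z"
  using assms grad_eq unfolding C1_compact_def by force

lemma C1_compactI:
  assumes "\<And>z. GDERIV \<phi> z :> G z" "continuous_on UNIV G" "compact K" "K \<subseteq> U" "\<And>z. z \<notin> K \<Longrightarrow> \<phi> z = 0"
  shows "\<phi> \<in> C1_compact U"
proof -
  have "grad \<phi> = G" using grad_eq[OF assms(1)] by auto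
  then show ?thesis using assms unfolding C1_compact_def by blast
qed

lemma C1_compact_Cc: "\<phi> \<in> C1_compact U \<Longrightarrow> \<phi> \<in> Cc U"
  using C1_compact_GDERIV[of \<phi> U] unfolding C1_compact_def Cc_def gderiv_def
  by (auto intro!: continuous_at_imp_continuous_on has_derivative_continuous)

text \<open>The complement of the support set is open, so the function vanishes near each of its
  points and so does the gradient; the same compact set serves for both.\<close>

lemma C1_compact_grad_Cc:
  fixes \<phi> :: "'a::euclidean_space \<Rightarrow> real"
  assumes "\<phi> \<in> C1_compact U" shows "grad \<phi> \<in> Cc U"
proof -
  obtain K where K: "compact K" "K \<subseteq> U" "\<And>z. z \<notin> K \<Longrightarrow> \<phi> z = 0" and c: "continuous_on UNIV (grad \<phi>)"
    using assms by (auto simp: C1_compact_def)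
  have "grad \<phi> z = 0" if "z \<notin> K" for z
  proof (rule grad_eq)
    have "GDERIV (\<lambda>z. 0 :: real) z :> 0" by (rule GDERIV_const)
    moreover have o: "open (- K)" "z \<in> - K" using K(1) that by (auto intro: compact_imp_closed)
    moreover have "0 = \<phi> w" if "w \<in> - K" for w using K(3) that by simp
    ultimately show "GDERIV \<phi> z :> 0"
      unfolding gderiv_def by (rule has_derivative_transform_within_open)
  qed
  then show ?thesis using K c by (auto simp: Cc_def)
qed

lemma C1_compact_space_grad_Cc: "\<phi> \<in> C1_compact U \<Longrightarrow> space_grad \<phi> \<in> Cc U"
  unfolding space_grad_def
  by (rule Cc_vanishing[OF C1_compact_grad_Cc])
     (auto intro!: continuous_intros Cc_continuous[OF C1_compact_grad_Cc])

lemma C1_compact_time_deriv_Cc: "\<phi> \<in> C1_compact U \<Longrightarrow> time_deriv \<phi> \<in> Cc U"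
  unfolding time_deriv_def
  by (rule Cc_vanishing[OF C1_compact_grad_Cc])
     (auto intro!: continuous_intros Cc_continuous[OF C1_compact_grad_Cc])

lemma C1_compact_mono: "\<phi> \<in> C1_compact U \<Longrightarrow> U \<subseteq> V \<Longrightarrow> \<phi> \<in> C1_compact V"
  unfolding C1_compact_def by blast

lemma C1_compact_lincomb:
  fixes \<phi> \<psi> :: "'a::euclidean_space \<Rightarrow> real"
  assumes "\<phi> \<in> C1_compact U" "\<psi> \<in> C1_compact U"
  shows "(\<lambda>z. \<phi> z + c * \<psi> z) \<in> C1_compact U"
    and "grad (\<lambda>z. \<phi> z + c * \<psi> z) z = grad \<phi> z + c *\<^sub>R grad \<psi> z"
proof -
  have D: "GDERIV (\<lambda>z. \<phi> z + c * \<psi> z) z :> grad \<phi> z + c *\<^sub>R grad \<psi> z" for z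
    using C1_compact_GDERIV[OF assms(1), of z] C1_compact_GDERIV[OF assms(2), of z]
    unfolding gderiv_def by (auto intro!: derivative_eq_intros simp: inner_simps)
  then show "grad (\<lambda>z. \<phi> z + c * \<psi> z) z = grad \<phi> z + c *\<^sub>R grad \<psi> z" by (rule grad_eq)
  obtain K where K: "compact K" "K \<subseteq> U" "\<And>z. z \<notin> K \<Longrightarrow> \<phi> z + c * \<psi> z = 0"
    using Cc_add[OF C1_compact_Cc[OF assms(1)] Cc_scaleR[OF C1_compact_Cc[OF assms(2)], of "\<lambda>_. c"]]
    by (auto simp: Cc_def)
  show "(\<lambda>z. \<phi> z + c * \<psi> z) \<in> C1_compact U"
    by (rule C1_compactI[OF D _ K])
       (intro continuous_intros Cc_continuous[OF C1_compact_grad_Cc[OF assms(1)]]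
         Cc_continuous[OF C1_compact_grad_Cc[OF assms(2)]])
qed

lemma space_time_grad_lincomb:
  fixes \<phi> \<psi> :: "(real^'n) \<times> real \<Rightarrow> real"
  assumes "\<phi> \<in> C1_compact U" "\<psi> \<in> C1_compact U"
  shows "space_grad (\<lambda>z. \<phi> z + c * \<psi> z) z = space_grad \<phi> z + c *\<^sub>R space_grad \<psi> z"
    and "time_deriv (\<lambda>z. \<phi> z + c * \<psi> z) z = time_deriv \<phi> z + c * time_deriv \<psi> z"
  by (simp_all add: space_grad_def time_deriv_def C1_compact_lincomb(2)[OF assms])

lemma C1_compact_zero: "(\<lambda>z. 0) \<in> C1_compact U"
  by (rule C1_compactI[of _ "\<lambda>_. 0" "{}"]) (auto intro: GDERIV_const)

lemma grad_zero: "grad (\<lambda>z. 0) z = 0"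
  by (rule grad_eq) (rule GDERIV_const)

text \<open>The multiplier of the coercivity estimate. Being a function of time alone it passes
  through the spatial gradient, and its slope \<open>d\<close> creates the term that controls the
  \<open>L2\<close> norm.\<close>

lemma C1_compact_time_weight:
  fixes \<phi> :: "(real^'n) \<times> real \<Rightarrow> real"
  assumes "\<phi> \<in> C1_compact U"
  shows "(\<lambda>z. (c + d * snd z) * \<phi> z) \<in> C1_compact U"
    and "space_grad (\<lambda>z. (c + d * snd z) * \<phi> z) z = (c + d * snd z) *\<^sub>R space_grad \<phi> z"
    and "time_deriv (\<lambda>z. (c + d * snd z) * \<phi> z) z = d * \<phi> z + (c + d * snd z) * time_deriv \<phi> z"
proof -
  have D: "GDERIV (\<lambda>z. (c + d * snd z) * \<phi> z) z :> (c + d * snd z) *\<^sub>R grad \<phi> z + (d * \<phi> z) *\<^sub>R (0, 1)" for z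
    using C1_compact_GDERIV[OF assms(1), of z]
    unfolding gderiv_def by (auto intro!: derivative_eq_intros simp: inner_simps algebra_simps)
  then have g: "grad (\<lambda>z. (c + d * snd z) * \<phi> z) z = (c + d * snd z) *\<^sub>R grad \<phi> z + (d * \<phi> z) *\<^sub>R (0, 1)"
    by (rule grad_eq)
  show "space_grad (\<lambda>z. (c + d * snd z) * \<phi> z) z = (c + d * snd z) *\<^sub>R space_grad \<phi> z"
    "time_deriv (\<lambda>z. (c + d * snd z) * \<phi> z) z = d * \<phi> z + (c + d * snd z) * time_deriv \<phi> z"
    by (simp_all add: space_grad_def time_deriv_def g)
  obtain K where K: "compact K" "K \<subseteq> U" "\<And>z. z \<notin> K \<Longrightarrow> \<phi> z = 0"
    using assms by (auto simp: C1_compact_def)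
  show "(\<lambda>z. (c + d * snd z) * \<phi> z) \<in> C1_compact U"
    using K(3) by (intro C1_compactI[OF D _ K(1,2)])
       (auto intro!: continuous_intros Cc_continuous[OF C1_compact_grad_Cc[OF assms]]
         Cc_continuous[OF C1_compact_Cc[OF assms]])
qed

lemma C1_compact_DERIV_time:
  assumes "\<phi> \<in> C1_compact U"
  shows "((\<lambda>t. \<phi> (x, t)) has_real_derivative time_deriv \<phi> (x, t)) (at t)"
proof -
  have "((\<lambda>t. (x, t)) has_derivative (\<lambda>h. (0, h))) (at t)"
    by (auto intro!: derivative_eq_intros)
  from has_derivative_compose[OF this, of \<phi>] C1_compact_GDERIV[OF assms, of "(x, t)"]
  have "((\<lambda>t. \<phi> (x, t)) has_derivative (\<lambda>h. (0, h) \<bullet> grad \<phi> (x, t))) (at t)"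
    by (simp add: gderiv_def)
  then show ?thesis
    by (simp add: has_field_derivative_def time_deriv_def inner_prod_def mult_commute_abs)
qed

section \<open>Integration over the cylinder along time lines\<close>

lemma cylinder_lebesgue [simp]: "open \<Omega> \<Longrightarrow> cylinder (\<Omega>::(real^'n) set) T \<in> sets lebesgue"
  by (simp add: open_Times)

text \<open>The inner integral is a Henstock-Kurzweil integral over the closed interval, the form in
  which the fundamental theorem of calculus and the exchange of continuous integrals apply; closing
  the interval adds only a null set.\<close>

lemma Cc_slices:
  fixes h :: "(real^'n) \<times> real \<Rightarrow> real"
  assumes \<Omega>: "open \<Omega>" and h: "h \<in> Cc U"
  shows "integrable lborel (\<lambda>x. indicator \<Omega> x * integral {0..T} (\<lambda>t. h (x, t)))"
    and "(LINT z|lebesgue_on (cylinder \<Omega> T). h z)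
       = (LINT x|lborel. indicator \<Omega> x * integral {0..T} (\<lambda>t. h (x, t)))"
proof -
  note [measurable] = borel_measurable_continuous_onI[OF Cc_continuous[OF h]]
  have [measurable]: "cylinder \<Omega> T \<in> sets borel" "\<Omega> \<in> sets borel" using \<Omega> by (auto simp: open_Times)
  define f where "f z = indicator (cylinder \<Omega> T) z * h z" for z
  have fi: "integrable (lborel \<Otimes>\<^sub>M lborel) f"
    using integrable_mult_indicator[OF _ Cc_integrable_lborel[OF h], of "cylinder \<Omega> T"]
    by (simp add: lborel_prod f_def[abs_def])
  have slice: "(LINT t|lborel. f (x, t)) = indicator \<Omega> x * integral {0..T} (\<lambda>t. h (x, t))" for x
  proof -
    have c: "continuous_on A (\<lambda>t. h (x, t))" for A
      by (rule continuous_on_compose2[OF Cc_continuous[OF h]]) (auto intro!: continuous_intros)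
    have "set_integrable lborel {0..T} (\<lambda>t. h (x, t))"
      unfolding set_integrable_def by (intro borel_integrable_compact c) auto
    then have si: "set_integrable lborel {0<..<T} (\<lambda>t. h (x, t))"
      by (rule set_integrable_subset) auto
    have "(LINT t|lborel. f (x, t)) = indicator \<Omega> x * (LINT t:{0<..<T}|lborel. h (x, t))"
      unfolding set_lebesgue_integral_def f_def
      by (subst integral_mult_right_zero[symmetric])
         (auto intro!: Bochner_Integration.integral_cong simp: indicator_def)
    also have "(LINT t:{0<..<T}|lborel. h (x, t)) = integral {0..T} (\<lambda>t. h (x, t))"
      using set_borel_integral_eq_integral(2)[OF si] by (simp add: integral_open_interval_real)
    finally show ?thesis .
  qed
  show "integrable lborel (\<lambda>x. indicator \<Omega> x * integral {0..T} (\<lambda>t. h (x, t)))"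
    using lborel_pair.integrable_fst'[OF fi] by (simp add: slice)
  have "(LINT z|lebesgue_on (cylinder \<Omega> T). h z) = (LINT z|lebesgue. f z)"
    using \<Omega> by (subst integral_restrict_space) (auto simp: f_def[abs_def])
  also have "\<dots> = (LINT z|lborel. f z)"
    by (rule integral_completion) (simp add: f_def[abs_def])
  also have "\<dots> = (LINT x|lborel. LINT t|lborel. f (x, t))"
    using lborel_pair.integral_fst'[OF fi] by (simp add: lborel_prod)
  finally show "(LINT z|lebesgue_on (cylinder \<Omega> T). h z)
      = (LINT x|lborel. indicator \<Omega> x * integral {0..T} (\<lambda>t. h (x, t)))"
    by (simp add: slice)
qed

text \<open>Comparisons of space-time integrals become one-dimensional at fixed \<open>x\<close>.
  Used in both directions it also yields equalities.\<close>

lemma Cc_integral_mono_slices: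
  fixes h k :: "(real^'n) \<times> real \<Rightarrow> real"
  assumes "open \<Omega>" "h \<in> Cc U" "k \<in> Cc V"
    and "\<And>x. integral {0..T} (\<lambda>t. h (x, t)) \<le> integral {0..T} (\<lambda>t. k (x, t))"
  shows "(LINT z|lebesgue_on (cylinder \<Omega> T). h z) \<le> (LINT z|lebesgue_on (cylinder \<Omega> T). k z)"
  unfolding Cc_slices(2)[OF assms(1,2)] Cc_slices(2)[OF assms(1,3)]
  by (intro integral_mono Cc_slices(1)[OF assms(1)] mult_left_mono) (use assms in auto)

section \<open>Existence of weak solutions\<close>

lemma L2_Linf_mult:
  assumes "a0 \<in> Linf S" "y \<in> L2 S" shows "(\<lambda>z. a0 z * y z) \<in> L2 S"
proof -
  obtain M where M: "AE z in lebesgue_on S. \<bar>a0 z\<bar> \<le> M" and [measurable]: "a0 \<in> borel_measurable (lebesgue_on S)"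
    using assms(1) by (auto simp: Linf_def)
  note [measurable] = L2D(1)[OF assms(2)]
  have "integrable (lebesgue_on S) (\<lambda>z. (norm (a0 z * y z))\<^sup>2)"
  proof (rule Bochner_Integration.integrable_bound)
    show "integrable (lebesgue_on S) (\<lambda>z. M\<^sup>2 * (norm (y z))\<^sup>2)"
      using L2D(2)[OF assms(2)] by simp
    show "AE z in lebesgue_on S. norm ((norm (a0 z * y z))\<^sup>2) \<le> norm (M\<^sup>2 * (norm (y z))\<^sup>2)"
      using M
    proof eventually_elim
      fix z assume "\<bar>a0 z\<bar> \<le> M"
      then have "(a0 z)\<^sup>2 \<le> M\<^sup>2" by (rule power2_le_iff_abs_le[THEN iffD2, rotated]) (use \<open>\<bar>a0 z\<bar> \<le> M\<close> in linarith)
      then show "norm ((norm (a0 z * y z))\<^sup>2) \<le> norm (M\<^sup>2 * (norm (y z))\<^sup>2)"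
        by (simp add: power_mult_distrib mult_right_mono)
    qed
  qed measurable
  then show ?thesis by (simp add: L2_def)
qed

lemma L2_Pair:
  assumes "f \<in> L2 S" "g \<in> L2 S" shows "(\<lambda>z. (f z, g z)) \<in> L2 S"
  using L2D[OF assms(1)] L2D[OF assms(2)]
  by (auto simp: L2_def norm_Pair real_sqrt_pow2 add_nonneg_nonneg)

lemma L2_fst_snd:
  fixes h :: "'a::euclidean_space \<Rightarrow> 'b::euclidean_space \<times> 'c::euclidean_space"
  assumes "h \<in> L2 S"
  shows "(\<lambda>z. fst (h z)) \<in> L2 S" "(\<lambda>z. snd (h z)) \<in> L2 S"
    and "L2_norm S (\<lambda>z. fst (h z)) \<le> L2_norm S h" "L2_norm S (\<lambda>z. snd (h z)) \<le> L2_norm S h"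
proof -
  have n: "norm (fst p) \<le> norm p" "norm (snd p) \<le> norm p" for p :: "'b \<times> 'c"
    by (metis norm_fst_le prod.collapse, metis norm_snd_le prod.collapse)
  have m: "(\<lambda>z. fst (h z)) \<in> borel_measurable (lebesgue_on S)" "(\<lambda>z. snd (h z)) \<in> borel_measurable (lebesgue_on S)"
    by (rule measurable_compose[OF L2D(1)[OF assms] borel_measurable_continuous_onI];
        intro continuous_intros)+
  show 1: "(\<lambda>z. fst (h z)) \<in> L2 S"
    by (rule L2_dominated[OF m(1) L2D(2)[OF assms]]) (auto intro!: power_mono n)
  show 2: "(\<lambda>z. snd (h z)) \<in> L2 S"
    by (rule L2_dominated[OF m(2) L2D(2)[OF assms]]) (auto intro!: power_mono n)
  show "L2_norm S (\<lambda>z. fst (h z)) \<le> L2_norm S h" "L2_norm S (\<lambda>z. snd (h z)) \<le> L2_norm S h"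
    by (intro L2_norm_mono 1 2 assms n)+
qed

lemma L2_inner_Pair:
  assumes "f \<in> L2 S" "g \<in> L2 S" "f' \<in> L2 S" "g' \<in> L2 S"
  shows "L2_inner S (\<lambda>z. (f z, g z)) (\<lambda>z. (f' z, g' z)) = L2_inner S f f' + L2_inner S g g'"
  unfolding L2_inner_def
  using L2_inner_integrable[OF assms(1,3)] L2_inner_integrable[OF assms(2,4)] by simp

text \<open>The weak formulation of the forward equation (\<open>sg = 1\<close>) and of the backward equation
  (\<open>sg = - 1\<close>, with the equation multiplied by \<open>- 1\<close>), for test functions supported in \<open>V\<close>.\<close>

definition weak_parabolic ::
  "real \<Rightarrow> ((real^'n) \<times> real) set \<Rightarrow> (real^'n) set \<Rightarrow> real \<Rightarrow> real \<Rightarrow> ((real^'n) \<times> real \<Rightarrow> real) \<Rightarrow>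
   ((real^'n) \<times> real \<Rightarrow> real) \<Rightarrow> ((real^'n) \<times> real \<Rightarrow> real) \<Rightarrow> ((real^'n) \<times> real \<Rightarrow> real^'n) \<Rightarrow> bool" where
  "weak_parabolic sg V \<Omega> T \<nu> a0 f y g \<longleftrightarrow> energy_space \<Omega> T y g \<and>
     (\<forall>\<phi>\<in>C1_compact V. - sg * L2_inner (cylinder \<Omega> T) y (time_deriv \<phi>)
        + \<nu> * L2_inner (cylinder \<Omega> T) g (space_grad \<phi>)
        + L2_inner (cylinder \<Omega> T) (\<lambda>z. a0 z * y z) \<phi> = L2_inner (cylinder \<Omega> T) f \<phi>)"

text \<open>Bundling value and spatial gradient makes the energy inner product an \<open>L2\<close>
  inner product of vector-valued functions, so that completeness and Riesz representation in
  \<open>L2\<close> apply to the energy space directly.\<close>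

definition energy_pair :: "((real^'n) \<times> real \<Rightarrow> real) \<Rightarrow> (real^'n) \<times> real \<Rightarrow> real \<times> (real^'n)" where
  "energy_pair \<phi> z = (\<phi> z, space_grad \<phi> z)"

text \<open>The same regular functions as in \<open>energy_space\<close> are closed up, but as
  pair-valued functions: the result is a closed linear subspace of \<open>L2\<close> in which
  representers can be found.\<close>

definition energy_closure :: "(real^'n) set \<Rightarrow> real \<Rightarrow> ((real^'n) \<times> real \<Rightarrow> real \<times> (real^'n)) set" where
  "energy_closure \<Omega> T = {h \<in> L2 (cylinder \<Omega> T).
     \<forall>e>0. \<exists>\<phi>\<in>C1_compact (\<Omega> \<times> UNIV). L2_norm (cylinder \<Omega> T) (\<lambda>z. energy_pair \<phi> z - h z) < e}"

lemma energy_pair_L2: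
  assumes "open \<Omega>" "\<phi> \<in> C1_compact U" shows "energy_pair \<phi> \<in> L2 (cylinder \<Omega> T)"
  unfolding energy_pair_def[abs_def]
  by (intro L2_Pair Cc_L2[OF C1_compact_Cc] Cc_L2[OF C1_compact_space_grad_Cc]) (use assms in auto)

lemma energy_closure_pair:
  assumes "open \<Omega>" "\<phi> \<in> C1_compact (\<Omega> \<times> UNIV)" shows "energy_pair \<phi> \<in> energy_closure \<Omega> T"
  unfolding energy_closure_def using assms by (auto intro!: energy_pair_L2 bexI[of _ \<phi>])

lemma energy_closure_lincomb:
  assumes \<Omega>: "open \<Omega>" and h: "h \<in> energy_closure \<Omega> T" "h' \<in> energy_closure \<Omega> T"
  shows "(\<lambda>z. h z + t *\<^sub>R h' z) \<in> energy_closure \<Omega> T"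
  unfolding energy_closure_def
proof (intro CollectI conjI allI impI)
  have L: "h \<in> L2 (cylinder \<Omega> T)" "h' \<in> L2 (cylinder \<Omega> T)" using h by (auto simp: energy_closure_def)
  then show "(\<lambda>z. h z + t *\<^sub>R h' z) \<in> L2 (cylinder \<Omega> T)" by (intro L2_add L2_scale)
  fix e :: real assume "0 < e"
  define e' where "e' = e / (1 + \<bar>t\<bar>)"
  have e': "0 < e'" "e' + \<bar>t\<bar> * e' = e" using \<open>0 < e\<close> by (auto simp: e'_def add_divide_distrib[symmetric] field_simps)
  obtain \<phi> \<psi> where \<phi>: "\<phi> \<in> C1_compact (\<Omega> \<times> UNIV)" "L2_norm (cylinder \<Omega> T) (\<lambda>z. energy_pair \<phi> z - h z) < e'"
    and \<psi>: "\<psi> \<in> C1_compact (\<Omega> \<times> UNIV)" "L2_norm (cylinder \<Omega> T) (\<lambda>z. energy_pair \<psi> z - h' z) < e'"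
    using h e'(1) unfolding energy_closure_def by blast
  have eq: "(\<lambda>z. energy_pair (\<lambda>z. \<phi> z + t * \<psi> z) z - (h z + t *\<^sub>R h' z))
    = (\<lambda>z. (energy_pair \<phi> z - h z) + t *\<^sub>R (energy_pair \<psi> z - h' z))"
    unfolding energy_pair_def
    by (auto simp: space_time_grad_lincomb(1)[OF \<phi>(1) \<psi>(1)] algebra_simps minus_prod_def plus_prod_def scaleR_prod_def fun_eq_iff)
  have "L2_norm (cylinder \<Omega> T) (\<lambda>z. energy_pair (\<lambda>z. \<phi> z + t * \<psi> z) z - (h z + t *\<^sub>R h' z))
     \<le> L2_norm (cylinder \<Omega> T) (\<lambda>z. energy_pair \<phi> z - h z)
      + \<bar>t\<bar> * L2_norm (cylinder \<Omega> T) (\<lambda>z. energy_pair \<psi> z - h' z)"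
    unfolding eq L2_norm_scale[symmetric]
    by (intro L2_norm_triangle L2_scale L2_diff energy_pair_L2[OF \<Omega> \<phi>(1)] energy_pair_L2[OF \<Omega> \<psi>(1)] L)
  also have "\<dots> < e' + \<bar>t\<bar> * e'"
    using \<phi>(2) \<psi>(2) by (intro add_less_le_mono mult_left_mono) auto
  finally have "L2_norm (cylinder \<Omega> T) (\<lambda>z. energy_pair (\<lambda>z. \<phi> z + t * \<psi> z) z - (h z + t *\<^sub>R h' z)) < e"
    by (simp add: e')
  then show "\<exists>\<phi>\<in>C1_compact (\<Omega> \<times> UNIV). L2_norm (cylinder \<Omega> T) (\<lambda>z. energy_pair \<phi> z - (h z + t *\<^sub>R h' z)) < e"
    using C1_compact_lincomb(1)[OF \<phi>(1) \<psi>(1)] by blast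
qed

lemma energy_closure_closed:
  assumes \<Omega>: "open \<Omega>" and h: "\<And>k. h k \<in> energy_closure \<Omega> T" and l: "l \<in> L2 (cylinder \<Omega> T)"
    and lim: "(\<lambda>k. L2_norm (cylinder \<Omega> T) (\<lambda>z. h k z - l z)) \<longlonglongrightarrow> 0"
  shows "l \<in> energy_closure \<Omega> T"
  unfolding energy_closure_def
proof (intro CollectI conjI allI impI l)
  fix e :: real assume "0 < e"
  then obtain k where k: "L2_norm (cylinder \<Omega> T) (\<lambda>z. h k z - l z) < e / 2"
    using LIMSEQ_D[OF lim, of "e / 2"] by fastforce
  have hk: "h k \<in> L2 (cylinder \<Omega> T)" using h[of k] by (simp add: energy_closure_def)
  obtain \<phi> where \<phi>: "\<phi> \<in> C1_compact (\<Omega> \<times> UNIV)" "L2_norm (cylinder \<Omega> T) (\<lambda>z. energy_pair \<phi> z - h k z) < e / 2"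
    using h[of k] \<open>0 < e\<close> unfolding energy_closure_def by (auto dest!: spec[of _ "e/2"])
  have "L2_norm (cylinder \<Omega> T) (\<lambda>z. energy_pair \<phi> z - l z) < e"
    using L2_norm_triangle_diff[OF energy_pair_L2[OF \<Omega> \<phi>(1)] hk l] \<phi>(2) k by linarith
  then show "\<exists>\<phi>\<in>C1_compact (\<Omega> \<times> UNIV). L2_norm (cylinder \<Omega> T) (\<lambda>z. energy_pair \<phi> z - l z) < e"
    using \<phi>(1) by blast
qed

lemma energy_closure_sequence:
  assumes \<Omega>: "open \<Omega>" and h: "h \<in> energy_closure \<Omega> T"
  obtains \<phi> where "\<And>k. \<phi> k \<in> C1_compact (\<Omega> \<times> UNIV)"
    "(\<lambda>k. L2_norm (cylinder \<Omega> T) (\<lambda>z. energy_pair (\<phi> k) z - h z)) \<longlonglongrightarrow> 0"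
proof -
  have "\<forall>k. \<exists>\<phi>. \<phi> \<in> C1_compact (\<Omega> \<times> UNIV) \<and>
      L2_norm (cylinder \<Omega> T) (\<lambda>z. energy_pair \<phi> z - h z) < inverse (real (Suc k))"
    using h unfolding energy_closure_def by (auto dest!: spec[of _ "inverse (real (Suc _))"])
  from choice[OF this] obtain \<phi> where \<phi>: "\<And>k. \<phi> k \<in> C1_compact (\<Omega> \<times> UNIV)"
    "\<And>k. L2_norm (cylinder \<Omega> T) (\<lambda>z. energy_pair (\<phi> k) z - h z) < inverse (real (Suc k))" by blast
  have "(\<lambda>k. L2_norm (cylinder \<Omega> T) (\<lambda>z. energy_pair (\<phi> k) z - h z)) \<longlonglongrightarrow> 0"
    by (rule Lim_null_comparison[OF always_eventually LIMSEQ_inverse_real_of_nat])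
       (use \<phi>(2) in \<open>auto intro: less_imp_le simp del: of_nat_Suc\<close>)
  then show ?thesis using that \<phi>(1) by blast
qed

text \<open>Each component is dominated in norm by the pair, so one sequence approximates value and
  gradient simultaneously.\<close>

lemma energy_closure_energy_space:
  assumes \<Omega>: "open \<Omega>" and h: "h \<in> energy_closure \<Omega> T"
  shows "energy_space \<Omega> T (\<lambda>z. fst (h z)) (\<lambda>z. snd (h z))"
proof -
  obtain \<phi> where \<phi>: "\<And>k. \<phi> k \<in> C1_compact (\<Omega> \<times> UNIV)"
    and lim: "(\<lambda>k. L2_norm (cylinder \<Omega> T) (\<lambda>z. energy_pair (\<phi> k) z - h z)) \<longlonglongrightarrow> 0"
    using energy_closure_sequence[OF assms] by blast
  have hL: "h \<in> L2 (cylinder \<Omega> T)" using h by (simp add: energy_closure_def)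
  have d: "(\<lambda>z. energy_pair (\<phi> k) z - h z) \<in> L2 (cylinder \<Omega> T)" for k
    by (intro L2_diff energy_pair_L2[OF \<Omega> \<phi>] hL)
  have "(\<lambda>k. L2_norm (cylinder \<Omega> T) (\<lambda>z. \<phi> k z - fst (h z))) \<longlonglongrightarrow> 0"
    "(\<lambda>k. L2_norm (cylinder \<Omega> T) (\<lambda>z. space_grad (\<phi> k) z - snd (h z))) \<longlonglongrightarrow> 0"
    using L2_fst_snd(3,4)[OF d]
    by (auto intro!: Lim_null_comparison[OF always_eventually lim] simp: energy_pair_def)
  then show ?thesis
    unfolding energy_space_def using L2_fst_snd(1,2)[OF hL] \<phi> by blast
qed

text \<open>The operator \<open>L\<close> below contains the time derivative, which the energy norm
  does not control; hence Lions' theorem instead of Lax-Milgram. Let \<open>S\<close> send a test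
  function \<open>\<zeta>\<close> to the representer, in \<open>energy_closure\<close>, of the
  functional \<open>\<phi> -> <L \<zeta>, energy_pair \<phi>>\<close>. Coercivity bounds
  \<open>\<zeta>\<close> by \<open>S \<zeta>\<close>, so \<open>S \<zeta> -> <f, \<zeta>>\<close> is
  a bounded functional, and its own representer solves the equation. The hypothesis \<open>w\<close>
  keeps the time weight between 1 and \<open>M\<close>; \<open>bd\<close> is the sign of the
  boundary terms left by integrating in time, and holds because test functions vanish at one
  end.\<close>

lemma weak_parabolic_exists:
  fixes \<Omega> :: "(real^'n) set" and sg c M :: real
  assumes \<Omega>: "open \<Omega>" and V: "V \<subseteq> \<Omega> \<times> UNIV" and \<nu>: "0 < \<nu>" and T: "0 < T"
    and a0: "a0 \<in> Linf (cylinder \<Omega> T)" "AE z in lebesgue_on (cylinder \<Omega> T). 0 \<le> a0 z"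
    and f: "f \<in> L2 (cylinder \<Omega> T)" and sg: "sg * sg = 1"
    and w: "\<And>t. 0 < t \<Longrightarrow> t < T \<Longrightarrow> 1 \<le> c + sg * t \<and> c + sg * t \<le> M"
    and bd: "\<And>\<zeta> x. \<zeta> \<in> C1_compact V \<Longrightarrow> sg * ((c + sg * T) * (\<zeta> (x, T))\<^sup>2 - c * (\<zeta> (x, 0))\<^sup>2) \<le> 0"
  shows "\<exists>y g. weak_parabolic sg V \<Omega> T \<nu> a0 f y g"
proof -
  define Q where "Q = cylinder \<Omega> T"
  \<comment> \<open>The pairing of \<open>L \<zeta>\<close> with \<open>(y, g)\<close> is the
    left-hand side of the weak equation tested with \<open>\<zeta>\<close>.\<close>
  define L where "L \<zeta> z = (- sg * time_deriv \<zeta> z + a0 z * \<zeta> z, \<nu> *\<^sub>R space_grad \<zeta> z)" for \<zeta> and z :: "(real^'n) \<times> real"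
  \<comment> \<open>The smaller of two coercivity constants: 1/2 comes from the slope of the weight,
    \<open>\<nu>\<close> from the gradient term with a weight of at least 1.\<close>
  define \<kappa> where "\<kappa> = min (1/2) \<nu>"
  have \<kappa>: "0 < \<kappa>" "\<kappa> \<le> 1/2" "\<kappa> \<le> \<nu>" using \<nu> by (auto simp: \<kappa>_def)
  have Ql: "Q \<in> sets lebesgue" using \<Omega> by (simp add: Q_def)
  have \<zeta>L2: "\<zeta> \<in> L2 Q" "time_deriv \<zeta> \<in> L2 Q" "space_grad \<zeta> \<in> L2 Q" "energy_pair \<zeta> \<in> L2 Q" "(\<lambda>z. a0 z * \<zeta> z) \<in> L2 Q"
    if "\<zeta> \<in> C1_compact U" for \<zeta> U
    using that Ql \<Omega> a0(1) unfolding Q_def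
    by (auto intro!: energy_pair_L2 L2_Linf_mult intro: Cc_L2[OF C1_compact_Cc]
        Cc_L2[OF C1_compact_time_deriv_Cc] Cc_L2[OF C1_compact_space_grad_Cc])
  have L1L2: "(\<lambda>z. - sg * time_deriv \<zeta> z + a0 z * \<zeta> z) \<in> L2 Q" if "\<zeta> \<in> C1_compact U" for \<zeta> U
    using L2_add[OF L2_mult[OF \<zeta>L2(2)[OF that], of "- sg"] \<zeta>L2(5)[OF that]] .
  have LL2: "L \<zeta> \<in> L2 Q" if "\<zeta> \<in> C1_compact U" for \<zeta> U
    unfolding L_def[abs_def] by (intro L2_Pair L1L2[OF that] L2_scale \<zeta>L2[OF that])
  have EV: "\<zeta> \<in> C1_compact (\<Omega> \<times> UNIV)" if "\<zeta> \<in> C1_compact V" for \<zeta>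
    using C1_compact_mono[OF that V] .

  \<comment> \<open>The first use of Riesz, producing \<open>S \<zeta>\<close>.\<close>
  have rep: "\<exists>h\<in>energy_closure \<Omega> T. \<forall>\<phi>\<in>C1_compact (\<Omega> \<times> UNIV). L2_inner Q h (energy_pair \<phi>) = L2_inner Q (L \<zeta>) (energy_pair \<phi>)"
    if \<zeta>: "\<zeta> \<in> C1_compact V" for \<zeta>
  proof -
    let ?G = "{(energy_pair \<phi>, L2_inner Q (L \<zeta>) (energy_pair \<phi>)) | \<phi>. \<phi> \<in> C1_compact (\<Omega> \<times> UNIV)}"
    obtain h H where h: "h \<in> L2 Q" and H: "\<And>k. H k \<in> fst ` ?G"
      and lim: "(\<lambda>k. L2_norm Q (\<lambda>z. H k z - h z)) \<longlonglongrightarrow> 0"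
      and eq: "\<And>v c. (v, c) \<in> ?G \<Longrightarrow> L2_inner Q h v = c"
    proof (rule L2_Riesz_graph[of ?G Q "L2_norm Q (L \<zeta>)"])
      show "v \<in> L2 Q" "\<bar>c\<bar> \<le> L2_norm Q (L \<zeta>) * L2_norm Q v" if "(v, c) \<in> ?G" for v c
        using that \<zeta>L2(4) L2_Cauchy_Schwarz[OF LL2[OF \<zeta>]] by auto
      have "energy_pair (\<lambda>z. 0) = (\<lambda>z::(real^'n) \<times> real. 0)"
        by (simp add: energy_pair_def[abs_def] space_grad_def grad_zero zero_prod_def)
      then show "(\<lambda>z. 0, 0) \<in> ?G"
        using C1_compact_zero[of "\<Omega> \<times> UNIV"] by (force simp: L2_inner_def)
      fix v c v' c' t assume "(v, c) \<in> ?G" "(v', c') \<in> ?G"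
      then obtain \<phi> \<psi> where \<phi>: "\<phi> \<in> C1_compact (\<Omega> \<times> UNIV)" "\<psi> \<in> C1_compact (\<Omega> \<times> UNIV)"
        "v = energy_pair \<phi>" "v' = energy_pair \<psi>" "c = L2_inner Q (L \<zeta>) v" "c' = L2_inner Q (L \<zeta>) v'" by blast
      have E: "(\<lambda>z. v z + t *\<^sub>R v' z) = energy_pair (\<lambda>z. \<phi> z + t * \<psi> z)"
        using \<phi> by (auto simp: energy_pair_def space_time_grad_lincomb(1)[OF \<phi>(1,2)] fun_eq_iff)
      have "L2_inner Q (L \<zeta>) (\<lambda>z. v z + t *\<^sub>R v' z) = c + t * c'"
        using \<phi> by (simp add: L2_inner_add_right L2_inner_scale_right L2_scale \<zeta>L2(4) LL2[OF \<zeta>])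
      then show "(\<lambda>z. v z + t *\<^sub>R v' z, c + t * c') \<in> ?G"
        unfolding E using C1_compact_lincomb(1)[OF \<phi>(1,2)] by auto
    qed (rule that)
    \<comment> \<open>The representer is a limit of members of the graph, so it stays in the closed
      subspace; this is why the Riesz lemma also delivers the sequence.\<close>
    have "H k \<in> energy_closure \<Omega> T" for k using H[of k] energy_closure_pair[OF \<Omega>] by auto
    then have "h \<in> energy_closure \<Omega> T"
      using energy_closure_closed[OF \<Omega>] h lim unfolding Q_def by blast
    then show ?thesis using eq by blast
  qed

  text \<open>The affine time weight makes the form coercive although \<open>\<Omega>\<close> may be unbounded.\<close>
  have coercive: "\<kappa> * (L2_norm Q (energy_pair \<zeta>))\<^sup>2 \<le> L2_inner Q (L \<zeta>) (energy_pair (\<lambda>z. (c + sg * snd z) * \<zeta> z))"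
    if \<zeta>: "\<zeta> \<in> C1_compact V" for \<zeta>
  proof -
    let ?w = "\<lambda>z::(real^'n) \<times> real. c + sg * snd z"
    \<comment> \<open>This is \<open>sg\<close> times the time derivative of the weight times
      \<open>\<zeta>^2\<close>; on each time line it integrates to the boundary terms in
      \<open>bd\<close>.\<close>
    define D where "D z = \<zeta> z * (sg * (sg * \<zeta> z + 2 * ?w z * time_deriv \<zeta> z))" for z
    have cont: "continuous_on UNIV \<zeta>" "continuous_on UNIV (time_deriv \<zeta>)"
      using \<zeta> by (auto intro: Cc_continuous C1_compact_Cc C1_compact_time_deriv_Cc)
    have D: "D \<in> Cc V"
      unfolding D_def[abs_def]
      by (rule Cc_vanishing[OF C1_compact_Cc[OF \<zeta>]]) (auto intro!: continuous_intros cont)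
    have slice: "integral {0..T} (\<lambda>t. D (x, t)) \<le> integral {0..T} (\<lambda>t. 0)" for x
    proof -
      have "((\<lambda>t. D (x, t)) has_integral
          sg * ((c + sg * T) * (\<zeta> (x, T))\<^sup>2) - sg * ((c + sg * 0) * (\<zeta> (x, 0))\<^sup>2)) {0..T}"
      proof (rule fundamental_theorem_of_calculus)
        show "((\<lambda>t. sg * ((c + sg * t) * (\<zeta> (x, t))\<^sup>2)) has_vector_derivative D (x, t)) (at t within {0..T})" for t
          unfolding has_real_derivative_iff_has_vector_derivative[symmetric] D_def
          by (rule DERIV_subset[where s = UNIV])
             (auto intro!: derivative_eq_intros C1_compact_DERIV_time[OF \<zeta>] simp: algebra_simps power2_eq_square)
      qed (use T in simp)
      then show ?thesis using bd[OF \<zeta>, of x] by (simp add: integral_unique algebra_simps)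
    qed
    have Dle: "(LINT z|lebesgue_on Q. D z) \<le> 0"
      using Cc_integral_mono_slices[OF \<Omega> D, of "\<lambda>z. 0" V T] slice
      by (simp add: Q_def Cc_def continuous_on_const exI[of _ "{}"])
    have w\<zeta>: "(\<lambda>z. ?w z * \<zeta> z) \<in> C1_compact V" by (rule C1_compact_time_weight(1)[OF \<zeta>])
    \<comment> \<open>Subtracting half of \<open>D\<close> does not lower the integral, and it makes
      the estimate pointwise: \<open>- sg * w * \<zeta> * time_deriv \<zeta>\<close> equals
      \<open>\<zeta>^2 / 2 - D / 2\<close>, with \<open>w\<close> the weight.\<close>
    have "\<kappa> * (L2_norm Q (energy_pair \<zeta>))\<^sup>2 \<le> \<kappa> * (L2_norm Q (energy_pair \<zeta>))\<^sup>2 - (LINT z|lebesgue_on Q. D z) / 2"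
      using Dle by simp
    also have "\<dots> = (LINT z|lebesgue_on Q. \<kappa> * (energy_pair \<zeta> z \<bullet> energy_pair \<zeta> z) - D z / 2)"
      using L2_inner_integrable[OF \<zeta>L2(4)[OF \<zeta>] \<zeta>L2(4)[OF \<zeta>]] Cc_integrable[OF D Ql]
      by (simp add: L2_norm_sq L2_inner_def)
    also have "\<dots> \<le> L2_inner Q (L \<zeta>) (energy_pair (\<lambda>z. ?w z * \<zeta> z))"
      unfolding L2_inner_def
    proof (rule integral_mono_AE)
      show "integrable (lebesgue_on Q) (\<lambda>z. \<kappa> * (energy_pair \<zeta> z \<bullet> energy_pair \<zeta> z) - D z / 2)"
        using L2_inner_integrable[OF \<zeta>L2(4)[OF \<zeta>] \<zeta>L2(4)[OF \<zeta>]] Cc_integrable[OF D Ql] by simp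
      show "integrable (lebesgue_on Q) (\<lambda>z. L \<zeta> z \<bullet> energy_pair (\<lambda>z. ?w z * \<zeta> z) z)"
        by (intro L2_inner_integrable LL2[OF \<zeta>] \<zeta>L2(4)[OF w\<zeta>])
      show "AE z in lebesgue_on Q. \<kappa> * (energy_pair \<zeta> z \<bullet> energy_pair \<zeta> z) - D z / 2
          \<le> L \<zeta> z \<bullet> energy_pair (\<lambda>z. ?w z * \<zeta> z) z"
        using a0(2) AE_space unfolding Q_def[symmetric]
      proof eventually_elim
        fix z assume a: "0 \<le> a0 z" and "z \<in> space (lebesgue_on Q)"
        then have wz: "1 \<le> ?w z" using w by (auto simp: Q_def space_restrict_space)
        have "D z = (\<zeta> z)\<^sup>2 + 2 * sg * ?w z * time_deriv \<zeta> z * \<zeta> z"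
        proof -
          have "D z = (sg * sg) * (\<zeta> z)\<^sup>2 + 2 * sg * ?w z * time_deriv \<zeta> z * \<zeta> z"
            unfolding D_def by (simp add: algebra_simps power2_eq_square)
          then show ?thesis unfolding sg by simp
        qed
        moreover have "L \<zeta> z \<bullet> energy_pair (\<lambda>z. ?w z * \<zeta> z) z
            = - sg * ?w z * time_deriv \<zeta> z * \<zeta> z + a0 z * (?w z * (\<zeta> z)\<^sup>2) + \<nu> * (?w z * (space_grad \<zeta> z \<bullet> space_grad \<zeta> z))"
          unfolding L_def energy_pair_def inner_Pair C1_compact_time_weight(2)[OF \<zeta>]
          by (simp add: algebra_simps power2_eq_square)
        moreover have "\<kappa> * (space_grad \<zeta> z \<bullet> space_grad \<zeta> z) \<le> \<nu> * (?w z * (space_grad \<zeta> z \<bullet> space_grad \<zeta> z))"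
          using \<kappa> mult_right_mono[OF wz, of "space_grad \<zeta> z \<bullet> space_grad \<zeta> z"] by (intro mult_mono) auto
        moreover have "\<kappa> * (\<zeta> z)\<^sup>2 \<le> 1/2 * (\<zeta> z)\<^sup>2" using \<kappa> by (intro mult_right_mono) auto
        moreover have "0 \<le> a0 z * (?w z * (\<zeta> z)\<^sup>2)" using a wz by simp
        ultimately show "\<kappa> * (energy_pair \<zeta> z \<bullet> energy_pair \<zeta> z) - D z / 2
          \<le> L \<zeta> z \<bullet> energy_pair (\<lambda>z. ?w z * \<zeta> z) z"
          unfolding energy_pair_def[of \<zeta>] inner_Pair inner_real_def power2_eq_square
          by (simp only: distrib_left mult.assoc mult.commute mult.left_commute) argo
      qed
    qed
    finally show ?thesis .
  qed

  have bound: "L2_norm Q (energy_pair \<zeta>) \<le> \<bar>M\<bar> / \<kappa> * L2_norm Q h"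
    if \<zeta>: "\<zeta> \<in> C1_compact V" and h: "h \<in> L2 Q"
      and eq: "\<And>\<phi>. \<phi> \<in> C1_compact (\<Omega> \<times> UNIV) \<Longrightarrow> L2_inner Q h (energy_pair \<phi>) = L2_inner Q (L \<zeta>) (energy_pair \<phi>)" for \<zeta> h
  proof -
    let ?w = "\<lambda>z::(real^'n) \<times> real. c + sg * snd z"
    let ?N = "L2_norm Q (energy_pair \<zeta>)"
    have w\<zeta>: "(\<lambda>z. ?w z * \<zeta> z) \<in> C1_compact V" by (rule C1_compact_time_weight(1)[OF \<zeta>])
    have "L2_norm Q (energy_pair (\<lambda>z. ?w z * \<zeta> z)) \<le> L2_norm Q (\<lambda>z. \<bar>M\<bar> *\<^sub>R energy_pair \<zeta> z)"
    proof (intro L2_norm_mono L2_scale \<zeta>L2(4)[OF w\<zeta>] \<zeta>L2(4)[OF \<zeta>])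
      fix z assume "z \<in> Q"
      then have "\<bar>?w z\<bar> \<le> \<bar>M\<bar>" using w[of "snd z"] by (auto simp: Q_def)
      moreover have "energy_pair (\<lambda>z. ?w z * \<zeta> z) z = ?w z *\<^sub>R energy_pair \<zeta> z"
        by (simp add: energy_pair_def C1_compact_time_weight(2)[OF \<zeta>])
      ultimately show "norm (energy_pair (\<lambda>z. ?w z * \<zeta> z) z) \<le> norm (\<bar>M\<bar> *\<^sub>R energy_pair \<zeta> z)"
        by (simp add: mult_right_mono)
    qed
    then have n: "L2_norm Q (energy_pair (\<lambda>z. ?w z * \<zeta> z)) \<le> \<bar>M\<bar> * ?N" by (simp add: L2_norm_scale)
    \<comment> \<open>The weighted test function is again a test function, so
      \<open>L \<zeta>\<close> may be replaced by its representer \<open>h\<close> in the coercivity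
      estimate.\<close>
    have "\<kappa> * ?N\<^sup>2 \<le> L2_inner Q h (energy_pair (\<lambda>z. ?w z * \<zeta> z))"
      using coercive[OF \<zeta>] eq[OF EV[OF w\<zeta>]] by simp
    also have "\<dots> \<le> L2_norm Q h * (\<bar>M\<bar> * ?N)"
      using L2_Cauchy_Schwarz[OF h \<zeta>L2(4)[OF w\<zeta>]] mult_left_mono[OF n, of "L2_norm Q h"] by simp
    finally have "?N * (\<kappa> * ?N) \<le> ?N * (L2_norm Q h * \<bar>M\<bar>)" by (simp add: power2_eq_square mult_ac)
    then have "?N = 0 \<or> \<kappa> * ?N \<le> L2_norm Q h * \<bar>M\<bar>"
      using L2_norm_nonneg[of Q "energy_pair \<zeta>"] by (force simp: mult_le_cancel_left)
    moreover have "0 \<le> L2_norm Q h * \<bar>M\<bar>" by simp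
    ultimately have "\<kappa> * ?N \<le> L2_norm Q h * \<bar>M\<bar>" by auto
    then show ?thesis using \<kappa> by (simp add: field_simps)
  qed

  \<comment> \<open>The graph of \<open>S \<zeta> -> <f, \<zeta>>\<close>; the estimate
    \<open>bound\<close> is what makes it bounded.\<close>
  define G where "G = {(h, L2_inner Q f \<zeta>) | h \<zeta>. \<zeta> \<in> C1_compact V \<and> h \<in> energy_closure \<Omega> T \<and>
    (\<forall>\<phi>\<in>C1_compact (\<Omega> \<times> UNIV). L2_inner Q h (energy_pair \<phi>) = L2_inner Q (L \<zeta>) (energy_pair \<phi>))}"
  have GL2: "h \<in> L2 Q" if "h \<in> energy_closure \<Omega> T" for h using that by (simp add: energy_closure_def Q_def)
  obtain h H where h: "h \<in> L2 Q" and H: "\<And>k. H k \<in> fst ` G"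
    and lim: "(\<lambda>k. L2_norm Q (\<lambda>z. H k z - h z)) \<longlonglongrightarrow> 0"
    and eq: "\<And>v c. (v, c) \<in> G \<Longrightarrow> L2_inner Q h v = c"
  proof (rule L2_Riesz_graph[of G Q "L2_norm Q f * (\<bar>M\<bar> / \<kappa>)"])
    show "v \<in> L2 Q" if "(v, c) \<in> G" for v c using that GL2 by (auto simp: G_def)
    show "\<bar>r\<bar> \<le> L2_norm Q f * (\<bar>M\<bar> / \<kappa>) * L2_norm Q v" if "(v, r) \<in> G" for v r
    proof -
      obtain \<zeta> where \<zeta>: "\<zeta> \<in> C1_compact V" "v \<in> L2 Q" "r = L2_inner Q f \<zeta>"
        "\<And>\<phi>. \<phi> \<in> C1_compact (\<Omega> \<times> UNIV) \<Longrightarrow> L2_inner Q v (energy_pair \<phi>) = L2_inner Q (L \<zeta>) (energy_pair \<phi>)"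
        using \<open>(v, r) \<in> G\<close> GL2 by (auto simp: G_def)
      have "L2_norm Q \<zeta> \<le> L2_norm Q (energy_pair \<zeta>)"
        using L2_fst_snd(3)[OF \<zeta>L2(4)[OF \<zeta>(1)]] by (simp add: energy_pair_def)
      also have "\<dots> \<le> \<bar>M\<bar> / \<kappa> * L2_norm Q v" by (rule bound[OF \<zeta>(1,2,4)])
      finally have "L2_norm Q f * L2_norm Q \<zeta> \<le> L2_norm Q f * (\<bar>M\<bar> / \<kappa> * L2_norm Q v)"
        by (intro mult_left_mono) auto
      then show ?thesis
        using L2_Cauchy_Schwarz[OF f[folded Q_def] \<zeta>L2(1)[OF \<zeta>(1)]] \<zeta>(3) by (simp add: mult.assoc)
    qed
    have "L (\<lambda>z. 0) = (\<lambda>z::(real^'n) \<times> real. 0)"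
      by (simp add: L_def[abs_def] space_grad_def time_deriv_def grad_zero zero_prod_def)
    moreover have "(\<lambda>z. 0) \<in> energy_closure \<Omega> T"
      using energy_closure_pair[OF \<Omega> C1_compact_zero]
      by (simp add: energy_pair_def[abs_def] space_grad_def grad_zero zero_prod_def)
    ultimately show "(\<lambda>z. 0, 0) \<in> G"
      using C1_compact_zero[of V] unfolding G_def by (auto intro!: exI[of _ "\<lambda>z. 0"] simp: L2_inner_def)
    fix v r v' r' t assume "(v, r) \<in> G" "(v', r') \<in> G"
    then obtain \<zeta> \<zeta>' where \<zeta>: "\<zeta> \<in> C1_compact V" "\<zeta>' \<in> C1_compact V"
      "v \<in> energy_closure \<Omega> T" "v' \<in> energy_closure \<Omega> T" "r = L2_inner Q f \<zeta>" "r' = L2_inner Q f \<zeta>'"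
      and e: "\<And>\<phi>. \<phi> \<in> C1_compact (\<Omega> \<times> UNIV) \<Longrightarrow> L2_inner Q v (energy_pair \<phi>) = L2_inner Q (L \<zeta>) (energy_pair \<phi>)"
       "\<And>\<phi>. \<phi> \<in> C1_compact (\<Omega> \<times> UNIV) \<Longrightarrow> L2_inner Q v' (energy_pair \<phi>) = L2_inner Q (L \<zeta>') (energy_pair \<phi>)"
      unfolding G_def by blast
    let ?\<zeta> = "\<lambda>z. \<zeta> z + t * \<zeta>' z"
    have Llin: "L ?\<zeta> = (\<lambda>z. L \<zeta> z + t *\<^sub>R L \<zeta>' z)"
      by (auto simp: L_def space_time_grad_lincomb[OF \<zeta>(1,2)] algebra_simps fun_eq_iff)
    have "L2_inner Q (\<lambda>z. v z + t *\<^sub>R v' z) (energy_pair \<phi>) = L2_inner Q (L ?\<zeta>) (energy_pair \<phi>)"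
      if "\<phi> \<in> C1_compact (\<Omega> \<times> UNIV)" for \<phi>
      unfolding Llin using that e \<zeta>
      by (simp add: L2_inner_add_left L2_inner_scale_left L2_scale GL2 LL2 \<zeta>L2(4))
    moreover have "L2_inner Q f ?\<zeta> = r + t * r'"
      using \<zeta> L2_inner_add_right[OF \<zeta>L2(1)[OF \<zeta>(1)] L2_mult[OF \<zeta>L2(1)[OF \<zeta>(2)], of t] f[folded Q_def]]
        L2_inner_scale_right[of Q f t \<zeta>'] by simp
    ultimately show "(\<lambda>z. v z + t *\<^sub>R v' z, r + t * r') \<in> G"
      unfolding G_def using C1_compact_lincomb(1)[OF \<zeta>(1,2)] energy_closure_lincomb[OF \<Omega> \<zeta>(3,4)]
      by (intro CollectI exI[of _ "\<lambda>z. v z + t *\<^sub>R v' z"] exI[of _ ?\<zeta>]) auto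
  qed (rule that)
  have "H k \<in> energy_closure \<Omega> T" for k using H[of k] by (auto simp: G_def)
  then have hc: "h \<in> energy_closure \<Omega> T"
    using energy_closure_closed[OF \<Omega>] h lim unfolding Q_def by blast
  \<comment> \<open>The identity that characterises \<open>k\<close> below is available only against
    energy pairs of regular functions; \<open>h\<close> is reached as their limit.\<close>
  obtain \<Phi> where \<Phi>: "\<And>k. \<Phi> k \<in> C1_compact (\<Omega> \<times> UNIV)"
    and \<Phi>lim: "(\<lambda>k. L2_norm Q (\<lambda>z. energy_pair (\<Phi> k) z - h z)) \<longlonglongrightarrow> 0"
    using energy_closure_sequence[OF \<Omega> hc] unfolding Q_def by blast
  note yg = L2_fst_snd(1,2)[OF h]
  have "- sg * L2_inner Q (\<lambda>z. fst (h z)) (time_deriv \<zeta>) + \<nu> * L2_inner Q (\<lambda>z. snd (h z)) (space_grad \<zeta>)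
        + L2_inner Q (\<lambda>z. a0 z * fst (h z)) \<zeta> = L2_inner Q f \<zeta>" if \<zeta>: "\<zeta> \<in> C1_compact V" for \<zeta>
  proof -
    obtain k where k: "k \<in> energy_closure \<Omega> T"
      "\<And>\<phi>. \<phi> \<in> C1_compact (\<Omega> \<times> UNIV) \<Longrightarrow> L2_inner Q k (energy_pair \<phi>) = L2_inner Q (L \<zeta>) (energy_pair \<phi>)"
      using rep[OF \<zeta>] by blast
    have "L2_inner Q h k = L2_inner Q f \<zeta>" using k \<zeta> by (intro eq) (auto simp: G_def)
    moreover have "L2_inner Q h k = L2_inner Q h (L \<zeta>)"
    proof (rule LIMSEQ_unique)
      show "(\<lambda>j. L2_inner Q (energy_pair (\<Phi> j)) k) \<longlonglongrightarrow> L2_inner Q h k"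
        by (intro L2_inner_tendsto \<zeta>L2(4)[OF \<Phi>] h GL2 k \<Phi>lim)
      have "(\<lambda>j. L2_inner Q (energy_pair (\<Phi> j)) (L \<zeta>)) \<longlonglongrightarrow> L2_inner Q h (L \<zeta>)"
        by (intro L2_inner_tendsto \<zeta>L2(4)[OF \<Phi>] h LL2[OF \<zeta>] \<Phi>lim)
      then show "(\<lambda>j. L2_inner Q (energy_pair (\<Phi> j)) k) \<longlonglongrightarrow> L2_inner Q h (L \<zeta>)"
        using k(2)[OF \<Phi>] by (simp add: L2_inner_commute[of Q k] L2_inner_commute[of Q "L \<zeta>"])
    qed
    moreover have "L2_inner Q h (L \<zeta>) = L2_inner Q (\<lambda>z. fst (h z)) (\<lambda>z. - sg * time_deriv \<zeta> z + a0 z * \<zeta> z)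
        + L2_inner Q (\<lambda>z. snd (h z)) (\<lambda>z. \<nu> *\<^sub>R space_grad \<zeta> z)"
      using L2_inner_Pair[OF yg L1L2[OF \<zeta>] L2_scale[OF \<zeta>L2(3)[OF \<zeta>], of \<nu>]] by (simp add: L_def[abs_def])
    moreover have "L2_inner Q (\<lambda>z. fst (h z)) (\<lambda>z. - sg * time_deriv \<zeta> z + a0 z * \<zeta> z)
        = - sg * L2_inner Q (\<lambda>z. fst (h z)) (time_deriv \<zeta>) + L2_inner Q (\<lambda>z. a0 z * fst (h z)) \<zeta>"
      using L2_inner_add_right[OF L2_mult[OF \<zeta>L2(2)[OF \<zeta>], of "- sg"] \<zeta>L2(5)[OF \<zeta>] yg(1)]
        L2_inner_scale_right[of Q "\<lambda>z. fst (h z)" "- sg" "time_deriv \<zeta>"]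
      by (simp add: L2_inner_def mult_ac)
    ultimately show ?thesis by (simp add: L2_inner_scale_right)
  qed
  then show ?thesis
    unfolding weak_parabolic_def Q_def[symmetric] using energy_closure_energy_space[OF \<Omega> hc] by blast
qed

section \<open>Mollification in time\<close>

text \<open>With the argument \<open>s - snd z\<close>, a kernel living on positive numbers averages
  over later times and its reflection over earlier ones. Only times in \<open>{0..T}\<close> enter,
  because the approximants are controlled on the cylinder alone.\<close>

definition tconv :: "real \<Rightarrow> (real \<Rightarrow> real) \<Rightarrow> ('a \<times> real \<Rightarrow> 'b::banach) \<Rightarrow> 'a \<times> real \<Rightarrow> 'b" where
  "tconv T \<eta> \<phi> z = integral {0..T} (\<lambda>s. \<eta> (s - snd z) *\<^sub>R \<phi> (fst z, s))"

lemma continuous_on_slice: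
  fixes \<phi> :: "'a::topological_space \<times> 'b::topological_space \<Rightarrow> 'c::topological_space"
  assumes "continuous_on UNIV \<phi>" shows "continuous_on A (\<lambda>s. \<phi> (x, s))"
  by (rule continuous_on_compose2[OF assms]) (auto intro!: continuous_intros)

lemma continuous_on_real_comp:
  fixes \<eta> :: "real \<Rightarrow> 'c::topological_space"
  assumes "continuous_on UNIV \<eta>" "continuous_on A f" shows "continuous_on A (\<lambda>s. \<eta> (f s))"
  by (rule continuous_on_compose2[OF assms]) auto

lemma tconv_continuous:
  fixes \<phi> :: "'a::topological_space \<times> real \<Rightarrow> 'b::banach"
  assumes "continuous_on UNIV \<eta>" "continuous_on UNIV \<phi>"
  shows "continuous_on UNIV (tconv T \<eta> \<phi>)"
proof -
  have "continuous_on UNIV (\<lambda>z. integral (cbox 0 T) (\<lambda>s. \<eta> (s - snd z) *\<^sub>R \<phi> (fst z, s)))"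
  proof (rule integral_continuous_on_param)
    show "continuous_on (UNIV \<times> cbox 0 T) (\<lambda>(z, s). \<eta> (s - snd z) *\<^sub>R \<phi> (fst z, s))"
      unfolding case_prod_unfold
      by (intro continuous_intros continuous_on_real_comp[OF assms(1)] continuous_on_compose2[OF assms(2)]) auto
  qed
  then show ?thesis by (simp add: tconv_def[abs_def])
qed

lemma tconv_integrable:
  fixes \<phi> :: "'a::topological_space \<times> real \<Rightarrow> 'b::banach"
  assumes "continuous_on UNIV \<eta>" "continuous_on UNIV \<phi>"
  shows "(\<lambda>s. \<eta> (s - t) *\<^sub>R \<phi> (x, s)) integrable_on {0..T}"
  by (intro integrable_continuous_real continuous_intros continuous_on_real_comp[OF assms(1)]
      continuous_on_slice assms(2))

lemma tconv_diff:
  fixes \<phi> \<psi> :: "'a::topological_space \<times> real \<Rightarrow> 'b::banach"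
  assumes "continuous_on UNIV \<eta>" "continuous_on UNIV \<phi>" "continuous_on UNIV \<psi>"
  shows "tconv T \<eta> (\<lambda>z. \<phi> z - \<psi> z) z = tconv T \<eta> \<phi> z - tconv T \<eta> \<psi> z"
  unfolding tconv_def scaleR_diff_right
  by (intro integral_diff tconv_integrable assms)

text \<open>Outside the spatial projection of \<open>K\<close> the whole time line misses
  \<open>K\<close>, and for \<open>t\<close> outside \<open>{l..u}\<close> the kernel is zero on the
  range of integration; hence a product as the supporting set.\<close>

lemma tconv_vanishes:
  fixes \<phi> :: "'a::topological_space \<times> real \<Rightarrow> 'b::banach"
  assumes K: "compact K" "K \<subseteq> \<Omega> \<times> UNIV" "\<And>z. z \<notin> K \<Longrightarrow> \<phi> z = 0"
    and \<eta>: "\<And>t s. 0 \<le> s \<Longrightarrow> s \<le> T \<Longrightarrow> t \<notin> {l..u} \<Longrightarrow> \<eta> (s - t) = 0" and J: "{l..u} \<subseteq> J"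
  shows "compact (fst ` K \<times> {l..u}) \<and> fst ` K \<times> {l..u} \<subseteq> \<Omega> \<times> J \<and>
    (\<forall>z. z \<notin> fst ` K \<times> {l..u} \<longrightarrow> tconv T \<eta> \<phi> z = 0)"
proof (intro conjI allI impI)
  show "compact (fst ` K \<times> {l..u})"
    by (intro compact_Times compact_continuous_image continuous_intros K compact_Icc)
  show "fst ` K \<times> {l..u} \<subseteq> \<Omega> \<times> J" using K(2) J by auto
  fix z :: "'a \<times> real" assume "z \<notin> fst ` K \<times> {l..u}"
  then have "fst z \<notin> fst ` K \<or> snd z \<notin> {l..u}" by (cases z) auto
  then have "\<eta> (s - snd z) *\<^sub>R \<phi> (fst z, s) = 0" if "s \<in> {0..T}" for s
  proof
    assume "fst z \<notin> fst ` K"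
    then have "(fst z, s) \<notin> K" using imageI[of "(fst z, s)" K fst] by auto
    then show ?thesis using K(3) by simp
  qed (use that \<eta> in auto)
  then show "tconv T \<eta> \<phi> z = 0"
    unfolding tconv_def by (subst Henstock_Kurzweil_Integration.integral_cong[of "{0..T}" _ "\<lambda>_. 0"]) auto
qed

text \<open>Differentiation under the integral: the spatial gradient falls on \<open>\<phi>\<close>,
  the time derivative on the kernel, with a minus sign. The support interval \<open>{l..u}\<close>
  of the result decides which equation it may test.\<close>

lemma tconv_C1_compact:
  fixes \<phi> :: "(real^'n) \<times> real \<Rightarrow> real"
  assumes \<phi>: "\<phi> \<in> C1_compact (\<Omega> \<times> UNIV)" and d\<eta>: "\<And>x. (\<eta> has_real_derivative \<eta>' x) (at x)"
    and c\<eta>': "continuous_on UNIV \<eta>'"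
    and \<eta>: "\<And>t s. 0 \<le> s \<Longrightarrow> s \<le> T \<Longrightarrow> t \<notin> {l..u} \<Longrightarrow> \<eta> (s - t) = 0" and J: "{l..u} \<subseteq> J"
  shows "tconv T \<eta> \<phi> \<in> C1_compact (\<Omega> \<times> J)"
    and "space_grad (tconv T \<eta> \<phi>) = tconv T \<eta> (space_grad \<phi>)"
    and "time_deriv (tconv T \<eta> \<phi>) = (\<lambda>z. - tconv T \<eta>' \<phi> z)"
proof -
  have c\<eta>: "continuous_on UNIV \<eta>"
    using d\<eta> by (meson DERIV_isCont continuous_at_imp_continuous_on)
  note c\<phi> = Cc_continuous[OF C1_compact_Cc[OF \<phi>]] and cg = Cc_continuous[OF C1_compact_space_grad_Cc[OF \<phi>]]
  define G where "G z = (tconv T \<eta> (space_grad \<phi>) z, - tconv T \<eta>' \<phi> z)" for z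
  \<comment> \<open>The gradient of the integrand in \<open>z\<close>;
    \<open>blinfun_inner_left\<close> turns it into the bounded linear map that the Leibniz rule
    asks for.\<close>
  define g where "g z s = (\<eta> (s - snd z) *\<^sub>R space_grad \<phi> (fst z, s), - \<eta>' (s - snd z) * \<phi> (fst z, s))"
    for z :: "(real^'n) \<times> real" and s
  have cgg: "continuous_on A (\<lambda>s. g z s)" for A z
    unfolding g_def by (intro continuous_intros continuous_on_real_comp[OF c\<eta>] continuous_on_real_comp[OF c\<eta>']
        continuous_on_slice c\<phi> cg)
  have D: "GDERIV (tconv T \<eta> \<phi>) z :> G z" for z
  proof -
    have "((\<lambda>z. integral (cbox 0 T) (\<lambda>s. \<eta> (s - snd z) * \<phi> (fst z, s)))
       has_derivative blinfun_apply (integral (cbox 0 T) (\<lambda>s. blinfun_inner_left (g z s)))) (at z within UNIV)"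
    proof (rule leibniz_rule[where fx = "\<lambda>z s. blinfun_inner_left (g z s)"])
      fix x :: "(real^'n) \<times> real" and s :: real
      have "((\<lambda>x. (fst x, s)) has_derivative (\<lambda>h. (fst h, 0))) (at x)"
        by (auto intro!: derivative_eq_intros)
      from has_derivative_compose[OF this, of \<phi>] C1_compact_GDERIV[OF \<phi>, of "(fst x, s)"]
      have 1: "((\<lambda>x. \<phi> (fst x, s)) has_derivative (\<lambda>h. (fst h, 0) \<bullet> grad \<phi> (fst x, s))) (at x)"
        by (simp add: gderiv_def)
      have "((\<lambda>x. s - snd x) has_derivative (\<lambda>h. - snd h)) (at x)"
        by (auto intro!: derivative_eq_intros)
      from has_derivative_compose[OF this d\<eta>[unfolded has_field_derivative_def]]
      have 2: "((\<lambda>x. \<eta> (s - snd x)) has_derivative (\<lambda>h. \<eta>' (s - snd x) * - snd h)) (at x)" .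
      show "((\<lambda>z. \<eta> (s - snd z) * \<phi> (fst z, s)) has_derivative blinfun_apply (blinfun_inner_left (g x s))) (at x within UNIV)"
        by (rule has_derivative_eq_rhs[OF has_derivative_mult[OF 2 1]])
           (auto simp: g_def fun_eq_iff inner_prod_def space_grad_def blinfun_inner_left.rep_eq)
    next
      show "(\<lambda>s. \<eta> (s - snd x) * \<phi> (fst x, s)) integrable_on cbox 0 T" for x
        using tconv_integrable[OF c\<eta> c\<phi>] by simp
      show "continuous_on (UNIV \<times> cbox 0 T) (\<lambda>(x, t). blinfun_inner_left (g x t))"
        unfolding case_prod_unfold g_def
        by (intro bounded_linear.continuous_on[OF bounded_linear_blinfun_inner_left] continuous_intros
            continuous_on_real_comp[OF c\<eta>] continuous_on_real_comp[OF c\<eta>']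
            continuous_on_compose2[OF c\<phi>] continuous_on_compose2[OF cg]) auto
    qed auto
    moreover have "integral (cbox 0 T) (\<lambda>s. blinfun_inner_left (g z s)) = blinfun_inner_left (integral (cbox 0 T) (g z))"
      using integral_linear[OF _ bounded_linear_blinfun_inner_left, of "g z" "cbox 0 T"] cgg
      by (simp add: o_def integrable_continuous_real)
    moreover have "integral (cbox 0 T) (g z) = G z"
    proof (rule prod_eqI)
      have i: "g z integrable_on {0..T}" by (intro integrable_continuous_real cgg)
      show "fst (integral (cbox 0 T) (g z)) = fst (G z)"
        using integral_linear[OF i bounded_linear_fst] by (simp add: o_def g_def G_def tconv_def)
      show "snd (integral (cbox 0 T) (g z)) = snd (G z)"
        using integral_linear[OF i bounded_linear_snd] by (simp add: o_def g_def G_def tconv_def)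
    qed
    ultimately show ?thesis
      by (simp add: gderiv_def tconv_def[abs_def] blinfun_inner_left.rep_eq)
  qed
  show "space_grad (tconv T \<eta> \<phi>) = tconv T \<eta> (space_grad \<phi>)"
    "time_deriv (tconv T \<eta> \<phi>) = (\<lambda>z. - tconv T \<eta>' \<phi> z)"
    by (auto simp: fun_eq_iff space_grad_def[of "tconv T \<eta> \<phi>"] time_deriv_def grad_eq[OF D] G_def)
  obtain K where K: "compact K" "K \<subseteq> \<Omega> \<times> UNIV" "\<And>z. z \<notin> K \<Longrightarrow> \<phi> z = 0"
    using \<phi> by (auto simp: C1_compact_def)
  have "compact (fst ` K \<times> {l..u}) \<and> fst ` K \<times> {l..u} \<subseteq> \<Omega> \<times> J \<and>
    (\<forall>z. z \<notin> fst ` K \<times> {l..u} \<longrightarrow> tconv T \<eta> \<phi> z = 0)"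
    using K \<eta> J by (intro tconv_vanishes) auto
  then have K': "compact (fst ` K \<times> {l..u})" "fst ` K \<times> {l..u} \<subseteq> \<Omega> \<times> J"
    "\<And>z. z \<notin> fst ` K \<times> {l..u} \<Longrightarrow> tconv T \<eta> \<phi> z = 0" by blast+
  show "tconv T \<eta> \<phi> \<in> C1_compact (\<Omega> \<times> J)"
    by (rule C1_compactI[OF D _ K'])
       (auto simp: G_def intro!: continuous_intros tconv_continuous c\<eta> c\<eta>' c\<phi> cg)
qed

lemma tconv_Cc:
  fixes \<phi> :: "'a::t2_space \<times> real \<Rightarrow> 'b::banach"
  assumes \<phi>: "\<phi> \<in> Cc (\<Omega> \<times> UNIV)" and c: "continuous_on UNIV \<eta>" and R: "\<And>x. R < \<bar>x\<bar> \<Longrightarrow> \<eta> x = 0"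
  shows "tconv T \<eta> \<phi> \<in> Cc (\<Omega> \<times> UNIV)"
proof -
  obtain K where K: "compact K" "K \<subseteq> \<Omega> \<times> UNIV" "\<And>z. z \<notin> K \<Longrightarrow> \<phi> z = 0"
    using \<phi> by (auto simp: Cc_def)
  \<comment> \<open>For \<open>s\<close> in \<open>[0, T]\<close>, the condition
    \<open>|s - t| \<le> R\<close> forces \<open>t\<close> into \<open>[-R, T + R]\<close>.\<close>
  have "\<eta> (s - t) = 0" if "0 \<le> s" "s \<le> T" "t \<notin> {-R..T+R}" for s t
    using that by (intro R) auto
  then have "compact (fst ` K \<times> {-R..T+R}) \<and> fst ` K \<times> {-R..T+R} \<subseteq> \<Omega> \<times> UNIV \<and>
    (\<forall>z. z \<notin> fst ` K \<times> {-R..T+R} \<longrightarrow> tconv T \<eta> \<phi> z = 0)"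
    using K by (intro tconv_vanishes) auto
  then show ?thesis
    using tconv_continuous[OF c Cc_continuous[OF \<phi>]] unfolding Cc_def by blast
qed

text \<open>On each time line the double integral over the square \<open>[0, T] x [0, T]\<close> may
  be exchanged, and swapping the roles of \<open>s\<close> and \<open>t\<close> reflects the kernel.
  Truncating the convolution to \<open>[0, T]\<close> is what makes this exact.\<close>

lemma tconv_symmetric:
  fixes \<phi> \<psi> :: "(real^'n) \<times> real \<Rightarrow> 'b::euclidean_space"
  assumes \<Omega>: "open \<Omega>" and \<phi>: "\<phi> \<in> Cc (\<Omega> \<times> UNIV)" and \<psi>: "\<psi> \<in> Cc (\<Omega> \<times> UNIV)" and c: "continuous_on UNIV \<eta>"
  shows "L2_inner (cylinder \<Omega> T) \<psi> (tconv T \<eta> \<phi>) = L2_inner (cylinder \<Omega> T) \<phi> (tconv T (\<lambda>x. \<eta> (- x)) \<psi>)"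
proof -
  have c': "continuous_on UNIV (\<lambda>x. \<eta> (- x))" by (intro continuous_on_real_comp[OF c] continuous_intros)
  note c\<phi> = Cc_continuous[OF \<phi>] and c\<psi> = Cc_continuous[OF \<psi>]
  have 1: "(\<lambda>z. \<psi> z \<bullet> tconv T \<eta> \<phi> z) \<in> Cc (\<Omega> \<times> UNIV)"
    by (intro Cc_inner \<psi> tconv_continuous c c\<phi>)
  have 2: "(\<lambda>z. \<phi> z \<bullet> tconv T (\<lambda>x. \<eta> (- x)) \<psi> z) \<in> Cc (\<Omega> \<times> UNIV)"
    by (intro Cc_inner \<phi> tconv_continuous c' c\<psi>)
  have in_out: "integral {0..T} (\<lambda>s. \<eta> (s - t) * (v \<bullet> \<phi> (x, s))) = v \<bullet> integral {0..T} (\<lambda>s. \<eta> (s - t) *\<^sub>R \<phi> (x, s))"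
    if "continuous_on UNIV \<phi>" "continuous_on UNIV \<eta>" for \<eta> t x v and \<phi> :: "(real^'n) \<times> real \<Rightarrow> 'b"
    using integral_linear[OF tconv_integrable[OF that(2,1), of t x T] bounded_linear_inner_right[of v]] by (simp add: o_def)
  have "integral {0..T} (\<lambda>t. \<psi> (x, t) \<bullet> tconv T \<eta> \<phi> (x, t))
      = integral {0..T} (\<lambda>t. \<phi> (x, t) \<bullet> tconv T (\<lambda>x. \<eta> (- x)) \<psi> (x, t))" for x
  proof -
    have "integral (cbox 0 T) (\<lambda>t. integral (cbox 0 T) (\<lambda>s. \<eta> (s - t) * (\<psi> (x, t) \<bullet> \<phi> (x, s))))
        = integral (cbox 0 T) (\<lambda>s. integral (cbox 0 T) (\<lambda>t. \<eta> (s - t) * (\<psi> (x, t) \<bullet> \<phi> (x, s))))"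
    proof (rule integral_swap_continuous)
      show "continuous_on (cbox (0, 0) (T, T)) (\<lambda>(t, s). \<eta> (s - t) * (\<psi> (x, t) \<bullet> \<phi> (x, s)))"
        unfolding case_prod_unfold
        by (intro continuous_intros continuous_on_real_comp[OF c] continuous_on_compose2[OF c\<phi>]
            continuous_on_compose2[OF c\<psi>]) auto
    qed
    moreover have "integral {0..T} (\<lambda>t. \<psi> (x, t) \<bullet> tconv T \<eta> \<phi> (x, t))
        = integral {0..T} (\<lambda>t. integral {0..T} (\<lambda>s. \<eta> (s - t) * (\<psi> (x, t) \<bullet> \<phi> (x, s))))"
      unfolding tconv_def fst_conv snd_conv in_out[OF c\<phi> c] ..
    moreover have "integral {0..T} (\<lambda>s. \<phi> (x, s) \<bullet> tconv T (\<lambda>x. \<eta> (- x)) \<psi> (x, s))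
        = integral {0..T} (\<lambda>s. integral {0..T} (\<lambda>t. \<eta> (s - t) * (\<psi> (x, t) \<bullet> \<phi> (x, s))))"
      unfolding tconv_def fst_conv snd_conv in_out[OF c\<psi> c', symmetric] by (simp add: inner_commute)
    ultimately show ?thesis by simp
  qed
  then show ?thesis
    unfolding L2_inner_def
    by (intro antisym Cc_integral_mono_slices[OF \<Omega> 1 2] Cc_integral_mono_slices[OF \<Omega> 2 1]) simp_all
qed

text \<open>The weighted square of \<open>u - I / \<Lambda>\<close> has nonnegative integral, where
  \<open>I\<close> is the weighted integral of \<open>u\<close>; only an upper bound of the total
  weight enters.\<close>

lemma integral_weighted_Cauchy_Schwarz:
  fixes w u :: "real \<Rightarrow> real"
  assumes w: "continuous_on {a..b} w" "\<And>x. x \<in> {a..b} \<Longrightarrow> 0 \<le> w x" and u: "continuous_on {a..b} u"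
    and \<Lambda>: "integral {a..b} w \<le> \<Lambda>" "0 < \<Lambda>"
  shows "(integral {a..b} (\<lambda>x. w x * u x))\<^sup>2 \<le> \<Lambda> * integral {a..b} (\<lambda>x. w x * (u x)\<^sup>2)"
proof -
  define I where "I = integral {a..b} (\<lambda>x. w x * u x)"
  have "0 \<le> integral {a..b} (\<lambda>x. w x * (u x - I / \<Lambda>)\<^sup>2)"
    by (intro integral_nonneg integrable_continuous_real continuous_intros w u) (use w in auto)
  also have "\<dots> = integral {a..b} (\<lambda>x. w x * (u x)\<^sup>2 - 2 * (I / \<Lambda>) * (w x * u x) + (I / \<Lambda>)\<^sup>2 * w x)"
    by (rule Henstock_Kurzweil_Integration.integral_cong) (simp add: power2_eq_square algebra_simps)
  also have "\<dots> = integral {a..b} (\<lambda>x. w x * (u x)\<^sup>2) - 2 * (I / \<Lambda>) * I + (I / \<Lambda>)\<^sup>2 * integral {a..b} w"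
    unfolding I_def
    by (subst integral_add integral_diff; (intro integrable_continuous_real continuous_intros w u)?)+ simp
  also have "\<dots> \<le> integral {a..b} (\<lambda>x. w x * (u x)\<^sup>2) - 2 * (I / \<Lambda>) * I + (I / \<Lambda>)\<^sup>2 * \<Lambda>"
    using \<Lambda> by (intro add_left_mono mult_left_mono) auto
  also have "\<dots> = integral {a..b} (\<lambda>x. w x * (u x)\<^sup>2) - I\<^sup>2 / \<Lambda>"
    using \<Lambda> by (simp add: power2_eq_square field_simps)
  finally show ?thesis using \<Lambda> unfolding I_def[symmetric] by (simp add: field_simps)
qed

text \<open>Schur's test: Cauchy-Schwarz with weight \<open>|\<eta>|\<close> costs one factor
  \<open>\<Lambda>\<close> from the integrals in \<open>s\<close>, and after exchanging the order of
  integration the integrals in \<open>t\<close> cost the other.\<close>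

lemma tconv_bound:
  fixes \<phi> :: "(real^'n) \<times> real \<Rightarrow> 'b::euclidean_space"
  assumes \<Omega>: "open \<Omega>" and \<phi>: "\<phi> \<in> Cc (\<Omega> \<times> UNIV)" and c: "continuous_on UNIV \<eta>" and R: "\<And>x. R < \<bar>x\<bar> \<Longrightarrow> \<eta> x = 0"
    and \<Lambda>: "0 < \<Lambda>" "\<And>t. t \<in> {0..T} \<Longrightarrow> integral {0..T} (\<lambda>s. \<bar>\<eta> (s - t)\<bar>) \<le> \<Lambda>"
      "\<And>s. s \<in> {0..T} \<Longrightarrow> integral {0..T} (\<lambda>t. \<bar>\<eta> (s - t)\<bar>) \<le> \<Lambda>"
  shows "L2_norm (cylinder \<Omega> T) (tconv T \<eta> \<phi>) \<le> \<Lambda> * L2_norm (cylinder \<Omega> T) \<phi>"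
proof -
  note c\<phi> = Cc_continuous[OF \<phi>]
  have c2: "continuous_on A (\<lambda>s. \<bar>\<eta> (f s)\<bar>)" if "continuous_on A f" for A :: "real set" and f
    using that by (intro continuous_intros continuous_on_real_comp[OF c])
  have ct: "tconv T \<eta> \<phi> \<in> Cc (\<Omega> \<times> UNIV)" by (rule tconv_Cc[OF \<phi> c R])
  have slice: "integral {0..T} (\<lambda>t. (norm (tconv T \<eta> \<phi> (x, t)))\<^sup>2) \<le> integral {0..T} (\<lambda>t. \<Lambda>\<^sup>2 * (norm (\<phi> (x, t)))\<^sup>2)" for x
  proof -
    let ?u = "\<lambda>s. norm (\<phi> (x, s))"
    have cu: "continuous_on A ?u" for A by (intro continuous_intros continuous_on_slice c\<phi>)
    have cI: "continuous_on {0..T} (\<lambda>t. integral (cbox 0 T) (\<lambda>s. \<bar>\<eta> (s - t)\<bar> * (?u s)\<^sup>2))"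
    proof (rule integral_continuous_on_param)
      show "continuous_on ({0..T} \<times> cbox 0 T) (\<lambda>(t, s). \<bar>\<eta> (s - t)\<bar> * (?u s)\<^sup>2)"
        unfolding case_prod_unfold
        by (intro continuous_intros continuous_on_real_comp[OF c] continuous_on_compose2[OF c\<phi>]) auto
    qed
    have "integral {0..T} (\<lambda>t. (norm (tconv T \<eta> \<phi> (x, t)))\<^sup>2)
        \<le> integral {0..T} (\<lambda>t. \<Lambda> * integral {0..T} (\<lambda>s. \<bar>\<eta> (s - t)\<bar> * (?u s)\<^sup>2))"
    proof (rule integral_le)
      show "(\<lambda>t. (norm (tconv T \<eta> \<phi> (x, t)))\<^sup>2) integrable_on {0..T}"
        by (intro integrable_continuous_real continuous_intros continuous_on_slice Cc_continuous[OF ct])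
      show "(\<lambda>t. \<Lambda> * integral {0..T} (\<lambda>s. \<bar>\<eta> (s - t)\<bar> * (?u s)\<^sup>2)) integrable_on {0..T}"
        using cI by (intro integrable_continuous_real continuous_intros) simp
      fix t assume t: "t \<in> {0..T}"
      have "norm (tconv T \<eta> \<phi> (x, t)) \<le> integral {0..T} (\<lambda>s. \<bar>\<eta> (s - t)\<bar> * ?u s)"
        unfolding tconv_def fst_conv snd_conv
        by (intro integral_norm_bound_integral tconv_integrable c c\<phi> integrable_continuous_real continuous_intros c2 cu) auto
      then have "(norm (tconv T \<eta> \<phi> (x, t)))\<^sup>2 \<le> (integral {0..T} (\<lambda>s. \<bar>\<eta> (s - t)\<bar> * ?u s))\<^sup>2"
        by (intro power_mono) auto
      also have "\<dots> \<le> \<Lambda> * integral {0..T} (\<lambda>s. \<bar>\<eta> (s - t)\<bar> * (?u s)\<^sup>2)"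
        using t by (intro integral_weighted_Cauchy_Schwarz c2 cu \<Lambda> continuous_intros) auto
      finally show "(norm (tconv T \<eta> \<phi> (x, t)))\<^sup>2 \<le> \<Lambda> * integral {0..T} (\<lambda>s. \<bar>\<eta> (s - t)\<bar> * (?u s)\<^sup>2)" .
    qed
    also have "\<dots> = \<Lambda> * integral {0..T} (\<lambda>s. integral {0..T} (\<lambda>t. \<bar>\<eta> (s - t)\<bar> * (?u s)\<^sup>2))"
    proof -
      have "integral (cbox 0 T) (\<lambda>t. integral (cbox 0 T) (\<lambda>s. \<bar>\<eta> (s - t)\<bar> * (?u s)\<^sup>2))
         = integral (cbox 0 T) (\<lambda>s. integral (cbox 0 T) (\<lambda>t. \<bar>\<eta> (s - t)\<bar> * (?u s)\<^sup>2))"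
      proof (rule integral_swap_continuous)
        show "continuous_on (cbox (0, 0) (T, T)) (\<lambda>(t, s). \<bar>\<eta> (s - t)\<bar> * (?u s)\<^sup>2)"
          unfolding case_prod_unfold
          by (intro continuous_intros continuous_on_real_comp[OF c] continuous_on_compose2[OF c\<phi>]) auto
      qed
      then show ?thesis by simp
    qed
    also have "\<dots> = \<Lambda> * integral {0..T} (\<lambda>s. (?u s)\<^sup>2 * integral {0..T} (\<lambda>t. \<bar>\<eta> (s - t)\<bar>))"
      by (simp add: mult.commute)
    also have "\<dots> \<le> \<Lambda> * integral {0..T} (\<lambda>s. (?u s)\<^sup>2 * \<Lambda>)"
    proof (intro mult_left_mono integral_le)
      have "continuous_on {0..T} (\<lambda>s. integral (cbox 0 T) (\<lambda>t. \<bar>\<eta> (s - t)\<bar>))"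
      proof (rule integral_continuous_on_param)
        show "continuous_on ({0..T} \<times> cbox 0 T) (\<lambda>(s, t). \<bar>\<eta> (s - t)\<bar>)"
          unfolding case_prod_unfold by (intro continuous_intros continuous_on_real_comp[OF c])
      qed
      then show "(\<lambda>s. (?u s)\<^sup>2 * integral {0..T} (\<lambda>t. \<bar>\<eta> (s - t)\<bar>)) integrable_on {0..T}"
        by (intro integrable_continuous_real continuous_intros cu) simp
      show "(\<lambda>s. (?u s)\<^sup>2 * \<Lambda>) integrable_on {0..T}"
        by (intro integrable_continuous_real continuous_intros cu)
    qed (use \<Lambda> in \<open>auto intro: mult_left_mono\<close>)
    also have "\<dots> = integral {0..T} (\<lambda>t. \<Lambda>\<^sup>2 * (?u t)\<^sup>2)"
      by (simp add: power2_eq_square mult_ac)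
    finally show ?thesis .
  qed
  have "(L2_norm (cylinder \<Omega> T) (tconv T \<eta> \<phi>))\<^sup>2 \<le> (LINT z|lebesgue_on (cylinder \<Omega> T). \<Lambda>\<^sup>2 * (norm (\<phi> z))\<^sup>2)"
    using Cc_integral_mono_slices[OF \<Omega> Cc_norm_sq[OF ct] Cc_scaleR[OF Cc_norm_sq[OF \<phi>], of "\<lambda>_. \<Lambda>\<^sup>2"], of T] slice
    by (simp add: L2_norm_def integral_nonneg_AE)
  also have "\<dots> = (\<Lambda> * L2_norm (cylinder \<Omega> T) \<phi>)\<^sup>2"
    by (simp add: L2_norm_def integral_nonneg_AE power_mult_distrib)
  finally show ?thesis
    by (rule power2_le_imp_le) (use \<Lambda>(1) in simp)
qed

text \<open>A crude constant, the supremum of the kernel times the length of the interval. It serves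
  kernels of changing sign and fixed width, where finiteness is all that matters.\<close>

lemma tconv_kernel_bound:
  fixes \<eta> :: "real \<Rightarrow> real"
  assumes c: "continuous_on UNIV \<eta>" and R: "\<And>x. R < \<bar>x\<bar> \<Longrightarrow> \<eta> x = 0"
  obtains \<Lambda> where "0 < \<Lambda>" "\<And>t. integral {0..T} (\<lambda>s. \<bar>\<eta> (s - t)\<bar>) \<le> \<Lambda>"
    "\<And>s. integral {0..T} (\<lambda>t. \<bar>\<eta> (s - t)\<bar>) \<le> \<Lambda>"
proof -
  have "bounded (\<eta> ` {-R..R})"
    by (intro compact_imp_bounded compact_continuous_image continuous_on_subset[OF c]) auto
  then obtain B0 where B0: "\<forall>x\<in>{-R..R}. \<bar>\<eta> x\<bar> \<le> B0" by (auto simp: bounded_iff)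
  \<comment> \<open>The absolute value of \<open>B0\<close> covers a negative \<open>R\<close>, for
    which \<open>{-R..R}\<close> is empty and says nothing about \<open>B0\<close>.\<close>
  have B: "\<bar>\<eta> x\<bar> \<le> \<bar>B0\<bar>" for x
  proof (cases "\<bar>x\<bar> \<le> R")
    case True
    then have "x \<in> {-R..R}" by auto
    then show ?thesis using B0 by force
  qed (use R[of x] in simp)
  have "integral {0..T} (\<lambda>s. \<bar>\<eta> (f s)\<bar>) \<le> \<bar>B0\<bar> * \<bar>T\<bar> + 1" if "continuous_on {0..T} f" for f
  proof -
    have "integral {0..T} (\<lambda>s. \<bar>\<eta> (f s)\<bar>) \<le> integral {0..T} (\<lambda>s. \<bar>B0\<bar>)"
      using that B by (intro integral_le integrable_continuous_real continuous_intros continuous_on_real_comp[OF c])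
    also have "\<dots> \<le> \<bar>B0\<bar> * \<bar>T\<bar> + 1" using mult_nonpos_nonneg[of T "\<bar>B0\<bar>"] by (cases "0 \<le> T") (auto simp: mult.commute)
    finally show ?thesis .
  qed
  note * = this
  show ?thesis
  proof (rule that)
    show "0 < \<bar>B0\<bar> * \<bar>T\<bar> + 1" by (intro add_nonneg_pos) auto
  qed (rule *; intro continuous_intros)+
qed

text \<open>For the approximants alone the two pairings agree exactly; replacing one factor by its
  limit \<open>u\<close> or \<open>v\<close> costs a null sequence, since convolution with a fixed
  kernel is bounded. It is applied to the values with the derivative of the mollifier and to the
  gradients with the mollifier itself.\<close>

lemma tconv_transpose_tendsto:
  fixes u v :: "(real^'n) \<times> real \<Rightarrow> 'b::euclidean_space"
  assumes \<Omega>: "open \<Omega>" and c: "continuous_on UNIV \<eta>" and R: "\<And>x. R < \<bar>x\<bar> \<Longrightarrow> \<eta> x = 0"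
    and uv: "u \<in> L2 (cylinder \<Omega> T)" "v \<in> L2 (cylinder \<Omega> T)"
    and \<Phi>: "\<And>k. \<Phi> k \<in> Cc (\<Omega> \<times> UNIV)" "(\<lambda>k. L2_norm (cylinder \<Omega> T) (\<lambda>z. \<Phi> k z - v z)) \<longlonglongrightarrow> 0"
    and \<Psi>: "\<And>k. \<Psi> k \<in> Cc (\<Omega> \<times> UNIV)" "(\<lambda>k. L2_norm (cylinder \<Omega> T) (\<lambda>z. \<Psi> k z - u z)) \<longlonglongrightarrow> 0"
  shows "(\<lambda>k. L2_inner (cylinder \<Omega> T) u (tconv T \<eta> (\<Phi> k))
            - L2_inner (cylinder \<Omega> T) v (tconv T (\<lambda>x. \<eta> (- x)) (\<Psi> k))) \<longlonglongrightarrow> 0"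
proof -
  define Q where "Q = cylinder \<Omega> T"
  obtain \<Lambda> where \<Lambda>: "0 < \<Lambda>" "\<And>t. integral {0..T} (\<lambda>s. \<bar>\<eta> (s - t)\<bar>) \<le> \<Lambda>"
    "\<And>s. integral {0..T} (\<lambda>t. \<bar>\<eta> (s - t)\<bar>) \<le> \<Lambda>"
    using tconv_kernel_bound[OF c R] by blast
  have c': "continuous_on UNIV (\<lambda>x. \<eta> (- x))" by (intro continuous_on_real_comp[OF c] continuous_intros)
  have R': "R < \<bar>x\<bar> \<Longrightarrow> \<eta> (- x) = 0" for x by (rule R) simp
  have CL: "f \<in> L2 Q" if "f \<in> Cc (\<Omega> \<times> UNIV)" for f :: "(real^'n) \<times> real \<Rightarrow> 'b"
    using Cc_L2[OF that] \<Omega> by (simp add: Q_def)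
  have uvQ: "u \<in> L2 Q" "v \<in> L2 Q" using uv by (auto simp: Q_def)
  have t1: "tconv T \<eta> (\<Phi> k) \<in> L2 Q" "tconv T (\<lambda>x. \<eta> (- x)) (\<Psi> k) \<in> L2 Q" for k
    by (intro CL tconv_Cc[OF \<Phi>(1) c R] tconv_Cc[OF \<Psi>(1) c' R']; assumption)+
  have b1: "L2_norm Q (tconv T \<eta> (\<Phi> k)) \<le> \<Lambda> * L2_norm Q (\<Phi> k)" for k
    unfolding Q_def by (rule tconv_bound[OF \<Omega> \<Phi>(1) c R \<Lambda>])
  have b2: "L2_norm Q (tconv T (\<lambda>x. \<eta> (- x)) (\<Psi> k)) \<le> \<Lambda> * L2_norm Q (\<Psi> k)" for k
    unfolding Q_def using \<Lambda>(2,3) by (intro tconv_bound[OF \<Omega> \<Psi>(1) c' R' \<Lambda>(1)]) simp_all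
  \<comment> \<open>Adding and subtracting the equal pairings of \<open>\<Psi> k\<close> with the
    convolved \<open>\<Phi> k\<close> and of \<open>\<Phi> k\<close> with the convolved
    \<open>\<Psi> k\<close>.\<close>
  have eq: "L2_inner Q u (tconv T \<eta> (\<Phi> k)) - L2_inner Q v (tconv T (\<lambda>x. \<eta> (- x)) (\<Psi> k))
      = - L2_inner Q (\<lambda>z. \<Psi> k z - u z) (tconv T \<eta> (\<Phi> k)) + L2_inner Q (\<lambda>z. \<Phi> k z - v z) (tconv T (\<lambda>x. \<eta> (- x)) (\<Psi> k))" for k
    using tconv_symmetric[OF \<Omega> \<Phi>(1)[of k] \<Psi>(1)[of k] c] CL[OF \<Phi>(1)[of k]] CL[OF \<Psi>(1)[of k]] uvQ t1
    by (simp add: L2_inner_diff_left Q_def)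
  have "(\<lambda>k. L2_inner Q u (tconv T \<eta> (\<Phi> k)) - L2_inner Q v (tconv T (\<lambda>x. \<eta> (- x)) (\<Psi> k))) \<longlonglongrightarrow> 0"
  proof (rule Lim_null_comparison)
    have "(\<lambda>k. L2_norm Q (\<lambda>z. \<Psi> k z - u z) * (\<Lambda> * L2_norm Q (\<Phi> k)) + L2_norm Q (\<lambda>z. \<Phi> k z - v z) * (\<Lambda> * L2_norm Q (\<Psi> k)))
       \<longlonglongrightarrow> 0 * (\<Lambda> * L2_norm Q v) + 0 * (\<Lambda> * L2_norm Q u)"
      using \<Phi>(2) \<Psi>(2) unfolding Q_def[symmetric]
      by (intro tendsto_intros L2_norm_tendsto CL \<Phi> \<Psi> uvQ)
    then show "(\<lambda>k. L2_norm Q (\<lambda>z. \<Psi> k z - u z) * (\<Lambda> * L2_norm Q (\<Phi> k)) + L2_norm Q (\<lambda>z. \<Phi> k z - v z) * (\<Lambda> * L2_norm Q (\<Psi> k))) \<longlonglongrightarrow> 0"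
      by simp
    show "\<forall>\<^sub>F k in sequentially. norm (L2_inner Q u (tconv T \<eta> (\<Phi> k)) - L2_inner Q v (tconv T (\<lambda>x. \<eta> (- x)) (\<Psi> k)))
       \<le> L2_norm Q (\<lambda>z. \<Psi> k z - u z) * (\<Lambda> * L2_norm Q (\<Phi> k)) + L2_norm Q (\<lambda>z. \<Phi> k z - v z) * (\<Lambda> * L2_norm Q (\<Psi> k))"
    proof (intro always_eventually allI)
      fix k
      have "\<bar>L2_inner Q (\<lambda>z. \<Psi> k z - u z) (tconv T \<eta> (\<Phi> k))\<bar> \<le> L2_norm Q (\<lambda>z. \<Psi> k z - u z) * (\<Lambda> * L2_norm Q (\<Phi> k))"
        by (rule order_trans[OF L2_Cauchy_Schwarz mult_left_mono[OF b1]]) (intro L2_diff CL[OF \<Psi>(1)] uvQ t1 L2_norm_nonneg)+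
      moreover have "\<bar>L2_inner Q (\<lambda>z. \<Phi> k z - v z) (tconv T (\<lambda>x. \<eta> (- x)) (\<Psi> k))\<bar> \<le> L2_norm Q (\<lambda>z. \<Phi> k z - v z) * (\<Lambda> * L2_norm Q (\<Psi> k))"
        by (rule order_trans[OF L2_Cauchy_Schwarz mult_left_mono[OF b2]]) (intro L2_diff CL[OF \<Phi>(1)] uvQ t1 L2_norm_nonneg)+
      ultimately show "norm (L2_inner Q u (tconv T \<eta> (\<Phi> k)) - L2_inner Q v (tconv T (\<lambda>x. \<eta> (- x)) (\<Psi> k)))
       \<le> L2_norm Q (\<lambda>z. \<Psi> k z - u z) * (\<Lambda> * L2_norm Q (\<Phi> k)) + L2_norm Q (\<lambda>z. \<Phi> k z - v z) * (\<Lambda> * L2_norm Q (\<Psi> k))"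
        unfolding eq by simp
    qed
  qed
  then show ?thesis by (simp add: Q_def)
qed

text \<open>Near \<open>t = 0\<close> or \<open>t = T\<close> part of the kernel's mass falls
  outside \<open>{0..T}\<close>, so mass one is required only at distance \<open>D m\<close> from
  both ends. Every interior time is eventually that far inside, which gives pointwise convergence;
  dominated convergence does the rest.\<close>

lemma tconv_approx_identity:
  fixes \<phi> :: "(real^'n) \<times> real \<Rightarrow> 'b::euclidean_space"
  assumes \<Omega>: "open \<Omega>" and \<phi>: "\<phi> \<in> Cc (\<Omega> \<times> UNIV)"
    and c: "\<And>m. continuous_on UNIV (\<eta> m)" and nn: "\<And>m x. 0 \<le> \<eta> m x"
    and R: "\<And>m x. D m < \<bar>x\<bar> \<Longrightarrow> \<eta> m x = 0" and D: "D \<longlonglongrightarrow> 0"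
    and le1: "\<And>m t. integral {0..T} (\<lambda>s. \<eta> m (s - t)) \<le> 1"
    and eq1: "\<And>m t. D m \<le> t \<Longrightarrow> t \<le> T - D m \<Longrightarrow> integral {0..T} (\<lambda>s. \<eta> m (s - t)) = 1"
  shows "(\<lambda>m. L2_norm (cylinder \<Omega> T) (\<lambda>z. tconv T (\<eta> m) \<phi> z - \<phi> z)) \<longlonglongrightarrow> 0"
proof -
  obtain K where K: "compact K" "K \<subseteq> \<Omega> \<times> UNIV" "\<And>z. z \<notin> K \<Longrightarrow> \<phi> z = 0" and c\<phi>: "continuous_on UNIV \<phi>"
    using \<phi> by (auto simp: Cc_def)
  have "bounded (\<phi> ` K)"
    by (intro compact_imp_bounded compact_continuous_image continuous_on_subset[OF c\<phi>] K) auto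
  then obtain B where B: "\<And>z. z \<in> K \<Longrightarrow> norm (\<phi> z) \<le> B" "0 < B" by (auto simp: bounded_pos)
  have B': "norm (\<phi> z) \<le> B" for z using B K(3) by (cases "z \<in> K") auto
  have wc: "continuous_on A (\<lambda>s. \<eta> m (s - t))" for A m t
    by (intro continuous_on_real_comp[OF c] continuous_intros)
  have wi: "(\<lambda>s. \<eta> m (s - t)) integrable_on {0..T}" for m t by (intro integrable_continuous_real wc)
  \<comment> \<open>An average of total mass at most one cannot exceed the bound that holds within
    the kernel's reach.\<close>
  have est: "norm (tconv T (\<eta> m) \<psi> (x, t)) \<le> C"
    if "continuous_on UNIV \<psi>" "0 \<le> C" "\<And>s. s \<in> {0..T} \<Longrightarrow> \<bar>s - t\<bar> \<le> D m \<Longrightarrow> norm (\<psi> (x, s)) \<le> C"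
    for m t x C and \<psi> :: "(real^'n) \<times> real \<Rightarrow> 'b"
  proof -
    have "norm (tconv T (\<eta> m) \<psi> (x, t)) \<le> integral {0..T} (\<lambda>s. C * \<eta> m (s - t))"
      unfolding tconv_def fst_conv snd_conv
    proof (intro integral_norm_bound_integral tconv_integrable c that integrable_continuous_real continuous_intros wc)
      fix s assume s: "s \<in> {0..T}"
      show "norm (\<eta> m (s - t) *\<^sub>R \<psi> (x, s)) \<le> C * \<eta> m (s - t)"
      proof (cases "\<bar>s - t\<bar> \<le> D m")
        case True
        then show ?thesis using that(3)[OF s True] nn[of m "s - t"] by (simp add: mult.commute mult_right_mono)
      qed (use R[of m "s - t"] in simp)
    qed
    also have "\<dots> \<le> C * 1"
      using le1[of m t] that(2) by (simp add: mult_left_le)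
    finally show ?thesis by simp
  qed
  have cT: "continuous_on UNIV (tconv T (\<eta> m) \<phi>)" for m by (intro tconv_continuous c c\<phi>)
  have lim: "(\<lambda>m. (norm (tconv T (\<eta> m) \<phi> (x, t) - \<phi> (x, t)))\<^sup>2) \<longlonglongrightarrow> 0" if t: "0 < t" "t < T" for x t
  proof -
    have "(\<lambda>m. tconv T (\<eta> m) \<phi> (x, t)) \<longlonglongrightarrow> \<phi> (x, t)"
    proof (rule LIMSEQ_I)
      fix e :: real assume e: "0 < e"
      have "continuous (at t) (\<lambda>s. \<phi> (x, s))"
        using continuous_on_slice[OF c\<phi>, of UNIV x] by (simp add: continuous_on_eq_continuous_at)
      then obtain r where r: "0 < r" "\<And>s. \<bar>s - t\<bar> < r \<Longrightarrow> norm (\<phi> (x, s) - \<phi> (x, t)) < e / 2"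
        using e unfolding continuous_at_eps_delta dist_norm real_norm_def by (meson half_gt_zero)
      \<comment> \<open>The kernel must fit into the continuity radius and also between
        \<open>t\<close> and both ends of the interval, where its mass is one.\<close>
      have "0 < min r (min t (T - t))" using r t by simp
      from LIMSEQ_D[OF D this] obtain N where N: "\<And>m. m \<ge> N \<Longrightarrow> \<bar>D m\<bar> < min r (min t (T - t))" by auto
      have "norm (tconv T (\<eta> m) \<phi> (x, t) - \<phi> (x, t)) < e" if "m \<ge> N" for m
      proof -
        have Dm: "D m < r" "D m \<le> t" "t \<le> T - D m" using N[OF that] by auto
        have "tconv T (\<eta> m) (\<lambda>z. \<phi> (x, t)) (x, t) = integral {0..T} (\<lambda>s. \<eta> m (s - t)) *\<^sub>R \<phi> (x, t)"
          using integral_linear[OF wi[of m t] bounded_linear_scaleR_left[of "\<phi> (x, t)"]]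
          by (simp add: tconv_def o_def)
        then have "tconv T (\<eta> m) \<phi> (x, t) - \<phi> (x, t) = tconv T (\<eta> m) (\<lambda>z. \<phi> z - \<phi> (x, t)) (x, t)"
          using eq1[OF Dm(2,3)] by (subst tconv_diff) (auto intro: c c\<phi>)
        moreover have "norm (tconv T (\<eta> m) (\<lambda>z. \<phi> z - \<phi> (x, t)) (x, t)) \<le> e / 2"
        proof (rule est)
          show "continuous_on UNIV (\<lambda>z. \<phi> z - \<phi> (x, t))" by (intro continuous_intros c\<phi>)
          fix s assume "\<bar>s - t\<bar> \<le> D m"
          then have "\<bar>s - t\<bar> < r" using Dm(1) by simp
          from r(2)[OF this] show "norm (\<phi> (x, s) - \<phi> (x, t)) \<le> e / 2" by simp
        qed (use e in simp)
        ultimately show ?thesis using e by simp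
      qed
      then show "\<exists>no. \<forall>m\<ge>no. norm (tconv T (\<eta> m) \<phi> (x, t) - \<phi> (x, t)) < e" by blast
    qed
    then have "(\<lambda>m. (norm (tconv T (\<eta> m) \<phi> (x, t) - \<phi> (x, t)))\<^sup>2) \<longlonglongrightarrow> (norm (\<phi> (x, t) - \<phi> (x, t)))\<^sup>2"
      by (intro tendsto_power tendsto_norm tendsto_diff tendsto_const)
    then show ?thesis by simp
  qed
  \<comment> \<open>Convolution in time does not enlarge the spatial support, so one compact set
    carries all the convolutions on the cylinder, each bounded by \<open>B\<close> like
    \<open>\<phi>\<close> itself.\<close>
  define K' where "K' = fst ` K \<times> {0..T}"
  have cK': "compact K'" unfolding K'_def
    by (intro compact_Times compact_continuous_image continuous_intros K compact_Icc)
  let ?w = "\<lambda>z. indicator K' z * (2 * B)\<^sup>2"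
  have w: "integrable lborel ?w"
    using borel_integrable_compact[OF cK', of "\<lambda>_. (2 * B)\<^sup>2"] by simp
  then have "integrable lebesgue ?w"
    using integrable_completion[OF borel_measurable_integrable[OF w]] by blast
  then have wint: "integrable (lebesgue_on (cylinder \<Omega> T)) ?w"
    using integrable_mult_indicator[of "cylinder \<Omega> T" lebesgue ?w] \<Omega> by (subst integrable_restrict_space) auto
  have "(\<lambda>m. LINT z|lebesgue_on (cylinder \<Omega> T). (norm (tconv T (\<eta> m) \<phi> z - \<phi> z))\<^sup>2)
     \<longlonglongrightarrow> (LINT z|lebesgue_on (cylinder \<Omega> T). 0)"
  proof (rule integral_dominated_convergence[OF _ _ wint])
    show "(\<lambda>z. (norm (tconv T (\<eta> m) \<phi> z - \<phi> z))\<^sup>2) \<in> borel_measurable (lebesgue_on (cylinder \<Omega> T))" for m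
    proof -
      have "continuous_on UNIV (\<lambda>z. (norm (tconv T (\<eta> m) \<phi> z - \<phi> z))\<^sup>2)" by (intro continuous_intros cT c\<phi>)
      then show ?thesis
        by (intro measurable_restrict_space1 measurable_completion) (auto intro: borel_measurable_continuous_onI)
    qed
    show "AE z in lebesgue_on (cylinder \<Omega> T). (\<lambda>m. (norm (tconv T (\<eta> m) \<phi> z - \<phi> z))\<^sup>2) \<longlonglongrightarrow> 0"
      using lim by (intro AE_I2) (auto simp: space_restrict_space)
    show "AE z in lebesgue_on (cylinder \<Omega> T). norm ((norm (tconv T (\<eta> m) \<phi> z - \<phi> z))\<^sup>2) \<le> ?w z" for m
    proof (intro AE_I2)
      fix z assume "z \<in> space (lebesgue_on (cylinder \<Omega> T))"
      then obtain x t where z: "z = (x, t)" and t: "0 < t" "t < T" by (auto simp: space_restrict_space)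
      show "norm ((norm (tconv T (\<eta> m) \<phi> z - \<phi> z))\<^sup>2) \<le> ?w z"
      proof (cases "z \<in> K'")
        case True
        have "norm (tconv T (\<eta> m) \<phi> z - \<phi> z) \<le> norm (tconv T (\<eta> m) \<phi> z) + norm (\<phi> z)" by (rule norm_triangle_ineq4)
        also have "\<dots> \<le> B + B" unfolding z by (intro add_mono est B' c\<phi> less_imp_le[OF B(2)])
        finally have "(norm (tconv T (\<eta> m) \<phi> z - \<phi> z))\<^sup>2 \<le> (2 * B)\<^sup>2" by (intro power_mono) auto
        then show ?thesis using True by simp
      next
        case False
        then have "(x, s) \<notin> K" for s using t imageI[of "(x, s)" K fst] by (auto simp: z K'_def)
        then have "\<phi> (x, s) = 0" for s using K(3) by blast
        then show ?thesis by (simp add: z tconv_def)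
      qed
    qed
  qed simp
  then have "(\<lambda>m. sqrt (LINT z|lebesgue_on (cylinder \<Omega> T). (norm (tconv T (\<eta> m) \<phi> z - \<phi> z))\<^sup>2)) \<longlonglongrightarrow> sqrt 0"
    by (intro tendsto_real_sqrt) simp
  then show ?thesis by (simp add: L2_norm_def)
qed

section \<open>The duality identity\<close>

text \<open>The mollifier is the quadratic B-spline with knots \<open>d, 2d, 3d, 4d\<close>; \<open>spline 3\<close>, \<open>spline 2\<close> and
  \<open>spline 1\<close> are, up to scaling, its primitive, the B-spline itself and its derivative.\<close>

definition spline :: "nat \<Rightarrow> real \<Rightarrow> real" where
  "spline k x = (max 0 x)^k - 3 * (max 0 (x - 1))^k + 3 * (max 0 (x - 2))^k - (max 0 (x - 3))^k"

text \<open>The shift by 1 moves the support from \<open>[0, 3]\<close> to \<open>[d, 4d]\<close>,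
  leaving a gap at 0. The spline of degree 2 has integral 2, because its multiple by 3 is the
  derivative of \<open>spline 3\<close>, which climbs from 0 to 6; dividing by \<open>2 * d\<close>
  normalises the mass to one. Degree 2 is chosen since a kernel of class C1 suffices for test
  functions of class C1.\<close>

definition moll :: "real \<Rightarrow> real \<Rightarrow> real" where
  "moll d t = spline 2 (t / d - 1) / (2 * d)"

definition moll_primitive :: "real \<Rightarrow> real \<Rightarrow> real" where
  "moll_primitive d t = spline 3 (t / d - 1) / 6"

definition moll_deriv :: "real \<Rightarrow> real \<Rightarrow> real" where
  "moll_deriv d t = spline 1 (t / d - 1) / d\<^sup>2"

text \<open>At the kink the difference quotient is at most \<open>|h| ^ Suc k\<close>, which tends
  to 0 because the exponent is at least 2.\<close>

lemma DERIV_truncated_power: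
  "((\<lambda>x. (max 0 x) ^ Suc (Suc k)) has_real_derivative real (Suc (Suc k)) * (max 0 x) ^ Suc k) (at x)"
proof -
  consider "x < 0" | "0 < x" | "x = 0" by linarith
  then show ?thesis
  proof cases
    case 1
    have "((\<lambda>x. (max 0 x) ^ Suc (Suc k)) has_real_derivative 0) (at x)"
      by (rule has_field_derivative_transform_within_open[of "\<lambda>_. 0 :: real" _ _ "{..<0}"]) (use 1 in \<open>auto simp: max_def\<close>)
    then show ?thesis using 1 by (simp add: max_def)
  next
    case 2
    have "((\<lambda>x. x ^ Suc (Suc k)) has_real_derivative real (Suc (Suc k)) * x ^ Suc k) (at x)"
      using DERIV_pow[of "Suc (Suc k)" x UNIV] by (simp del: power_Suc of_nat_Suc)
    then have "((\<lambda>x. (max 0 x) ^ Suc (Suc k)) has_real_derivative real (Suc (Suc k)) * x ^ Suc k) (at x)"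
      by (rule has_field_derivative_transform_within_open[of _ _ _ "{0<..}"]) (use 2 in \<open>auto simp: max_def\<close>)
    then show ?thesis using 2 by (simp add: max_def)
  next
    case 3
    have "((\<lambda>h::real. (max 0 h) ^ Suc (Suc k) / h) \<longlongrightarrow> 0) (at 0)"
    proof (rule Lim_null_comparison)
      show "\<forall>\<^sub>F h :: real in at 0. norm ((max 0 h) ^ Suc (Suc k) / h) \<le> \<bar>h\<bar> ^ Suc k"
        by (intro always_eventually allI) (auto simp: max_def mult_nonpos_nonneg)
      have "((\<lambda>h::real. \<bar>h\<bar> ^ Suc k) \<longlongrightarrow> \<bar>0\<bar> ^ Suc k) (at 0)" by (intro tendsto_intros)
      then show "((\<lambda>h::real. \<bar>h\<bar> ^ Suc k) \<longlongrightarrow> 0) (at 0)" by simp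
    qed
    then show ?thesis using 3 by (simp add: DERIV_def)
  qed
qed

lemma DERIV_spline:
  "(spline (Suc (Suc k)) has_real_derivative real (Suc (Suc k)) * spline (Suc k) x) (at x)"
proof -
  have "((\<lambda>x. (max 0 (x - c)) ^ Suc (Suc k)) has_real_derivative real (Suc (Suc k)) * (max 0 (x - c)) ^ Suc k) (at x)" for c
  proof -
    have "((\<lambda>x. x - c) has_real_derivative 1) (at x)" by (auto intro!: derivative_eq_intros)
    from DERIV_chain2[where f = "\<lambda>u. max 0 u ^ Suc (Suc k)" and g = "\<lambda>x. x - c", OF DERIV_truncated_power this]
    show ?thesis by simp
  qed
  note t = this
  from DERIV_diff[OF DERIV_add[OF DERIV_diff[OF t[of 0] DERIV_cmult[OF t[of 1], of 3]] DERIV_cmult[OF t[of 2], of 3]] t[of 3]]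
  show ?thesis
    by (simp add: spline_def[abs_def] algebra_simps del: power_Suc of_nat_Suc)
qed

lemma spline_vanishes:
  assumes "0 < k" "x \<le> 0" shows "spline k x = 0"
  using assms by (simp add: spline_def max_def)

text \<open>Beyond the last knot no truncation is active and \<open>spline k\<close> is the third
  backward difference of the k-th power: zero for degree below 3, and 3! = 6 for degree 3.\<close>

lemma spline_right:
  assumes "3 \<le> x" shows "spline 1 x = 0" "spline 2 x = 0" "spline 3 x = 6"
proof -
  have "max 0 x = x" "max 0 (x - 1) = x - 1" "max 0 (x - 2) = x - 2" "max 0 (x - 3) = x - 3"
    using assms by auto
  then show "spline 1 x = 0" "spline 2 x = 0" "spline 3 x = 6"
    by (simp_all add: spline_def power2_eq_square power3_eq_cube algebra_simps)
qed

lemma spline_2_nonneg: "0 \<le> spline 2 x"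
proof -
  consider "x \<le> 0" | "0 \<le> x" "x \<le> 1" | "1 \<le> x" "x \<le> 2" | "2 \<le> x" "x \<le> 3" | "3 \<le> x" by linarith
  then show ?thesis
  proof cases
    case 1 then show ?thesis by (simp add: spline_vanishes)
  next
    case 2
    then have "max 0 (x - 1) = 0" "max 0 (x - 2) = 0" "max 0 (x - 3) = 0" by auto
    then show ?thesis by (simp add: spline_def)
  next
    case 3
    then have "max 0 x = x" "max 0 (x - 1) = x - 1" "max 0 (x - 2) = 0" "max 0 (x - 3) = 0" by auto
    \<comment> \<open>The middle piece is \<open>- 2 x^2 + 6 x - 3\<close>, written so that its sign
      on \<open>[1, 2]\<close> is visible.\<close>
    then have "spline 2 x = 2 * ((x - 1) * (2 - x)) + 1"
      by (simp add: spline_def power2_eq_square algebra_simps)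
    then show ?thesis using 3 by simp
  next
    case 4
    then have "max 0 x = x" "max 0 (x - 1) = x - 1" "max 0 (x - 2) = x - 2" "max 0 (x - 3) = 0" by auto
    then have "spline 2 x = (3 - x)\<^sup>2" by (simp add: spline_def power2_eq_square algebra_simps)
    then show ?thesis by simp
  next
    case 5 then show ?thesis by (simp add: spline_right)
  qed
qed

context
  fixes d :: real
  assumes d: "0 < d"
begin

lemma DERIV_moll: "(moll d has_real_derivative moll_deriv d t) (at t)"
proof -
  have "((\<lambda>t. t / d - 1) has_real_derivative 1 / d) (at t)"
    using d by (auto intro!: derivative_eq_intros)
  from DERIV_cdivide[OF DERIV_chain2[OF DERIV_spline[of 0 "t / d - 1"] this], of "2 * d"]
  show ?thesis
    using d by (simp add: moll_def[abs_def] moll_deriv_def numeral_2_eq_2 power2_eq_square field_simps)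
qed

lemma DERIV_moll_primitive: "(moll_primitive d has_real_derivative moll d t) (at t)"
proof -
  have "((\<lambda>t. t / d - 1) has_real_derivative 1 / d) (at t)"
    using d by (auto intro!: derivative_eq_intros)
  from DERIV_cdivide[OF DERIV_chain2[OF DERIV_spline[of 1 "t / d - 1"] this], of 6]
  show ?thesis
    using d by (simp add: moll_primitive_def[abs_def] moll_def numeral_2_eq_2 numeral_3_eq_3 field_simps)
qed

lemma continuous_moll: "continuous_on A (moll d)"
  using DERIV_moll by (meson DERIV_isCont continuous_at_imp_continuous_on)

lemma continuous_moll_deriv: "continuous_on A (moll_deriv d)"
  unfolding moll_deriv_def[abs_def] spline_def using d by (intro continuous_intros) auto

lemma moll_nonneg: "0 \<le> moll d t"
  using d by (simp add: moll_def spline_2_nonneg)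

lemma moll_left:
  assumes "t \<le> d" shows "moll d t = 0" "moll_deriv d t = 0" "moll_primitive d t = 0"
proof -
  have "t / d - 1 \<le> 0" using assms d by (simp add: field_simps)
  then show "moll d t = 0" "moll_deriv d t = 0" "moll_primitive d t = 0"
    by (simp_all add: moll_def moll_deriv_def moll_primitive_def spline_vanishes)
qed

lemma moll_right:
  assumes "4 * d \<le> t" shows "moll d t = 0" "moll_deriv d t = 0" "moll_primitive d t = 1"
proof -
  have "3 \<le> t / d - 1" using assms d by (simp add: field_simps)
  from spline_right[OF this] show "moll d t = 0" "moll_deriv d t = 0" "moll_primitive d t = 1"
    by (simp_all add: moll_def moll_deriv_def moll_primitive_def)
qed

text \<open>The two-sided form is the one that the convolution lemmas ask for, and being even in
  \<open>t\<close> it passes to the reflected kernel.\<close>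

lemma moll_support:
  assumes "4 * d < \<bar>t\<bar>" shows "moll d t = 0" "moll_deriv d t = 0"
  using assms d moll_left[of t] moll_right[of t] by (cases "0 \<le> t"; simp)+

lemma moll_primitive_mono: "s \<le> t \<Longrightarrow> moll_primitive d s \<le> moll_primitive d t"
proof (erule DERIV_nonneg_imp_nondecreasing)
  show "\<exists>y. (moll_primitive d has_real_derivative y) (at x) \<and> 0 \<le> y" for x
    by (rule exI[of _ "moll d x"] conjI DERIV_moll_primitive moll_nonneg)+
qed

lemma moll_primitive_bounds: "0 \<le> moll_primitive d t" "moll_primitive d t \<le> 1"
  using moll_primitive_mono[of "min t d" t] moll_left(3)[of "min t d"]
    moll_primitive_mono[of t "max t (4 * d)"] moll_right(3)[of "max t (4 * d)"] by auto

text \<open>The mass inside \<open>{0..T}\<close> is a difference of two values of a primitive that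
  climbs from 0 to 1. It is therefore at most one, and equal to one as soon as \<open>t\<close> is
  at distance \<open>4 * d\<close> from both ends.\<close>

lemma integral_moll:
  assumes "0 \<le> T"
  shows "integral {0..T} (\<lambda>s. moll d (s - t)) = moll_primitive d (T - t) - moll_primitive d (- t)"
    and "integral {0..T} (\<lambda>s. moll d (t - s)) = moll_primitive d t - moll_primitive d (t - T)"
proof -
  have "((\<lambda>s. moll d (s - t)) has_integral moll_primitive d (T - t) - moll_primitive d (0 - t)) {0..T}"
  proof (rule fundamental_theorem_of_calculus[OF assms])
    show "((\<lambda>s. moll_primitive d (s - t)) has_vector_derivative moll d (s - t)) (at s within {0..T})" for s
    proof -
      have "((\<lambda>s. s - t) has_real_derivative 1) (at s)" by (auto intro!: derivative_eq_intros)
      from DERIV_chain2[where f = "moll_primitive d" and g = "\<lambda>s. s - t", OF DERIV_moll_primitive this]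
      show ?thesis
        unfolding has_real_derivative_iff_has_vector_derivative[symmetric] by (auto intro: DERIV_subset)
    qed
  qed
  then show "integral {0..T} (\<lambda>s. moll d (s - t)) = moll_primitive d (T - t) - moll_primitive d (- t)"
    by (simp add: integral_unique)
  have "((\<lambda>s. moll d (t - s)) has_integral - moll_primitive d (t - T) - - moll_primitive d (t - 0)) {0..T}"
  proof (rule fundamental_theorem_of_calculus[OF assms])
    show "((\<lambda>s. - moll_primitive d (t - s)) has_vector_derivative moll d (t - s)) (at s within {0..T})" for s
    proof -
      have "((\<lambda>s. t - s) has_real_derivative - 1) (at s)" by (auto intro!: derivative_eq_intros)
      from DERIV_minus[OF DERIV_chain2[where f = "moll_primitive d" and g = "\<lambda>s. t - s", OF DERIV_moll_primitive this]]
      show ?thesis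
        unfolding has_real_derivative_iff_has_vector_derivative[symmetric] by (auto intro: DERIV_subset)
    qed
  qed
  then show "integral {0..T} (\<lambda>s. moll d (t - s)) = moll_primitive d t - moll_primitive d (t - T)"
    by (simp add: integral_unique)
qed

end

section \<open>Passage to weak solutions\<close>

lemma energy_spaceE:
  assumes "energy_space \<Omega> T y g"
  obtains \<phi> where "y \<in> L2 (cylinder \<Omega> T)" "g \<in> L2 (cylinder \<Omega> T)"
    "\<And>k. \<phi> k \<in> C1_compact (\<Omega> \<times> UNIV)"
    "(\<lambda>k. L2_norm (cylinder \<Omega> T) (\<lambda>z. \<phi> k z - y z)) \<longlonglongrightarrow> 0"
    "(\<lambda>k. L2_norm (cylinder \<Omega> T) (\<lambda>z. space_grad (\<phi> k) z - g z)) \<longlonglongrightarrow> 0"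
  using assms unfolding energy_space_def by blast

text \<open>A kernel with mass at most one contracts \<open>L\<^sup>2\<close>, so it moves the tail of an approximating sequence
  about as little as one fixed member.\<close>

lemma tconv_approx_limit:
  fixes \<phi> :: "(real^'n) \<times> real \<Rightarrow> 'b::euclidean_space"
  assumes \<Omega>: "open \<Omega>" and \<phi>: "\<phi> \<in> Cc (\<Omega> \<times> UNIV)" "\<psi> \<in> Cc (\<Omega> \<times> UNIV)" and p: "p \<in> L2 (cylinder \<Omega> T)"
    and c: "continuous_on UNIV \<eta>" and nn: "\<And>x. 0 \<le> \<eta> x" and R: "\<And>x. R < \<bar>x\<bar> \<Longrightarrow> \<eta> x = 0"
    and le1: "\<And>t. integral {0..T} (\<lambda>s. \<eta> (s - t)) \<le> 1" "\<And>s. integral {0..T} (\<lambda>t. \<eta> (s - t)) \<le> 1"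
    and e: "L2_norm (cylinder \<Omega> T) (\<lambda>z. \<phi> z - p z) \<le> e" "L2_norm (cylinder \<Omega> T) (\<lambda>z. \<psi> z - p z) \<le> e"
      "L2_norm (cylinder \<Omega> T) (\<lambda>z. tconv T \<eta> \<psi> z - \<psi> z) \<le> e"
  shows "L2_norm (cylinder \<Omega> T) (\<lambda>z. tconv T \<eta> \<phi> z - p z) \<le> 4 * e"
proof -
  define Q where "Q = cylinder \<Omega> T"
  have CL: "f \<in> L2 Q" if "f \<in> Cc (\<Omega> \<times> UNIV)" for f :: "(real^'n) \<times> real \<Rightarrow> 'b"
    using Cc_L2[OF that] \<Omega> by (simp add: Q_def)
  have L: "\<phi> \<in> L2 Q" "\<psi> \<in> L2 Q" "tconv T \<eta> \<phi> \<in> L2 Q" "tconv T \<eta> \<psi> \<in> L2 Q" "p \<in> L2 Q"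
    using p[folded Q_def] CL[OF \<phi>(1)] CL[OF \<phi>(2)] CL[OF tconv_Cc[OF \<phi>(1) c R]] CL[OF tconv_Cc[OF \<phi>(2) c R]]
    by blast+
  have d: "(\<lambda>z. \<phi> z - \<psi> z) \<in> Cc (\<Omega> \<times> UNIV)"
    using Cc_add[OF \<phi>(1) Cc_scaleR[OF \<phi>(2), of "\<lambda>_. - 1"]] by simp
  have "(\<lambda>z. tconv T \<eta> \<phi> z - tconv T \<eta> \<psi> z) = tconv T \<eta> (\<lambda>z. \<phi> z - \<psi> z)"
    using tconv_diff[OF c Cc_continuous[OF \<phi>(1)] Cc_continuous[OF \<phi>(2)]] by auto
  moreover have "L2_norm Q (tconv T \<eta> (\<lambda>z. \<phi> z - \<psi> z)) \<le> 1 * L2_norm Q (\<lambda>z. \<phi> z - \<psi> z)"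
    unfolding Q_def using nn le1 by (intro tconv_bound[OF \<Omega> d c R]) auto
  moreover have "L2_norm Q (\<lambda>z. \<phi> z - \<psi> z) \<le> 2 * e"
    using L2_norm_triangle_diff[OF L(1,5,2)] e(1,2) L2_norm_minus_commute[of Q p \<psi>] unfolding Q_def by linarith
  \<comment> \<open>The four errors: at most \<open>2 * e\<close> between the two convolutions by
    contraction, \<open>e\<close> between \<open>\<psi>\<close> and its convolution,
    \<open>e\<close> between \<open>\<psi>\<close> and \<open>p\<close>.\<close>
  ultimately show ?thesis
    using L2_norm_triangle_diff[OF L(3,4,5)] L2_norm_triangle_diff[OF L(4,2,5)] e unfolding Q_def by simp
qed

lemma weak_parabolic_duality:
  fixes \<Omega> :: "(real^'n) set"
  assumes \<Omega>: "open \<Omega>" and T: "0 < T" and a0: "a0 \<in> Linf (cylinder \<Omega> T)"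
    and fr: "f \<in> L2 (cylinder \<Omega> T)" "r \<in> L2 (cylinder \<Omega> T)"
    and y: "weak_parabolic 1 (\<Omega> \<times> {..<T}) \<Omega> T \<nu> a0 f y g"
    and p: "weak_parabolic (-1) (\<Omega> \<times> {0<..}) \<Omega> T \<nu> a0 r p h"
  shows "L2_inner (cylinder \<Omega> T) f p = L2_inner (cylinder \<Omega> T) r y"
proof -
  define Q where "Q = cylinder \<Omega> T"
  define N where "N \<equiv> L2_norm Q"
  have es: "energy_space \<Omega> T y g" "energy_space \<Omega> T p h" using y p by (simp_all add: weak_parabolic_def)
  obtain \<psi> where y': "y \<in> L2 Q" "g \<in> L2 Q" and \<psi>: "\<And>k. \<psi> k \<in> C1_compact (\<Omega> \<times> UNIV)"
    "(\<lambda>k. L2_norm Q (\<lambda>z. \<psi> k z - y z)) \<longlonglongrightarrow> 0" "(\<lambda>k. L2_norm Q (\<lambda>z. space_grad (\<psi> k) z - g z)) \<longlonglongrightarrow> 0"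
    using energy_spaceE[OF es(1)] unfolding Q_def by blast
  obtain \<phi> where p': "p \<in> L2 Q" "h \<in> L2 Q" and \<phi>: "\<And>k. \<phi> k \<in> C1_compact (\<Omega> \<times> UNIV)"
    "(\<lambda>k. L2_norm Q (\<lambda>z. \<phi> k z - p z)) \<longlonglongrightarrow> 0" "(\<lambda>k. L2_norm Q (\<lambda>z. space_grad (\<phi> k) z - h z)) \<longlonglongrightarrow> 0"
    using energy_spaceE[OF es(2)] unfolding Q_def by blast
  have frQ: "f \<in> L2 Q" "r \<in> L2 Q" using fr by (auto simp: Q_def)
  have ay: "(\<lambda>z. a0 z * y z) \<in> L2 Q" "(\<lambda>z. a0 z * p z) \<in> L2 Q"
    using a0 y' p' unfolding Q_def by (auto intro: L2_Linf_mult)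
  \<comment> \<open>The zero-order terms are moved to the data, because multiplication by
    \<open>a0\<close>, which may depend on time, does not commute with the convolution. At the end
    they cancel without any convolution.\<close>
  define X where "X z = f z - a0 z * y z" for z
  define Y where "Y z = r z - a0 z * p z" for z
  have XY: "X \<in> L2 Q" "Y \<in> L2 Q" unfolding X_def[abs_def] Y_def[abs_def] by (intro L2_diff frQ ay)+
  note \<phi>Cc = C1_compact_Cc[OF \<phi>(1)] C1_compact_space_grad_Cc[OF \<phi>(1)]
  note \<psi>Cc = C1_compact_Cc[OF \<psi>(1)] C1_compact_space_grad_Cc[OF \<psi>(1)]

  have cancel: "(\<lambda>k. L2_inner Q X (tconv T (moll d) (\<phi> k)) - L2_inner Q Y (tconv T (\<lambda>x. moll d (- x)) (\<psi> k))) \<longlonglongrightarrow> 0"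
    if d: "0 < d" for d
  proof -
    \<comment> \<open>The difference of the time derivative and gradient terms of the two tested
      equations; each bracket is a pairing minus its transpose and so tends to 0.\<close>
    define E where "E k = L2_inner Q y (tconv T (moll_deriv d) (\<phi> k)) - L2_inner Q p (tconv T (\<lambda>x. moll_deriv d (- x)) (\<psi> k))
      + \<nu> * (L2_inner Q g (tconv T (moll d) (space_grad (\<phi> k))) - L2_inner Q h (tconv T (\<lambda>x. moll d (- x)) (space_grad (\<psi> k))))" for k
    have "E \<longlonglongrightarrow> 0 + \<nu> * 0"
      unfolding E_def[abs_def] Q_def
      by (intro tendsto_add tendsto_mult tendsto_const
          tconv_transpose_tendsto[OF \<Omega> continuous_moll_deriv[OF d] moll_support(2)[OF d] y'(1)[unfolded Q_def] p'(1)[unfolded Q_def]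
            \<phi>Cc(1) \<phi>(2)[unfolded Q_def] \<psi>Cc(1) \<psi>(2)[unfolded Q_def]]
          tconv_transpose_tendsto[OF \<Omega> continuous_moll[OF d] moll_support(1)[OF d] y'(2)[unfolded Q_def] p'(2)[unfolded Q_def]
            \<phi>Cc(2) \<phi>(3)[unfolded Q_def] \<psi>Cc(2) \<psi>(3)[unfolded Q_def]])
    moreover have "L2_inner Q X (tconv T (moll d) (\<phi> k)) - L2_inner Q Y (tconv T (\<lambda>x. moll d (- x)) (\<psi> k)) = E k" for k
    proof -
      \<comment> \<open>From \<open>d \<le> s - t \<le> 4 * d\<close> and
        \<open>0 \<le> s \<le> T\<close> follows \<open>- 4 * d \<le> t \<le> T - d\<close>, so the
        forward equation admits this test function.\<close>
      have 0: "moll d (s - t) = 0" if "0 \<le> s" "s \<le> T" "t \<notin> {- 4 * d..T - d}" for s t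
        using that moll_left(1)[OF d, of "s - t"] moll_right(1)[OF d, of "s - t"] by force
      have sub: "{- 4 * d..T - d} \<subseteq> {..<T}" using d by auto
      have F: "tconv T (moll d) (\<phi> k) \<in> C1_compact (\<Omega> \<times> {..<T})"
        "space_grad (tconv T (moll d) (\<phi> k)) = tconv T (moll d) (space_grad (\<phi> k))"
        "time_deriv (tconv T (moll d) (\<phi> k)) = (\<lambda>z. - tconv T (moll_deriv d) (\<phi> k) z)"
        by (rule tconv_C1_compact[where \<eta> = "moll d", OF \<phi>(1) DERIV_moll[OF d] continuous_moll_deriv[OF d] 0 sub]; assumption)+
      \<comment> \<open>For the reflected kernel \<open>t - s\<close> lies in
        \<open>[d, 4d]\<close>, so \<open>t\<close> is at least \<open>d\<close> and the backward
        equation admits the test function.\<close>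
      have 1: "moll d (- (s - t)) = 0" if "0 \<le> s" "s \<le> T" "t \<notin> {d..T + 4 * d}" for s t
        using that moll_left(1)[OF d, of "t - s"] moll_right(1)[OF d, of "t - s"] by force
      have sub1: "{d..T + 4 * d} \<subseteq> {0<..}" using d by auto
      have D1: "((\<lambda>x. moll d (- x)) has_real_derivative - moll_deriv d (- x)) (at x)" for x
        using DERIV_mirror[of "moll d" "moll_deriv d (- x)" x] DERIV_moll[OF d, of "- x"] by simp
      have C1: "continuous_on UNIV (\<lambda>x. - moll_deriv d (- x))"
        by (intro continuous_intros continuous_on_real_comp[OF continuous_moll_deriv[OF d]])
      have B: "tconv T (\<lambda>x. moll d (- x)) (\<psi> k) \<in> C1_compact (\<Omega> \<times> {0<..})"
        "space_grad (tconv T (\<lambda>x. moll d (- x)) (\<psi> k)) = tconv T (\<lambda>x. moll d (- x)) (space_grad (\<psi> k))"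
        "time_deriv (tconv T (\<lambda>x. moll d (- x)) (\<psi> k)) = (\<lambda>z. - tconv T (\<lambda>x. - moll_deriv d (- x)) (\<psi> k) z)"
        by (rule tconv_C1_compact[where \<eta> = "\<lambda>x. moll d (- x)", OF \<psi>(1) D1 C1 1 sub1]; assumption)+
      let ?u = "tconv T (moll d) (\<phi> k)" and ?v = "tconv T (\<lambda>x. moll d (- x)) (\<psi> k)"
      have uv: "?u \<in> L2 Q" "?v \<in> L2 Q"
        using \<Omega> unfolding Q_def by (auto intro!: Cc_L2[OF C1_compact_Cc[OF F(1)]] Cc_L2[OF C1_compact_Cc[OF B(1)]])
      have "time_deriv ?v = tconv T (\<lambda>x. moll_deriv d (- x)) (\<psi> k)"
        unfolding B(3) by (simp add: tconv_def[abs_def])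
      moreover have "L2_inner Q y (time_deriv ?u) = - L2_inner Q y (tconv T (moll_deriv d) (\<phi> k))"
        unfolding F(3) using L2_inner_scale_right[of Q y "- 1" "tconv T (moll_deriv d) (\<phi> k)"] by simp
      moreover have "- 1 * L2_inner Q y (time_deriv ?u) + \<nu> * L2_inner Q g (space_grad ?u)
        + L2_inner Q (\<lambda>z. a0 z * y z) ?u = L2_inner Q f ?u"
        using y F(1) unfolding weak_parabolic_def Q_def by blast
      moreover have "- (- 1) * L2_inner Q p (time_deriv ?v) + \<nu> * L2_inner Q h (space_grad ?v)
        + L2_inner Q (\<lambda>z. a0 z * p z) ?v = L2_inner Q r ?v"
        using p B(1) unfolding weak_parabolic_def Q_def by blast
      moreover have "L2_inner Q X ?u = L2_inner Q f ?u - L2_inner Q (\<lambda>z. a0 z * y z) ?u"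
        "L2_inner Q Y ?v = L2_inner Q r ?v - L2_inner Q (\<lambda>z. a0 z * p z) ?v"
        unfolding X_def[abs_def] Y_def[abs_def] by (intro L2_inner_diff_left frQ ay uv)+
      ultimately show ?thesis
        unfolding E_def F(2) B(2) by (simp add: algebra_simps)
    qed
    ultimately show ?thesis by simp
  qed

  \<comment> \<open>One \<open>e\<close> is the remaining transpose defect; the other two terms are
    Cauchy-Schwarz with the error \<open>4 * e\<close> of the convolved approximants.\<close>
  define C where "C = 1 + 4 * L2_norm Q X + 4 * L2_norm Q Y"
  have C: "0 < C" by (simp add: C_def add_pos_nonneg)
  have small: "\<bar>L2_inner Q X p - L2_inner Q Y y\<bar> \<le> e * C" if e: "0 < e" for e
  proof -
    \<comment> \<open>Order of choices: \<open>n\<close> for the quality of the approximants, then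
      the width \<open>d m\<close> adapted to \<open>\<phi> n\<close> and \<open>\<psi> n\<close>,
      and last \<open>k \<ge> n\<close>, large enough for the cancellation at that width.
      Contraction lets the estimate at \<open>n\<close> control the convolutions at
      \<open>k\<close>.\<close>
    have "\<forall>\<^sub>F k in sequentially. L2_norm Q (\<lambda>z. \<phi> k z - p z) < e \<and> L2_norm Q (\<lambda>z. \<psi> k z - y z) < e"
      by (intro eventually_conj order_tendstoD(2)[OF \<phi>(2) e] order_tendstoD(2)[OF \<psi>(2) e])
    then obtain n where n: "\<And>k. k \<ge> n \<Longrightarrow> L2_norm Q (\<lambda>z. \<phi> k z - p z) < e"
      "\<And>k. k \<ge> n \<Longrightarrow> L2_norm Q (\<lambda>z. \<psi> k z - y z) < e"
      unfolding eventually_sequentially by blast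
    define d where "d m = inverse (real (Suc m))" for m
    have d: "0 < d m" for m by (simp add: d_def)
    have dlim: "(\<lambda>m. 4 * d m) \<longlonglongrightarrow> 0"
      using tendsto_mult_left[OF LIMSEQ_inverse_real_of_nat, of 4] by (simp add: d_def)
    have cr: "continuous_on UNIV (\<lambda>x. moll (d m) (- x))" for m
      by (intro continuous_on_real_comp[OF continuous_moll[OF d]] continuous_intros)
    have supp: "4 * d m < \<bar>x\<bar> \<Longrightarrow> moll (d m) (- x) = 0" for m x
      by (intro moll_support(1)[OF d]) simp
    have int: "integral {0..T} (\<lambda>s. moll (d m) (s - t)) \<le> 1" "integral {0..T} (\<lambda>s. moll (d m) (t - s)) \<le> 1" for m t
      using moll_primitive_bounds[OF d] T by (simp_all add: integral_moll[OF d] add_increasing2 diff_le_eq)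
    have int1: "integral {0..T} (\<lambda>s. moll (d m) (s - t)) = 1" "integral {0..T} (\<lambda>s. moll (d m) (t - s)) = 1"
      if "4 * d m \<le> t" "t \<le> T - 4 * d m" for m t
      using that T d[of m] by (simp_all add: integral_moll[OF d] moll_left[OF d] moll_right[OF d])
    have "(\<lambda>m. L2_norm Q (\<lambda>z. tconv T (moll (d m)) (\<phi> n) z - \<phi> n z)) \<longlonglongrightarrow> 0"
      unfolding Q_def
      by (rule tconv_approx_identity[OF \<Omega> \<phi>Cc(1) continuous_moll[OF d] moll_nonneg[OF d] moll_support(1)[OF d] dlim int(1) int1(1)])
    moreover have "(\<lambda>m. L2_norm Q (\<lambda>z. tconv T (\<lambda>x. moll (d m) (- x)) (\<psi> n) z - \<psi> n z)) \<longlonglongrightarrow> 0"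
      unfolding Q_def
      by (rule tconv_approx_identity[OF \<Omega> \<psi>Cc(1) cr moll_nonneg[OF d] supp dlim]) (simp_all add: int int1)
    ultimately have "\<forall>\<^sub>F m in sequentially. L2_norm Q (\<lambda>z. tconv T (moll (d m)) (\<phi> n) z - \<phi> n z) < e
       \<and> L2_norm Q (\<lambda>z. tconv T (\<lambda>x. moll (d m) (- x)) (\<psi> n) z - \<psi> n z) < e"
      by (intro eventually_conj order_tendstoD(2)[OF _ e])
    then obtain m where m: "L2_norm Q (\<lambda>z. tconv T (moll (d m)) (\<phi> n) z - \<phi> n z) < e"
       "L2_norm Q (\<lambda>z. tconv T (\<lambda>x. moll (d m) (- x)) (\<psi> n) z - \<psi> n z) < e"
      using eventually_happens'[OF sequentially_bot] by blast
    obtain n' where n': "\<And>k. k \<ge> n' \<Longrightarrow>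
        \<bar>L2_inner Q X (tconv T (moll (d m)) (\<phi> k)) - L2_inner Q Y (tconv T (\<lambda>x. moll (d m) (- x)) (\<psi> k))\<bar> < e"
      using LIMSEQ_D[OF cancel[OF d] e] by auto
    define k where "k = max n n'"
    let ?u = "tconv T (moll (d m)) (\<phi> k)" and ?v = "tconv T (\<lambda>x. moll (d m) (- x)) (\<psi> k)"
    have uv: "?u \<in> L2 Q" "?v \<in> L2 Q"
      using \<Omega> unfolding Q_def
      by (auto intro!: Cc_L2[OF tconv_Cc[OF \<phi>Cc(1) continuous_moll[OF d] moll_support(1)[OF d]]]
          Cc_L2[OF tconv_Cc[OF \<psi>Cc(1) cr supp]])
    have "L2_norm Q (\<lambda>z. ?u z - p z) \<le> 4 * e"
      unfolding Q_def using n[of n] n[of k] m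
      by (intro tconv_approx_limit[OF \<Omega> \<phi>Cc(1)[of k] \<phi>Cc(1)[of n] p'(1)[unfolded Q_def] continuous_moll[OF d] moll_nonneg[OF d] moll_support(1)[OF d] int])
         (auto simp: Q_def k_def)
    then have "\<bar>L2_inner Q X ?u - L2_inner Q X p\<bar> \<le> L2_norm Q X * (4 * e)"
      using L2_Cauchy_Schwarz[OF XY(1) L2_diff[OF uv(1) p'(1)]] mult_left_mono[of _ "4 * e" "L2_norm Q X"]
      by (fastforce simp: L2_inner_diff_right[OF uv(1) p'(1) XY(1)])
    moreover have "L2_norm Q (\<lambda>z. ?v z - y z) \<le> 4 * e"
      unfolding Q_def using n[of n] n[of k] m int
      by (intro tconv_approx_limit[OF \<Omega> \<psi>Cc(1)[of k] \<psi>Cc(1)[of n] y'(1)[unfolded Q_def] cr moll_nonneg[OF d] supp])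
         (auto simp: Q_def k_def)
    then have "\<bar>L2_inner Q Y ?v - L2_inner Q Y y\<bar> \<le> L2_norm Q Y * (4 * e)"
      using L2_Cauchy_Schwarz[OF XY(2) L2_diff[OF uv(2) y'(1)]] mult_left_mono[of _ "4 * e" "L2_norm Q Y"]
      by (fastforce simp: L2_inner_diff_right[OF uv(2) y'(1) XY(2)])
    moreover have "\<bar>L2_inner Q X ?u - L2_inner Q Y ?v\<bar> < e" by (rule n') (simp add: k_def)
    ultimately show ?thesis by (simp add: C_def algebra_simps)
  qed
  have "L2_inner Q X p = L2_inner Q Y y"
  proof (rule ccontr)
    assume "L2_inner Q X p \<noteq> L2_inner Q Y y"
    \<comment> \<open>With this \<open>e\<close> the estimate says that a positive number is at most
      half of itself.\<close>
    then show False
      using small[of "\<bar>L2_inner Q X p - L2_inner Q Y y\<bar> / (2 * C)"] C by simp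
  qed
  moreover have "L2_inner Q X p = L2_inner Q f p - L2_inner Q (\<lambda>z. a0 z * y z) p"
    "L2_inner Q Y y = L2_inner Q r y - L2_inner Q (\<lambda>z. a0 z * p z) y"
    unfolding X_def[abs_def] Y_def[abs_def] by (intro L2_inner_diff_left frQ ay p' y')+
  moreover have "L2_inner Q (\<lambda>z. a0 z * y z) p = L2_inner Q (\<lambda>z. a0 z * p z) y"
    by (simp add: L2_inner_def mult_ac)
  ultimately show ?thesis by (simp add: Q_def)
qed

section \<open>Optimality\<close>

text \<open>The definitions integrate the whole sum at once. Splitting it requires each product to
  be integrable, which follows from the bound on \<open>a0\<close> and the compact supports of the
  test functions.\<close>

lemma weak_parabolic_integral:
  fixes \<phi> :: "(real^'n) \<times> real \<Rightarrow> real"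
  assumes \<Omega>: "open \<Omega>" and a0: "a0 \<in> Linf (cylinder \<Omega> T)" and e: "energy_space \<Omega> T y g" and \<phi>: "\<phi> \<in> C1_compact U"
  shows "(LINT z|lebesgue_on (cylinder \<Omega> T). - sg * (y z * time_deriv \<phi> z) + \<nu> * (g z \<bullet> space_grad \<phi> z) + a0 z * y z * \<phi> z)
    = - sg * L2_inner (cylinder \<Omega> T) y (time_deriv \<phi>) + \<nu> * L2_inner (cylinder \<Omega> T) g (space_grad \<phi>)
        + L2_inner (cylinder \<Omega> T) (\<lambda>z. a0 z * y z) \<phi>"
proof -
  have L: "y \<in> L2 (cylinder \<Omega> T)" "g \<in> L2 (cylinder \<Omega> T)" using e by (auto simp: energy_space_def)
  have Q: "cylinder \<Omega> T \<in> sets lebesgue" using \<Omega> by simp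
  note \<phi>L = Cc_L2[OF C1_compact_Cc[OF \<phi>] Q] Cc_L2[OF C1_compact_time_deriv_Cc[OF \<phi>] Q] Cc_L2[OF C1_compact_space_grad_Cc[OF \<phi>] Q]
  show ?thesis
    using L2_inner_integrable[OF L(1) \<phi>L(2)] L2_inner_integrable[OF L(2) \<phi>L(3)]
      L2_inner_integrable[OF L2_Linf_mult[OF a0 L(1)] \<phi>L(1)]
    by (simp add: L2_inner_def)
qed

lemma weak_forward_iff:
  assumes \<Omega>: "open \<Omega>" and a0: "a0 \<in> Linf (cylinder \<Omega> T)"
  shows "weak_forward \<Omega> T \<nu> a0 f y \<longleftrightarrow> (\<exists>g. weak_parabolic 1 (\<Omega> \<times> {..<T}) \<Omega> T \<nu> a0 f y g)"
proof -
  have "(LINT z|lebesgue_on (cylinder \<Omega> T). - (y z * time_deriv \<phi> z) + \<nu> * (g z \<bullet> space_grad \<phi> z) + a0 z * y z * \<phi> z)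
       = (LINT z|lebesgue_on (cylinder \<Omega> T). f z * \<phi> z) \<longleftrightarrow>
      - 1 * L2_inner (cylinder \<Omega> T) y (time_deriv \<phi>) + \<nu> * L2_inner (cylinder \<Omega> T) g (space_grad \<phi>)
        + L2_inner (cylinder \<Omega> T) (\<lambda>z. a0 z * y z) \<phi> = L2_inner (cylinder \<Omega> T) f \<phi>"
    if "energy_space \<Omega> T y g" "\<phi> \<in> C1_compact (\<Omega> \<times> {..<T})" for g \<phi>
    unfolding weak_parabolic_integral[OF \<Omega> a0 that, of 1 \<nu>, symmetric] by (simp add: L2_inner_def)
  then show ?thesis unfolding weak_forward_def weak_parabolic_def by blast
qed

lemma weak_backward_iff:
  assumes \<Omega>: "open \<Omega>" and a0: "a0 \<in> Linf (cylinder \<Omega> T)"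
  shows "weak_backward \<Omega> T \<nu> a0 (\<lambda>z. - q z) p \<longleftrightarrow> (\<exists>g. weak_parabolic (-1) (\<Omega> \<times> {0<..}) \<Omega> T \<nu> a0 q p g)"
proof -
  have "(LINT z|lebesgue_on (cylinder \<Omega> T). - (p z * time_deriv \<phi> z) - \<nu> * (g z \<bullet> space_grad \<phi> z) - a0 z * p z * \<phi> z)
       = (LINT z|lebesgue_on (cylinder \<Omega> T). - q z * \<phi> z) \<longleftrightarrow>
      - (- 1) * L2_inner (cylinder \<Omega> T) p (time_deriv \<phi>) + \<nu> * L2_inner (cylinder \<Omega> T) g (space_grad \<phi>)
        + L2_inner (cylinder \<Omega> T) (\<lambda>z. a0 z * p z) \<phi> = L2_inner (cylinder \<Omega> T) q \<phi>"
    if "energy_space \<Omega> T p g" "\<phi> \<in> C1_compact (\<Omega> \<times> {0<..})" for g \<phi>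
  proof -
    have "(\<lambda>z. - (p z * time_deriv \<phi> z) - \<nu> * (g z \<bullet> space_grad \<phi> z) - a0 z * p z * \<phi> z)
      = (\<lambda>z. - (- (- 1) * (p z * time_deriv \<phi> z) + \<nu> * (g z \<bullet> space_grad \<phi> z) + a0 z * p z * \<phi> z))"
      by auto
    then have "(LINT z|lebesgue_on (cylinder \<Omega> T). - (p z * time_deriv \<phi> z) - \<nu> * (g z \<bullet> space_grad \<phi> z) - a0 z * p z * \<phi> z)
      = - (LINT z|lebesgue_on (cylinder \<Omega> T). - (- 1) * (p z * time_deriv \<phi> z) + \<nu> * (g z \<bullet> space_grad \<phi> z) + a0 z * p z * \<phi> z)"
      by (simp only: Bochner_Integration.integral_minus)
    moreover have "(LINT z|lebesgue_on (cylinder \<Omega> T). - q z * \<phi> z) = - L2_inner (cylinder \<Omega> T) q \<phi>"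
      by (simp add: L2_inner_def)
    ultimately show ?thesis
      unfolding weak_parabolic_integral[OF \<Omega> a0 that, of "- 1" \<nu>] by (simp only: neg_equal_iff_equal)
  qed
  then show ?thesis unfolding weak_backward_def weak_parabolic_def by blast
qed

section \<open>Linearity and solvability in both time directions\<close>

lemma energy_space_lincomb:
  assumes \<Omega>: "open \<Omega>" and "energy_space \<Omega> T y g" "energy_space \<Omega> T y' g'"
  shows "energy_space \<Omega> T (\<lambda>z. y z + t * y' z) (\<lambda>z. g z + t *\<^sub>R g' z)"
proof -
  let ?Q = "cylinder \<Omega> T"
  obtain \<phi> where y: "y \<in> L2 ?Q" "g \<in> L2 ?Q" and \<phi>: "\<And>k. \<phi> k \<in> C1_compact (\<Omega> \<times> UNIV)"
    "(\<lambda>k. L2_norm ?Q (\<lambda>z. \<phi> k z - y z)) \<longlonglongrightarrow> 0" "(\<lambda>k. L2_norm ?Q (\<lambda>z. space_grad (\<phi> k) z - g z)) \<longlonglongrightarrow> 0"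
    using energy_spaceE[OF assms(2)] by blast
  obtain \<psi> where y': "y' \<in> L2 ?Q" "g' \<in> L2 ?Q" and \<psi>: "\<And>k. \<psi> k \<in> C1_compact (\<Omega> \<times> UNIV)"
    "(\<lambda>k. L2_norm ?Q (\<lambda>z. \<psi> k z - y' z)) \<longlonglongrightarrow> 0" "(\<lambda>k. L2_norm ?Q (\<lambda>z. space_grad (\<psi> k) z - g' z)) \<longlonglongrightarrow> 0"
    using energy_spaceE[OF assms(3)] by blast
  have Q: "?Q \<in> sets lebesgue" using \<Omega> by simp
  have lim: "(\<lambda>k. L2_norm ?Q (\<lambda>z. (F k z + t *\<^sub>R G k z) - (f z + t *\<^sub>R h z))) \<longlonglongrightarrow> 0"
    if "\<And>k. F k \<in> L2 ?Q" "\<And>k. G k \<in> L2 ?Q" "f \<in> L2 ?Q" "h \<in> L2 ?Q"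
      "(\<lambda>k. L2_norm ?Q (\<lambda>z. F k z - f z)) \<longlonglongrightarrow> 0" "(\<lambda>k. L2_norm ?Q (\<lambda>z. G k z - h z)) \<longlonglongrightarrow> 0"
    for F G :: "nat \<Rightarrow> (real^'a) \<times> real \<Rightarrow> 'b::euclidean_space" and f h
  proof (rule Lim_null_comparison[OF always_eventually])
    have "(\<lambda>k. L2_norm ?Q (\<lambda>z. F k z - f z) + \<bar>t\<bar> * L2_norm ?Q (\<lambda>z. G k z - h z)) \<longlonglongrightarrow> 0 + \<bar>t\<bar> * 0"
      by (intro tendsto_intros that)
    then show "(\<lambda>k. L2_norm ?Q (\<lambda>z. F k z - f z) + \<bar>t\<bar> * L2_norm ?Q (\<lambda>z. G k z - h z)) \<longlonglongrightarrow> 0" by simp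
    have "L2_norm ?Q (\<lambda>z. (F k z - f z) + t *\<^sub>R (G k z - h z)) \<le> L2_norm ?Q (\<lambda>z. F k z - f z) + \<bar>t\<bar> * L2_norm ?Q (\<lambda>z. G k z - h z)" for k
      unfolding L2_norm_scale[symmetric] by (intro L2_norm_triangle L2_scale L2_diff that)
    then show "\<forall>k. norm (L2_norm ?Q (\<lambda>z. (F k z + t *\<^sub>R G k z) - (f z + t *\<^sub>R h z)))
        \<le> L2_norm ?Q (\<lambda>z. F k z - f z) + \<bar>t\<bar> * L2_norm ?Q (\<lambda>z. G k z - h z)"
      by (simp add: algebra_simps)
  qed
  have "(\<lambda>k. L2_norm ?Q (\<lambda>z. (\<phi> k z + t * \<psi> k z) - (y z + t * y' z))) \<longlonglongrightarrow> 0"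
    using lim[OF Cc_L2[OF C1_compact_Cc[OF \<phi>(1)] Q] Cc_L2[OF C1_compact_Cc[OF \<psi>(1)] Q] y(1) y'(1) \<phi>(2) \<psi>(2)] by simp
  moreover have "(\<lambda>k. L2_norm ?Q (\<lambda>z. space_grad (\<lambda>z. \<phi> k z + t * \<psi> k z) z - (g z + t *\<^sub>R g' z))) \<longlonglongrightarrow> 0"
    using lim[OF Cc_L2[OF C1_compact_space_grad_Cc[OF \<phi>(1)] Q] Cc_L2[OF C1_compact_space_grad_Cc[OF \<psi>(1)] Q] y(2) y'(2) \<phi>(3) \<psi>(3)]
    by (simp add: space_time_grad_lincomb(1)[OF \<phi>(1) \<psi>(1)])
  moreover have "(\<lambda>z. \<phi> k z + t * \<psi> k z) \<in> C1_compact (\<Omega> \<times> UNIV)" for k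
    by (rule C1_compact_lincomb(1)[OF \<phi>(1) \<psi>(1)])
  moreover have "(\<lambda>z. y z + t * y' z) \<in> L2 ?Q" "(\<lambda>z. g z + t *\<^sub>R g' z) \<in> L2 ?Q"
    by (intro L2_add L2_mult L2_scale y y')+
  ultimately show ?thesis
    unfolding energy_space_def by (intro conjI exI[of _ "\<lambda>k z. \<phi> k z + t * \<psi> k z"] allI) auto
qed

lemma weak_parabolic_lincomb:
  assumes \<Omega>: "open \<Omega>" and a0: "a0 \<in> Linf (cylinder \<Omega> T)"
    and f: "f \<in> L2 (cylinder \<Omega> T)" "f' \<in> L2 (cylinder \<Omega> T)"
    and y: "weak_parabolic sg V \<Omega> T \<nu> a0 f y g" "weak_parabolic sg V \<Omega> T \<nu> a0 f' y' g'"
  shows "weak_parabolic sg V \<Omega> T \<nu> a0 (\<lambda>z. f z + t * f' z) (\<lambda>z. y z + t * y' z) (\<lambda>z. g z + t *\<^sub>R g' z)"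
  unfolding weak_parabolic_def
proof (intro conjI ballI)
  let ?Q = "cylinder \<Omega> T"
  have e: "energy_space \<Omega> T y g" "energy_space \<Omega> T y' g'" using y by (auto simp: weak_parabolic_def)
  then show "energy_space \<Omega> T (\<lambda>z. y z + t * y' z) (\<lambda>z. g z + t *\<^sub>R g' z)"
    by (rule energy_space_lincomb[OF \<Omega>])
  fix \<phi> assume \<phi>: "\<phi> \<in> C1_compact V"
  have L: "y \<in> L2 ?Q" "y' \<in> L2 ?Q" "g \<in> L2 ?Q" "g' \<in> L2 ?Q" using e by (auto simp: energy_space_def)
  have Q: "?Q \<in> sets lebesgue" using \<Omega> by simp
  note \<phi>L = Cc_L2[OF C1_compact_Cc[OF \<phi>] Q] Cc_L2[OF C1_compact_time_deriv_Cc[OF \<phi>] Q] Cc_L2[OF C1_compact_space_grad_Cc[OF \<phi>] Q]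
  have lin: "L2_inner ?Q (\<lambda>z. k z + t * k' z) \<psi> = L2_inner ?Q k \<psi> + t * L2_inner ?Q k' \<psi>"
    if "k \<in> L2 ?Q" "k' \<in> L2 ?Q" "\<psi> \<in> L2 ?Q" for k k' \<psi> :: "(real^'a) \<times> real \<Rightarrow> real"
    using L2_inner_add_left[OF that(1) L2_mult[OF that(2), of t] that(3)] by (simp add: L2_inner_mult_left)
  have ling: "L2_inner ?Q (\<lambda>z. g z + t *\<^sub>R g' z) (space_grad \<phi>) = L2_inner ?Q g (space_grad \<phi>) + t * L2_inner ?Q g' (space_grad \<phi>)"
    using L2_inner_add_left[OF L(3) L2_scale[OF L(4), of t] \<phi>L(3)] by (simp add: L2_inner_scale_left)
  have eq: "(\<lambda>z. a0 z * (y z + t * y' z)) = (\<lambda>z. a0 z * y z + t * (a0 z * y' z))" by (auto simp: algebra_simps)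
  have e1: "- sg * L2_inner ?Q y (time_deriv \<phi>) + \<nu> * L2_inner ?Q g (space_grad \<phi>) + L2_inner ?Q (\<lambda>z. a0 z * y z) \<phi> = L2_inner ?Q f \<phi>"
    and e2: "- sg * L2_inner ?Q y' (time_deriv \<phi>) + \<nu> * L2_inner ?Q g' (space_grad \<phi>) + L2_inner ?Q (\<lambda>z. a0 z * y' z) \<phi> = L2_inner ?Q f' \<phi>"
    using y \<phi> unfolding weak_parabolic_def by blast+
  show "- sg * L2_inner ?Q (\<lambda>z. y z + t * y' z) (time_deriv \<phi>) + \<nu> * L2_inner ?Q (\<lambda>z. g z + t *\<^sub>R g' z) (space_grad \<phi>)
      + L2_inner ?Q (\<lambda>z. a0 z * (y z + t * y' z)) \<phi> = L2_inner ?Q (\<lambda>z. f z + t * f' z) \<phi>"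
    unfolding eq ling lin[OF L(1,2) \<phi>L(2)] lin[OF L2_Linf_mult[OF a0 L(1)] L2_Linf_mult[OF a0 L(2)] \<phi>L(1)] lin[OF f \<phi>L(1)]
      e1[symmetric] e2[symmetric]
    by (simp add: algebra_simps)
qed

text \<open>The weight is \<open>1 + t\<close>. Test functions vanish at time \<open>T\<close>,
  which leaves the boundary term \<open>- \<zeta>(x, 0)^2\<close>.\<close>

lemma weak_parabolic_forward_exists:
  fixes \<Omega> :: "(real^'n) set"
  assumes "open \<Omega>" "0 < \<nu>" "0 < T" "a0 \<in> Linf (cylinder \<Omega> T)" "AE z in lebesgue_on (cylinder \<Omega> T). 0 \<le> a0 z"
    "f \<in> L2 (cylinder \<Omega> T)"
  shows "\<exists>y g. weak_parabolic 1 (\<Omega> \<times> {..<T}) \<Omega> T \<nu> a0 f y g"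
proof (rule weak_parabolic_exists[where c = 1 and M = "1 + T"])
  fix \<zeta> :: "(real^'n) \<times> real \<Rightarrow> real" and x assume "\<zeta> \<in> C1_compact (\<Omega> \<times> {..<T})"
  then have "\<zeta> (x, T) = 0" unfolding C1_compact_def by force
  then show "1 * ((1 + 1 * T) * (\<zeta> (x, T))\<^sup>2 - 1 * (\<zeta> (x, 0))\<^sup>2) \<le> 0" by simp
qed (use assms in auto)

text \<open>The weight is \<open>1 + T - t\<close>, decreasing to 1. Test functions vanish at time
  0, which leaves the boundary term \<open>- \<zeta>(x, T)^2\<close>.\<close>

lemma weak_parabolic_backward_exists:
  fixes \<Omega> :: "(real^'n) set"
  assumes "open \<Omega>" "0 < \<nu>" "0 < T" "a0 \<in> Linf (cylinder \<Omega> T)" "AE z in lebesgue_on (cylinder \<Omega> T). 0 \<le> a0 z"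
    "f \<in> L2 (cylinder \<Omega> T)"
  shows "\<exists>p g. weak_parabolic (-1) (\<Omega> \<times> {0<..}) \<Omega> T \<nu> a0 f p g"
proof (rule weak_parabolic_exists[where c = "1 + T" and M = "1 + T"])
  fix \<zeta> :: "(real^'n) \<times> real \<Rightarrow> real" and x assume "\<zeta> \<in> C1_compact (\<Omega> \<times> {0<..})"
  then have "\<zeta> (x, 0) = 0" unfolding C1_compact_def by force
  then show "- 1 * ((1 + T + - 1 * T) * (\<zeta> (x, T))\<^sup>2 - (1 + T) * (\<zeta> (x, 0))\<^sup>2) \<le> 0" by simp
qed (use assms in auto)

section \<open>Restriction to the control region and projection onto the box\<close>

lemma integral_lebesgue_on_subset:
  assumes "A \<subseteq> B" "A \<in> sets lebesgue" "B \<in> sets lebesgue"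
  shows "(LINT z|lebesgue_on A. h z) = (LINT z|lebesgue_on B. indicator A z * (h z :: real))"
  using assms by (subst (1 2) integral_restrict_space)
    (auto intro!: Bochner_Integration.integral_cong simp: indicator_def)

lemma L2_subset:
  fixes f :: "'a::euclidean_space \<Rightarrow> 'b::euclidean_space"
  assumes "f \<in> L2 B" "A \<subseteq> B" "A \<in> sets lebesgue" "B \<in> sets lebesgue"
  shows "f \<in> L2 A"
proof -
  have eq: "restrict_space (lebesgue_on B) A = lebesgue_on A"
    using assms by (simp add: restrict_restrict_space Int_absorb1)
  have "f \<in> borel_measurable (lebesgue_on A)"
    using measurable_restrict_space1[OF L2D(1)[OF assms(1)], of A] unfolding eq .
  moreover have "integrable (lebesgue_on A) (\<lambda>z. (norm (f z))\<^sup>2)"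
  proof -
    have A: "A \<in> sets (lebesgue_on B)" using assms by (simp add: sets_restrict_space_iff)
    then have "A \<inter> space (lebesgue_on B) \<in> sets (lebesgue_on B)" by (intro sets.Int) auto
    then show ?thesis
      unfolding eq[symmetric] using integrable_mult_indicator[OF A L2D(2)[OF assms(1)]]
      by (simp add: integrable_restrict_space)
  qed
  ultimately show ?thesis by (simp add: L2_def)
qed

lemma L2_extend_zero:
  fixes u :: "'a::euclidean_space \<Rightarrow> real"
  assumes u: "u \<in> L2 A" and A: "A \<subseteq> B" "A \<in> sets lebesgue" "B \<in> sets lebesgue"
  shows "(\<lambda>z. u z * indicator A z) \<in> L2 B"
proof -
  have m: "(\<lambda>z. u z * indicator A z) \<in> borel_measurable lebesgue"
    using L2D(1)[OF u] A by (simp add: borel_measurable_restrict_space_iff mult.commute)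
  have "integrable lebesgue (\<lambda>z. indicator A z *\<^sub>R (norm (u z))\<^sup>2)"
    using L2D(2)[OF u] A by (simp add: integrable_restrict_space)
  moreover have "(\<lambda>z. indicator A z *\<^sub>R (norm (u z))\<^sup>2) = (\<lambda>z. (norm (u z * indicator A z))\<^sup>2)"
    by (auto simp: indicator_def)
  ultimately have "integrable lebesgue (\<lambda>z. (norm (u z * indicator A z))\<^sup>2)" by simp
  then have "integrable (lebesgue_on B) (\<lambda>z. (norm (u z * indicator A z))\<^sup>2)"
    using A(3) integrable_mult_indicator[of B lebesgue "\<lambda>z. (norm (u z * indicator A z))\<^sup>2"]
    by (simp add: integrable_restrict_space)
  then show ?thesis using measurable_restrict_space1[OF m, of B] by (simp add: L2_def)
qed

lemma L2_inner_extend_zero: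
  assumes "A \<subseteq> B" "A \<in> sets lebesgue" "B \<in> sets lebesgue"
  shows "L2_inner B (\<lambda>z. u z * indicator A z) p = L2_inner A u (p :: 'a::euclidean_space \<Rightarrow> real)"
  unfolding L2_inner_def integral_lebesgue_on_subset[OF assms]
  by (intro Bochner_Integration.integral_cong) auto

text \<open>Since 0 lies in \<open>[a, b]\<close>, truncation does not increase the absolute value;
  this gives square integrability also on sets of infinite measure.\<close>

lemma Pr_box_control_set:
  assumes "v \<in> L2 S" "a \<le> 0" "0 \<le> b" shows "Pr_box a b v \<in> control_set S a b"
proof -
  note [measurable] = L2D(1)[OF assms(1)]
  have "Pr_box a b v \<in> L2 S"
  proof (rule L2_dominated[OF _ L2D(2)[OF assms(1)]])
    show "Pr_box a b v \<in> borel_measurable (lebesgue_on S)" unfolding Pr_box_def[abs_def] by measurable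
    have "\<bar>Pr_box a b v z\<bar> \<le> \<bar>v z\<bar>" for z using assms(2,3) by (auto simp: Pr_box_def)
    then show "(norm (Pr_box a b v z))\<^sup>2 \<le> (norm (v z))\<^sup>2" for z by (intro power_mono) auto
  qed
  then show ?thesis using assms(2,3) by (auto simp: control_set_def Pr_box_def)
qed

text \<open>First-order condition: \<open>\<pi>\<close> minimises
  \<open>\<gamma> / 2 * x^2 - s * x\<close> over \<open>[a, b]\<close>.\<close>

lemma Pr_box_variational:
  fixes a b v s \<pi> \<gamma> :: real
  assumes "0 < \<gamma>" "a \<le> v" "v \<le> b" "\<pi> = min b (max a (s / \<gamma>))"
  shows "0 \<le> (v - \<pi>) * (\<gamma> * \<pi> - s)"
proof -
  consider "s / \<gamma> \<le> a" | "a \<le> s / \<gamma>" "s / \<gamma> \<le> b" | "b \<le> s / \<gamma>" by linarith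
  then show ?thesis
  proof cases
    case 1
    then have "\<pi> = a" "s \<le> \<gamma> * a" using assms by (auto simp: field_simps)
    then show ?thesis using assms by simp
  next
    case 2
    then have "\<pi> = s / \<gamma>" using assms by auto
    then show ?thesis using assms by simp
  next
    case 3
    then have "\<pi> = b" using assms by (simp add: min_def max_def)
    moreover have "\<gamma> * b \<le> s" using 3 assms by (simp add: field_simps)
    ultimately show ?thesis using assms by (simp add: mult_nonpos_nonpos)
  qed
qed

lemma Pr_box_variational_L2:
  fixes v s :: "'a::euclidean_space \<Rightarrow> real"
  assumes \<gamma>: "0 < \<gamma>" and ab: "a \<le> 0" "0 \<le> b" and v: "v \<in> control_set S a b" and s: "s \<in> L2 S"
  defines "\<pi> \<equiv> Pr_box a b (\<lambda>z. s z / \<gamma>)"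
  shows "0 \<le> \<gamma> * L2_inner S v \<pi> - \<gamma> * L2_inner S \<pi> \<pi> - L2_inner S v s + L2_inner S \<pi> s"
proof -
  have "(\<lambda>z. s z / \<gamma>) \<in> L2 S" using L2_mult[OF s, of "1 / \<gamma>"] by simp
  then have L: "v \<in> L2 S" "\<pi> \<in> L2 S" using v Pr_box_control_set[OF _ ab] by (auto simp: control_set_def \<pi>_def)
  have "0 \<le> L2_inner S (\<lambda>z. v z - \<pi> z) (\<lambda>z. \<gamma> * \<pi> z - s z)"
    unfolding L2_inner_def
  proof (rule integral_nonneg_AE)
    have "AE z in lebesgue_on S. a \<le> v z \<and> v z \<le> b" using v by (simp add: control_set_def)
    then show "AE z in lebesgue_on S. 0 \<le> (v z - \<pi> z) \<bullet> (\<gamma> * \<pi> z - s z)"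
      by eventually_elim (simp add: Pr_box_variational[OF \<gamma> _ _ refl] \<pi>_def Pr_box_def)
  qed
  also have "\<dots> = \<gamma> * L2_inner S v \<pi> - \<gamma> * L2_inner S \<pi> \<pi> - L2_inner S v s + L2_inner S \<pi> s"
    using L s L2_mult[OF L(2), of \<gamma>] L2_inner_scale_right[of S _ \<gamma> \<pi>]
    by (simp add: L2_inner_diff_left L2_inner_diff_right L2_diff algebra_simps)
  finally show ?thesis .
qed

section \<open>Costs and the duality gap\<close>

lemma primal_cost_L2:
  "primal_cost \<Omega> W T \<gamma> yd u y
    = 1/2 * (L2_norm (cylinder \<Omega> T) (\<lambda>z. y z - yd z))\<^sup>2 + \<gamma>/2 * (L2_norm (cylinder W T) u)\<^sup>2"
  by (simp add: primal_cost_def L2_norm_def integral_nonneg_AE)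

lemma primal_dual_duality:
  assumes \<Omega>: "open \<Omega>" "open W" "W \<subseteq> \<Omega>" and T: "0 < T" and a0: "a0 \<in> Linf (cylinder \<Omega> T)"
    and v: "primal_feasible \<Omega> W T \<nu> a0 a b v w" and r: "dual_feasible \<Omega> T \<nu> a0 r s"
  shows "v \<in> L2 (cylinder W T)" "w \<in> L2 (cylinder \<Omega> T)" "r \<in> L2 (cylinder \<Omega> T)" "s \<in> L2 (cylinder \<Omega> T)" "s \<in> L2 (cylinder W T)"
    and "L2_inner (cylinder W T) v s = L2_inner (cylinder \<Omega> T) w r"
proof -
  have O: "cylinder W T \<subseteq> cylinder \<Omega> T" "cylinder W T \<in> sets lebesgue" "cylinder \<Omega> T \<in> sets lebesgue"
    using \<Omega> by auto
  show vL: "v \<in> L2 (cylinder W T)" using v by (simp add: primal_feasible_def control_set_def)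
  show rL: "r \<in> L2 (cylinder \<Omega> T)" using r by (simp add: dual_feasible_def)
  obtain g where g: "weak_parabolic 1 (\<Omega> \<times> {..<T}) \<Omega> T \<nu> a0 (\<lambda>z. v z * indicator (cylinder W T) z) w g"
    using v unfolding primal_feasible_def weak_forward_iff[OF \<Omega>(1) a0] by blast
  obtain h where h: "weak_parabolic (-1) (\<Omega> \<times> {0<..}) \<Omega> T \<nu> a0 r s h"
    using r unfolding dual_feasible_def weak_backward_iff[OF \<Omega>(1) a0] by blast
  show "w \<in> L2 (cylinder \<Omega> T)" using g by (simp add: weak_parabolic_def energy_space_def)
  show sL: "s \<in> L2 (cylinder \<Omega> T)" using h by (simp add: weak_parabolic_def energy_space_def)
  then show "s \<in> L2 (cylinder W T)" by (rule L2_subset[OF _ O])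
  show "L2_inner (cylinder W T) v s = L2_inner (cylinder \<Omega> T) w r"
    using weak_parabolic_duality[OF \<Omega>(1) T a0 L2_extend_zero[OF vL O] rL g h]
    unfolding L2_inner_extend_zero[OF O] by (simp add: L2_inner_commute)
qed

text \<open>\<open>gap\<close> is the excess at \<open>v\<close> over the minimum, attained at
  \<open>\<pi>\<close>, of the functional \<open>x -> \<gamma> / 2 * |x|^2 - <x, s>\<close> on the
  control set; strong convexity gives its quadratic lower bound. Completing the square leaves the
  cross term \<open><w, r>\<close>, which duality turns into \<open><v, s>\<close>.\<close>

lemma primal_plus_dual_cost:
  assumes \<Omega>: "open \<Omega>" "open W" "W \<subseteq> \<Omega>" and T: "0 < T" and a0: "a0 \<in> Linf (cylinder \<Omega> T)"
    and \<gamma>: "0 < \<gamma>" and ab: "a \<le> 0" "0 \<le> b" and yd: "yd \<in> L2 (cylinder \<Omega> T)"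
    and v: "primal_feasible \<Omega> W T \<nu> a0 a b v w" and r: "dual_feasible \<Omega> T \<nu> a0 r s"
  defines "\<pi> \<equiv> Pr_box a b (\<lambda>z. s z / \<gamma>)"
  defines "gap \<equiv> \<gamma>/2 * (L2_norm (cylinder W T) v)\<^sup>2 - L2_inner (cylinder W T) v s
         + L2_inner (cylinder W T) s \<pi> - \<gamma>/2 * (L2_norm (cylinder W T) \<pi>)\<^sup>2"
  shows "primal_cost \<Omega> W T \<gamma> yd v w + dual_cost \<Omega> W T \<gamma> yd a b r s
     = 1/2 * (L2_norm (cylinder \<Omega> T) (\<lambda>z. w z - (yd z - r z)))\<^sup>2 + gap"
    and "\<gamma>/2 * (L2_norm (cylinder W T) (\<lambda>z. v z - \<pi> z))\<^sup>2 \<le> gap"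
    and "\<pi> \<in> control_set (cylinder W T) a b"
proof -
  note D = primal_dual_duality[OF \<Omega> T a0 v r]
  let ?Q = "cylinder \<Omega> T" and ?O = "cylinder W T"
  have "(\<lambda>z. s z / \<gamma>) \<in> L2 ?O" using L2_mult[OF D(5), of "1 / \<gamma>"] by simp
  then show \<pi>: "\<pi> \<in> control_set ?O a b" unfolding \<pi>_def by (rule Pr_box_control_set[OF _ ab])
  then have \<pi>L: "\<pi> \<in> L2 ?O" by (simp add: control_set_def)
  have "(L2_norm ?Q (\<lambda>z. w z - (yd z - r z)))\<^sup>2
     = (L2_norm ?Q (\<lambda>z. w z - yd z))\<^sup>2 + 2 * (L2_inner ?Q w r - L2_inner ?Q yd r) + (L2_norm ?Q r)\<^sup>2"
    using L2_norm_sq_add[OF L2_diff[OF D(2) yd] D(3), of 1] D yd by (simp add: L2_inner_diff_left algebra_simps)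
  then show "primal_cost \<Omega> W T \<gamma> yd v w + dual_cost \<Omega> W T \<gamma> yd a b r s
     = 1/2 * (L2_norm ?Q (\<lambda>z. w z - (yd z - r z)))\<^sup>2 + gap"
    unfolding gap_def primal_cost_L2 dual_cost_def D(6) \<pi>_def[symmetric] L2_inner_commute[of ?Q r yd] by (simp add: algebra_simps)
  have "v \<in> control_set ?O a b" using v by (simp add: primal_feasible_def)
  from Pr_box_variational_L2[OF \<gamma> ab this D(5)]
  have "0 \<le> \<gamma> * L2_inner ?O v \<pi> - \<gamma> * (L2_norm ?O \<pi>)\<^sup>2 - L2_inner ?O v s + L2_inner ?O s \<pi>"
    unfolding \<pi>_def[symmetric] L2_norm_sq L2_inner_commute[of ?O s] .
  moreover have "\<gamma>/2 * (L2_norm ?O (\<lambda>z. v z - \<pi> z))\<^sup>2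
      = \<gamma>/2 * (L2_norm ?O v)\<^sup>2 - \<gamma> * L2_inner ?O v \<pi> + \<gamma>/2 * (L2_norm ?O \<pi>)\<^sup>2"
  proof -
    have eq: "(L2_norm ?O (\<lambda>z. v z - \<pi> z))\<^sup>2 = (L2_norm ?O v)\<^sup>2 - 2 * L2_inner ?O v \<pi> + (L2_norm ?O \<pi>)\<^sup>2"
      using L2_norm_sq_add[OF D(1) \<pi>L, of "- 1"] by simp
    show ?thesis unfolding eq by (simp add: field_simps)
  qed
  ultimately show "\<gamma>/2 * (L2_norm ?O (\<lambda>z. v z - \<pi> z))\<^sup>2 \<le> gap" unfolding gap_def by (simp add: field_simps)
qed

text \<open>The box constraint is convex and the state equation linear; the segment carries the
  first variation of the primal cost.\<close>

lemma primal_feasible_segment: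
  assumes \<Omega>: "open \<Omega>" "open W" "W \<subseteq> \<Omega>" and a0: "a0 \<in> Linf (cylinder \<Omega> T)"
    and u: "primal_feasible \<Omega> W T \<nu> a0 a b u y" and v: "primal_feasible \<Omega> W T \<nu> a0 a b v w"
    and t: "0 \<le> t" "t \<le> 1"
  shows "primal_feasible \<Omega> W T \<nu> a0 a b (\<lambda>z. u z + t * (v z - u z)) (\<lambda>z. y z + t * (w z - y z))"
proof -
  let ?Q = "cylinder \<Omega> T" and ?O = "cylinder W T"
  have O: "?O \<subseteq> ?Q" "?O \<in> sets lebesgue" "?Q \<in> sets lebesgue" using \<Omega> by auto
  have L: "u \<in> L2 ?O" "v \<in> L2 ?O" using u v by (auto simp: primal_feasible_def control_set_def)
  have "(\<lambda>z. u z + t * (v z - u z)) \<in> L2 ?O" by (intro L2_add L2_mult L2_diff L)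
  moreover have "AE z in lebesgue_on ?O. a \<le> u z \<and> u z \<le> b" "AE z in lebesgue_on ?O. a \<le> v z \<and> v z \<le> b"
    using u v by (auto simp: primal_feasible_def control_set_def)
  then have "AE z in lebesgue_on ?O. a \<le> u z + t * (v z - u z) \<and> u z + t * (v z - u z) \<le> b"
  proof eventually_elim
    fix z assume z: "a \<le> u z \<and> u z \<le> b" "a \<le> v z \<and> v z \<le> b"
    have "u z + t * (v z - u z) = (1 - t) * u z + t * v z" by (simp add: algebra_simps)
    moreover have "(1 - t) * a + t * a \<le> (1 - t) * u z + t * v z" "(1 - t) * u z + t * v z \<le> (1 - t) * b + t * b"
      using z t by (auto intro!: add_mono mult_left_mono)
    ultimately show "a \<le> u z + t * (v z - u z) \<and> u z + t * (v z - u z) \<le> b"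
      by (simp add: algebra_simps)
  qed
  moreover obtain g where g: "weak_parabolic 1 (\<Omega> \<times> {..<T}) \<Omega> T \<nu> a0 (\<lambda>z. u z * indicator ?O z) y g"
    using u unfolding primal_feasible_def weak_forward_iff[OF \<Omega>(1) a0] by blast
  moreover obtain h where h: "weak_parabolic 1 (\<Omega> \<times> {..<T}) \<Omega> T \<nu> a0 (\<lambda>z. v z * indicator ?O z) w h"
    using v unfolding primal_feasible_def weak_forward_iff[OF \<Omega>(1) a0] by blast
  note E = L2_extend_zero[OF L(1) O] L2_extend_zero[OF L(2) O]
  have "weak_parabolic 1 (\<Omega> \<times> {..<T}) \<Omega> T \<nu> a0
      (\<lambda>z. u z * indicator ?O z + t * (v z * indicator ?O z + (- 1) * (u z * indicator ?O z)))
      (\<lambda>z. y z + t * (w z + (- 1) * y z)) (\<lambda>z. g z + t *\<^sub>R (h z + (- 1) *\<^sub>R g z))"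
    by (intro weak_parabolic_lincomb[OF \<Omega>(1) a0] g h E L2_add L2_mult)
  moreover have "(\<lambda>z. u z * indicator ?O z + t * (v z * indicator ?O z + (- 1) * (u z * indicator ?O z)))
      = (\<lambda>z. (u z + t * (v z - u z)) * indicator ?O z)"
    by (auto simp: algebra_simps)
  ultimately show ?thesis
    unfolding primal_feasible_def weak_forward_iff[OF \<Omega>(1) a0] control_set_def by auto
qed

text \<open>The adjoint state of \<open>yd - y\<close> closes the duality gap: moving from \<open>u\<close> towards the projected
  adjoint state gives the variational inequality that identifies the two.\<close>

lemma primal_solution_adjoint:
  fixes \<Omega> :: "(real^'n) set"
  assumes \<Omega>: "open \<Omega>" "open W" "W \<subseteq> \<Omega>" and T: "0 < T" and \<nu>: "0 < \<nu>" and \<gamma>: "0 < \<gamma>"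
    and a0: "a0 \<in> Linf (cylinder \<Omega> T)" "AE z in lebesgue_on (cylinder \<Omega> T). 0 \<le> a0 z"
    and ab: "a \<le> 0" "0 \<le> b" and yd: "yd \<in> L2 (cylinder \<Omega> T)"
    and u: "primal_solution \<Omega> W T \<nu> \<gamma> a0 yd a b u y"
  obtains r s where "dual_feasible \<Omega> T \<nu> a0 r s"
    "primal_cost \<Omega> W T \<gamma> yd u y + dual_cost \<Omega> W T \<gamma> yd a b r s = 0"
proof -
  let ?Q = "cylinder \<Omega> T" and ?O = "cylinder W T"
  have O: "?O \<subseteq> ?Q" "?O \<in> sets lebesgue" "?Q \<in> sets lebesgue" using \<Omega> by auto
  have uf: "primal_feasible \<Omega> W T \<nu> a0 a b u y" using u by (simp add: primal_solution_def)
  have yL: "y \<in> L2 ?Q"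
    using uf unfolding primal_feasible_def weak_forward_def energy_space_def by blast
  define r where "r z = yd z - y z" for z
  have rL: "r \<in> L2 ?Q" unfolding r_def[abs_def] by (intro L2_diff yd yL)
  obtain s h where "weak_parabolic (-1) (\<Omega> \<times> {0<..}) \<Omega> T \<nu> a0 r s h"
    using weak_parabolic_backward_exists[OF \<Omega>(1) \<nu> T a0 rL] by blast
  then have rs: "dual_feasible \<Omega> T \<nu> a0 r s"
    unfolding dual_feasible_def weak_backward_iff[OF \<Omega>(1) a0(1)] using rL by blast
  define \<pi> where "\<pi> = Pr_box a b (\<lambda>z. s z / \<gamma>)"
  note cost = primal_plus_dual_cost[OF \<Omega> T a0(1) \<gamma> ab yd uf rs, folded \<pi>_def]
  note D = primal_dual_duality[OF \<Omega> T a0(1) uf rs]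
  have \<pi>L: "\<pi> \<in> L2 ?O" using cost(3) by (simp add: control_set_def)
  obtain w g where "weak_parabolic 1 (\<Omega> \<times> {..<T}) \<Omega> T \<nu> a0 (\<lambda>z. \<pi> z * indicator ?O z) w g"
    using weak_parabolic_forward_exists[OF \<Omega>(1) \<nu> T a0 L2_extend_zero[OF \<pi>L O]] by blast
  then have \<pi>f: "primal_feasible \<Omega> W T \<nu> a0 a b \<pi> w"
    unfolding primal_feasible_def weak_forward_iff[OF \<Omega>(1) a0(1)] using cost(3) by blast
  note D' = primal_dual_duality[OF \<Omega> T a0(1) \<pi>f rs]
  have dL: "(\<lambda>z. w z - y z) \<in> L2 ?Q" "(\<lambda>z. \<pi> z - u z) \<in> L2 ?O" by (intro L2_diff D D' \<pi>L)+
  \<comment> \<open>Along the segment from \<open>u\<close> to \<open>\<pi>\<close> the cost changes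
    by \<open>t * A + t^2 * B\<close>; the sign in \<open>A\<close> comes from
    \<open>y - yd = - r\<close>.\<close>
  define A where "A = - L2_inner ?Q r (\<lambda>z. w z - y z) + \<gamma> * L2_inner ?O u (\<lambda>z. \<pi> z - u z)"
  define B where "B = 1/2 * (L2_norm ?Q (\<lambda>z. w z - y z))\<^sup>2 + \<gamma>/2 * (L2_norm ?O (\<lambda>z. \<pi> z - u z))\<^sup>2"
  have step: "0 \<le> t * A + t\<^sup>2 * B" if t: "0 \<le> t" "t \<le> 1" for t
  proof -
    have "primal_cost \<Omega> W T \<gamma> yd u y \<le> primal_cost \<Omega> W T \<gamma> yd (\<lambda>z. u z + t * (\<pi> z - u z)) (\<lambda>z. y z + t * (w z - y z))"
      using u primal_feasible_segment[OF \<Omega> a0(1) uf \<pi>f t] unfolding primal_solution_def by blast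
    moreover have "(L2_norm ?Q (\<lambda>z. y z + t * (w z - y z) - yd z))\<^sup>2
        = (L2_norm ?Q (\<lambda>z. y z - yd z))\<^sup>2 + 2 * t * L2_inner ?Q (\<lambda>z. y z - yd z) (\<lambda>z. w z - y z) + t\<^sup>2 * (L2_norm ?Q (\<lambda>z. w z - y z))\<^sup>2"
      using L2_norm_sq_add[OF L2_diff[OF yL yd] dL(1), of t] by (simp add: algebra_simps)
    moreover have "L2_inner ?Q (\<lambda>z. y z - yd z) (\<lambda>z. w z - y z) = - L2_inner ?Q r (\<lambda>z. w z - y z)"
      using L2_inner_scale_left[of ?Q "- 1" r "\<lambda>z. w z - y z"] by (simp add: r_def)
    moreover have "(L2_norm ?O (\<lambda>z. u z + t * (\<pi> z - u z)))\<^sup>2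
        = (L2_norm ?O u)\<^sup>2 + 2 * t * L2_inner ?O u (\<lambda>z. \<pi> z - u z) + t\<^sup>2 * (L2_norm ?O (\<lambda>z. \<pi> z - u z))\<^sup>2"
      using L2_norm_sq_add[OF D(1) dL(2), of t] by simp
    ultimately show ?thesis unfolding primal_cost_L2 A_def B_def by (simp add: field_simps)
  qed
  have B: "0 \<le> B" using \<gamma> by (simp add: B_def)
  have A: "0 \<le> A"
  proof (rule ccontr)
    assume "\<not> 0 \<le> A"
    \<comment> \<open>Small enough for \<open>t * B \<le> - A / 2\<close>, which makes
      \<open>A + t * B\<close> negative; \<open>B + 1\<close> keeps the divisor positive.\<close>
    define t where "t = min 1 (- A / (2 * (B + 1)))"
    have t: "0 < t" "t \<le> 1" using \<open>\<not> 0 \<le> A\<close> B by (auto simp: t_def intro!: divide_neg_pos)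
    have "t * B \<le> - A / (2 * (B + 1)) * (B + 1)" using B t by (intro mult_mono) (auto simp: t_def)
    also have "\<dots> = - A / 2"
      unfolding times_divide_eq_left by (rule mult_divide_mult_cancel_right) (use B in simp)
    finally have "A + t * B < 0" using \<open>\<not> 0 \<le> A\<close> by simp
    then have "t * (A + t * B) < 0" using t(1) by (rule mult_pos_neg[rotated])
    then show False using step[of t] t by (simp add: power2_eq_square algebra_simps)
  qed
  \<comment> \<open>Duality replaces the variation of the state by the variation of the control
    paired with the adjoint state.\<close>
  have i1: "L2_inner ?Q r (\<lambda>z. w z - y z) = L2_inner ?O \<pi> s - L2_inner ?O u s"
    using D(6) D'(6) L2_inner_diff_right[OF D'(2) D(2) rL] by (simp add: L2_inner_commute)
  have i2: "L2_inner ?O u (\<lambda>z. \<pi> z - u z) = L2_inner ?O u \<pi> - (L2_norm ?O u)\<^sup>2"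
    using L2_inner_diff_right[OF \<pi>L D(1) D(1)] by (simp add: L2_norm_sq)
  have i3: "0 \<le> \<gamma> * L2_inner ?O u \<pi> - \<gamma> * (L2_norm ?O \<pi>)\<^sup>2 - L2_inner ?O u s + L2_inner ?O \<pi> s"
    using Pr_box_variational_L2[OF \<gamma> ab _ D(5)] uf by (simp add: primal_feasible_def \<pi>_def L2_norm_sq)
  have i4: "(L2_norm ?O (\<lambda>z. u z - \<pi> z))\<^sup>2 = (L2_norm ?O u)\<^sup>2 - 2 * L2_inner ?O u \<pi> + (L2_norm ?O \<pi>)\<^sup>2"
    using L2_norm_sq_add[OF D(1) \<pi>L, of "- 1"] by simp
  \<comment> \<open>Optimality of \<open>u\<close> tested with \<open>\<pi>\<close> and optimality
    of \<open>\<pi>\<close> tested with \<open>u\<close> add up to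
    \<open>0 \<le> - \<gamma> * |u - \<pi>|^2\<close>; the pairings with \<open>s\<close>
    cancel.\<close>
  have "\<gamma> * (L2_norm ?O (\<lambda>z. u z - \<pi> z))\<^sup>2 \<le> 0"
    using A i3 unfolding A_def i1 i2 i4 by (simp add: algebra_simps)
  then have N: "L2_norm ?O (\<lambda>z. u z - \<pi> z) = 0" using \<gamma> by (simp add: mult_le_0_iff)
  \<comment> \<open>The functions \<open>u\<close> and \<open>\<pi>\<close> agree only almost
    everywhere, so they are exchanged inside inner products.\<close>
  have eq: "L2_inner ?O u k = L2_inner ?O \<pi> k" if "k \<in> L2 ?O" for k
    using L2_Cauchy_Schwarz[OF L2_diff[OF D(1) \<pi>L] that] L2_inner_diff_left[OF D(1) \<pi>L that] N by simp
  have "(L2_norm ?O u)\<^sup>2 = (L2_norm ?O \<pi>)\<^sup>2"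
    unfolding L2_norm_sq using eq[OF D(1)] eq[OF \<pi>L] by (simp add: L2_inner_commute)
  then have G: "\<gamma>/2 * (L2_norm ?O u)\<^sup>2 - L2_inner ?O u s + L2_inner ?O s \<pi> - \<gamma>/2 * (L2_norm ?O \<pi>)\<^sup>2 = 0"
    using eq[OF D(5)] by (simp add: L2_inner_commute)
  have "(\<lambda>z. y z - (yd z - r z)) = (\<lambda>z. 0)" by (simp add: r_def)
  then have "primal_cost \<Omega> W T \<gamma> yd u y + dual_cost \<Omega> W T \<gamma> yd a b r s = 0"
    unfolding cost(1) G by simp
  then show ?thesis using that rs by blast
qed

theorem mainTheorem3:
  fixes \<Omega> W :: "(real^'n) set"
    and T \<nu> \<gamma> a b :: real
    and a0 yd u y q p :: "(real^'n) \<times> real \<Rightarrow> real"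
  assumes "is_domain \<Omega>" and "piecewise_continuous_boundary \<Omega>"
    and "open W" and "W \<subseteq> \<Omega>"
    and "0 < T" and "0 < \<nu>" and "0 < \<gamma>"
    and "a0 \<in> Linf (cylinder \<Omega> T)"
    and "AE z in lebesgue_on (cylinder \<Omega> T). 0 \<le> a0 z"
    and "yd \<in> L2 (cylinder \<Omega> T)"
    and "a \<le> 0" and "0 \<le> b"
    and "primal_solution \<Omega> W T \<nu> \<gamma> a0 yd a b u y"
    and "dual_solution \<Omega> W T \<nu> \<gamma> a0 yd a b q p"
  shows "L2_eq (cylinder W T) u (Pr_box a b (\<lambda>z. p z / \<gamma>)) \<and>
         L2_eq (cylinder \<Omega> T) y (\<lambda>z. yd z - q z)"
proof -
  let ?Q = "cylinder \<Omega> T" and ?O = "cylinder W T" and ?\<pi> = "Pr_box a b (\<lambda>z. p z / \<gamma>)"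
  have \<Omega>: "open \<Omega>" using assms(1) by (simp add: is_domain_def)
  have uf: "primal_feasible \<Omega> W T \<nu> a0 a b u y" and qf: "dual_feasible \<Omega> T \<nu> a0 q p"
    using assms(13,14) by (simp_all add: primal_solution_def dual_solution_def)
  note cost = primal_plus_dual_cost[OF \<Omega> assms(3-5,8,7,11,12,10) uf qf]
  note D = primal_dual_duality[OF \<Omega> assms(3-5,8) uf qf]
  obtain r s where rs: "dual_feasible \<Omega> T \<nu> a0 r s"
    "primal_cost \<Omega> W T \<gamma> yd u y + dual_cost \<Omega> W T \<gamma> yd a b r s = 0"
    using primal_solution_adjoint[OF \<Omega> assms(3-9,11,12,10,13)] by blast
  \<comment> \<open>The adjoint pair is a competitor in the dual problem, so the two optimal costs
    add up to at most 0, while their sum dominates both squares below.\<close>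
  have "dual_cost \<Omega> W T \<gamma> yd a b q p \<le> dual_cost \<Omega> W T \<gamma> yd a b r s"
    using assms(14) rs(1) unfolding dual_solution_def by blast
  then have "1/2 * (L2_norm ?Q (\<lambda>z. y z - (yd z - q z)))\<^sup>2 + \<gamma>/2 * (L2_norm ?O (\<lambda>z. u z - ?\<pi> z))\<^sup>2 \<le> 0"
    using cost(1,2) rs(2) by linarith
  moreover have "0 \<le> \<gamma>/2 * (L2_norm ?O (\<lambda>z. u z - ?\<pi> z))\<^sup>2" using assms(7) by simp
  moreover have "0 \<le> 1/2 * (L2_norm ?Q (\<lambda>z. y z - (yd z - q z)))\<^sup>2" by simp
  ultimately have "\<gamma>/2 * (L2_norm ?O (\<lambda>z. u z - ?\<pi> z))\<^sup>2 = 0" "1/2 * (L2_norm ?Q (\<lambda>z. y z - (yd z - q z)))\<^sup>2 = 0"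
    by linarith+
  then have zero: "L2_norm ?O (\<lambda>z. u z - ?\<pi> z) = 0" "L2_norm ?Q (\<lambda>z. y z - (yd z - q z)) = 0"
    using assms(7) by simp_all
  have L: "?\<pi> \<in> L2 ?O" "(\<lambda>z. yd z - q z) \<in> L2 ?Q"
    using cost(3) L2_diff[OF assms(10) D(3)] by (simp_all add: control_set_def)
  show ?thesis
    unfolding L2_eq_def
    using L D L2_norm_eq_0_AE[OF L2_diff[OF D(1) L(1)] zero(1)] L2_norm_eq_0_AE[OF L2_diff[OF D(2) L(2)] zero(2)]
    by simp
qed

end
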